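(* For every $\mu\in\mathrm{Prob}([-R,R]^n)$ with marginals $\mu_1,\dots,\mu_n$, $$H(\mu)=-\mathcal{I}_\mathrm{sym}(\mu)+\sum_{i=1}^nH(\mu_i).$$ Moreover, if $H(\mu_i)>-\infty$ for all $i$, then $\mathcal{I}_\mathrm{sym}(\mu)=I_\mathrm{sym}(\mu)=S(\mu\,\|\,\mu_1\otimes\cdots\otimes\mu_n)$, and $\mathcal{I}_\mathrm{sym}(\mu)=0$ if and only if $\mu=\mu_1\otimes\cdots\otimes\mu_n$.
   Context: Fix $R>0$ and $n\in\mathbb{N}$. $\mathrm{Prob}([-R,R]^k)$ denotes Borel probability measures on $[-R,R]^k$; $C_\mathbb{R}([-R,R]^n)$ real continuous functions with sup-norm; $\mu(h)=\int h\,d\mu$; $\mu_i$ is the $i$th marginal of $\mu$. The Boltzmann–Gibbs entropy is $H(\mu)=-\int p\log p\,d\mathbf{x}$ if $\mu$ has Lebesgue density $p$, else $H(\mu)=-\infty$; $S(\cdot\,\|\,\cdot)$ is relative entropy (Kullback–Leibler divergence). For $\mathbf{x}\in\mathbb{R}^N$ let $\kappa_N(\mathbf{x})=\frac1N\sum_jx_j$, with products and powers of vectors coordinatewise. $[-R,R]_\le^N$ is the set of vectors in $[-R,R]^N$ with nondecreasing coordinates; $S_N$ acts by $\sigma(\mathbf{x})=(x_{\sigma^{-1}(1)},\dots,x_{\sigma^{-1}(N)})$; $\gamma_{S_N}$ is the uniform probability on $S_N$. An approximating sequence for $(\mu_1,\dots,\mu_n)$ is $\Xi(N)=(\xi_1(N),\dots,\xi_n(N))$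 with $\xi_i(N)\in[-R,R]_\le^N$ and $\kappa_N(\xi_i(N)^k)\to\int x^k\,d\mu_i$ for all $k$. $\Delta_R(\mu;N,m,\delta)$ is the set of $(\mathbf{x}_1,\dots,\mathbf{x}_n)\in([-R,R]^N)^n$ with $|\kappa_N(\mathbf{x}_{i_1}\cdots\mathbf{x}_{i_k})-\int x_{i_1}\cdots x_{i_k}\,d\mu|<\delta$ for all $i_1,\dots,i_k\in\{1,\dots,n\}$, $1\le k\le m$; $\Delta_\mathrm{sym}(\mu:\Xi(N);N,m,\delta)$ is the set of $(\sigma_1,\dots,\sigma_n)\in S_N^n$ with $(\sigma_1(\xi_1(N)),\dots,\sigma_n(\xi_n(N)))\in\Delta_R(\mu;N,m,\delta)$; and $I_\mathrm{sym}(\mu)=-\lim_{m\to\infty,\delta\searrow0}\limsup_{N\to\infty}\frac1N\log\gamma_{S_N}^{\otimes n}(\Delta_\mathrm{sym}(\mu:\Xi(N);N,m,\delta))$. For $h\in C_\mathbb{R}([-R,R]^n)$, $\kappa_N(h(\mathbf{x}_1,\dots,\mathbf{x}_n))=\frac1N\sum_{j=1}^Nh(x_{1j},\dots,x_{nj})$, the mutual pressure is $$P_\mathrm{sym}(h:\mu_1,\dots,\mu_n)=\limsup_{N\to\infty}\frac1N\log\Biggl[\frac1{(N!)^n}\sum_{\sigma_1,\dots,\sigma_n\in S_N}\exp\bigl(N\kappa_N(h(\sigma_1(\xi_1(N)),\dots,\sigma_n(\xi_n(N))))\bigr)\Biggr],$$ and $\mathcal{I}_\mathrm{sym}(\mu)=\sup\{\mu(h)-P_\mathrm{sym}(h:\mu_1,\dots,\mu_n):h\in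 C_\mathbb{R}([-R,R]^n)\}\in[0,\infty]$. These quantities are independent of the approximating sequence. *)

theory Defs
  imports "HOL-Probability.Probability"
begin

text \<open>Points of R^n are extensional functions nat => real supported on {..<n}
  (indices 0..n-1 play the role of 1..n).\<close>

definition cube :: "real \<Rightarrow> nat \<Rightarrow> (nat \<Rightarrow> real) set" where
  "cube R n = PiE {..<n} (\<lambda>_. {-R..R})"

definition lebn :: "nat \<Rightarrow> (nat \<Rightarrow> real) measure" where
  "lebn n = PiM {..<n} (\<lambda>_. lborel)"

definition Prob_cube :: "real \<Rightarrow> nat \<Rightarrow> (nat \<Rightarrow> real) measure set" where
  "Prob_cube R n = {\<mu>. prob_space \<mu> \<and> sets \<mu> = sets (lebn n) \<and> emeasure \<mu> (cube R n) = 1}"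

definition marg :: "(nat \<Rightarrow> real) measure \<Rightarrow> nat \<Rightarrow> real measure" where
  "marg \<mu> i = distr \<mu> lborel (\<lambda>x. x i)"

text \<open>Boltzmann-Gibbs entropy w.r.t. the Lebesgue measure L:
  -int p log p if mu has a density p, and -infinity otherwise (for compactly supported
  measures the positive part of -p log p is integrable, so non-integrability means -infinity).\<close>
definition bg_entropy :: "'a measure \<Rightarrow> 'a measure \<Rightarrow> ereal" where
  "bg_entropy L \<mu> =
    (if \<exists>p. p \<in> borel_measurable L \<and> (\<forall>x. 0 \<le> p x) \<and> \<mu> = density L (\<lambda>x. ennreal (p x))
     then (let p = (SOME p. p \<in> borel_measurable L \<and> (\<forall>x. 0 \<le> p x) \<and>
                         \<mu> = density L (\<lambda>x. ennreal (p x)))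
           in if integrable L (\<lambda>x. p x * ln (p x))
              then ereal (- (\<integral>x. p x * ln (p x) \<partial>L)) else -\<infinity>)
     else -\<infinity>)"

definition rel_entropy :: "'a measure \<Rightarrow> 'a measure \<Rightarrow> ereal" where
  "rel_entropy \<mu> \<nu> =
    (if sets \<mu> = sets \<nu> \<and> absolutely_continuous \<nu> \<mu>
     then (let f = (\<lambda>x. enn2real (RN_deriv \<nu> \<mu> x))
           in if integrable \<nu> (\<lambda>x. f x * ln (f x))
              then ereal (\<integral>x. f x * ln (f x) \<partial>\<nu>) else \<infinity>)
     else \<infinity>)"

definition elog :: "real \<Rightarrow> ereal" where
  "elog x = (if x \<le> 0 then -\<infinity> else ereal (ln x))"

definition kappa :: "nat \<Rightarrow> (nat \<Rightarrow> real) \<Rightarrow> real" where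
  "kappa N x = (\<Sum>j<N. x j) / real N"

definition perms :: "nat \<Rightarrow> (nat \<Rightarrow> nat) set" where
  "perms N = {\<sigma>. \<sigma> permutes {..<N}}"

definition act :: "(nat \<Rightarrow> nat) \<Rightarrow> (nat \<Rightarrow> real) \<Rightarrow> (nat \<Rightarrow> real)" where
  "act \<sigma> x = (\<lambda>j. x (inv \<sigma> j))"

text \<open>Xi i N j is the j-th coordinate of xi_i(N).\<close>
definition xi_vec :: "(nat \<Rightarrow> nat \<Rightarrow> nat \<Rightarrow> real) \<Rightarrow> nat \<Rightarrow> nat \<Rightarrow> (nat \<Rightarrow> real)" where
  "xi_vec \<Xi> i N = restrict (\<Xi> i N) {..<N}"

definition approx_seq :: "real \<Rightarrow> nat \<Rightarrow> (nat \<Rightarrow> real) measure \<Rightarrow> (nat \<Rightarrow> nat \<Rightarrow> nat \<Rightarrow> real) \<Rightarrow> bool" where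
  "approx_seq R n \<mu> \<Xi> \<longleftrightarrow>
     (\<forall>i<n. \<forall>N. (\<forall>j<N. \<Xi> i N j \<in> {-R..R}) \<and> (\<forall>j k. j \<le> k \<and> k < N \<longrightarrow> \<Xi> i N j \<le> \<Xi> i N k)) \<and>
     (\<forall>i<n. \<forall>k::nat. (\<lambda>N. kappa N (\<lambda>j. (\<Xi> i N j) ^ k)) \<longlonglongrightarrow> (\<integral>x. x ^ k \<partial>(marg \<mu> i)))"

definition Delta_R :: "real \<Rightarrow> (nat \<Rightarrow> real) measure \<Rightarrow> nat \<Rightarrow> nat \<Rightarrow> nat \<Rightarrow> real \<Rightarrow> (nat \<Rightarrow> nat \<Rightarrow> real) set" where
  "Delta_R R \<mu> n N m \<delta> =
    {X \<in> PiE {..<n} (\<lambda>_. PiE {..<N} (\<lambda>_. {-R..R})).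
       \<forall>is. set is \<subseteq> {..<n} \<and> 1 \<le> length is \<and> length is \<le> m \<longrightarrow>
         \<bar>kappa N (\<lambda>j. prod_list (map (\<lambda>i. X i j) is)) - (\<integral>y. prod_list (map (\<lambda>i. y i) is) \<partial>\<mu>)\<bar> < \<delta>}"

definition Delta_sym :: "real \<Rightarrow> (nat \<Rightarrow> real) measure \<Rightarrow> (nat \<Rightarrow> nat \<Rightarrow> nat \<Rightarrow> real) \<Rightarrow> nat \<Rightarrow> nat \<Rightarrow> nat \<Rightarrow> real \<Rightarrow> (nat \<Rightarrow> nat \<Rightarrow> nat) set" where
  "Delta_sym R \<mu> \<Xi> n N m \<delta> =
    {s \<in> PiE {..<n} (\<lambda>_. perms N). (\<lambda>i\<in>{..<n}. act (s i) (xi_vec \<Xi> i N)) \<in> Delta_R R \<mu> n N m \<delta>}"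

text \<open>I_sym(mu); gamma^{(x)n}(Delta) = card Delta / (N!)^n. The limit over m -> infinity,
  delta -> 0 is monotone (Delta_sym shrinks), hence equals the infimum.\<close>
definition Isym :: "real \<Rightarrow> nat \<Rightarrow> (nat \<Rightarrow> real) measure \<Rightarrow> (nat \<Rightarrow> nat \<Rightarrow> nat \<Rightarrow> real) \<Rightarrow> ereal" where
  "Isym R n \<mu> \<Xi> =
    - (INF m. INF \<delta>\<in>{0<..}.
         limsup (\<lambda>N. ereal (1 / real N) *
           elog (real (card (Delta_sym R \<mu> \<Xi> n N m \<delta>)) / (fact N) ^ n)))"

definition Psym :: "nat \<Rightarrow> (nat \<Rightarrow> nat \<Rightarrow> nat \<Rightarrow> real) \<Rightarrow> ((nat \<Rightarrow> real) \<Rightarrow> real) \<Rightarrow> ereal" where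
  "Psym n \<Xi> h =
    limsup (\<lambda>N. ereal (1 / real N) *
      elog ((\<Sum>s\<in>PiE {..<n} (\<lambda>_. perms N).
               exp (\<Sum>j<N. h (\<lambda>i\<in>{..<n}. act (s i) (xi_vec \<Xi> i N) j))) / (fact N) ^ n))"

definition Isym_cal :: "real \<Rightarrow> nat \<Rightarrow> (nat \<Rightarrow> real) measure \<Rightarrow> (nat \<Rightarrow> nat \<Rightarrow> nat \<Rightarrow> real) \<Rightarrow> ereal" where
  "Isym_cal R n \<mu> \<Xi> =
    (SUP h\<in>{h. continuous_on (cube R n) h}.
       ereal (LINT x:cube R n|\<mu>. h x) - Psym n \<Xi> h)"

end

theory Submission
  imports Defs "HOL-Real_Asymp.Real_Asymp"
begin

text \<open>
  Let \<open>\<nu>\<close> be the product of the marginals of \<open>\<mu>\<close> and \<open>S = S(\<mu> \<parallel> \<nu>)\<close>. The proof closes the cycle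
  \<open>S \<le> \<I>\<^sub>s\<^sub>y\<^sub>m(\<mu>) \<le> I\<^sub>s\<^sub>y\<^sub>m(\<mu>) \<le> S\<close>.

  \<^item> After rounding coordinates to a finite grid, averaging over permutations is dominated, up to a
    polynomial factor, by averaging over all maps \<open>[N] \<rightarrow> [N]\<close>, where the sum factorises. Hence
    \<open>P\<^sub>s\<^sub>y\<^sub>m(h) \<le> ln \<nu>(exp h)\<close>, and the Donsker-Varadhan formula gives the first inequality.
  \<^item> On \<open>\<Delta>\<^sub>s\<^sub>y\<^sub>m\<close> the empirical mean of \<open>h\<close> is close to \<open>\<mu>(h)\<close> by Stone-Weierstrass; this gives the second.
  \<^item> For the set \<open>\<Gamma>\<close> of samples with almost the moments of \<open>\<mu>\<close>, \<open>\<mu>\<^sup>N(\<Gamma>) \<rightarrow> 1\<close> and the entropy inequality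
    with test function \<open>t 1\<^sub>\<Gamma>\<close> bounds \<open>\<nu>\<^sup>N(\<Gamma>)\<close> below by \<open>exp(-N(S + o(1)))\<close>. Since \<open>\<nu>\<^sup>N\<close> is invariant
    under independent permutations of the coordinates, some sample has at least that proportion of
    its rearrangements in \<open>\<Gamma>\<close>, and once sorted it is close to the approximating sequence.

  The entropy identity is the chain rule for densities; if some \<open>H(\<mu>\<^sub>i) = -\<infinity>\<close>, comparison with the uniform
  law on the cube and the data processing inequality force \<open>H(\<mu>) = -\<infinity>\<close>.
\<close>

subsection \<open>Permutations versus arbitrary maps\<close>

lemma power_div_exp_le_fact: "(real n / exp 1) ^ n \<le> fact n"
proof -
  have "(\<Sum>k\<in>{n}. real n ^ k /\<^sub>R fact k) \<le> (\<Sum>k. real n ^ k /\<^sub>R fact k)"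
    by (rule sum_le_suminf[OF summable_exp_generic]) auto
  then have "real n ^ n / fact n \<le> exp (real n)"
    by (simp add: exp_def divide_inverse mult.commute)
  also have "exp (real n) = exp 1 ^ n"
    by (simp flip: exp_of_nat_mult)
  finally show ?thesis
    by (simp add: power_divide field_simps)
qed

lemma fact_le_power_div_exp:
  assumes "n > 0"
  shows "fact n \<le> exp 1 * real n * (real n / exp 1) ^ n"
  using assms
proof (induction n rule: nat_induct_non_zero)
  case (Suc n)
  let ?m = "real (Suc n)"
  have "(real n / ?m) ^ Suc n = (1 - 1 / ?m) ^ Suc n"
    by (simp add: field_simps)
  also have "\<dots> \<le> exp (- 1)"
    using exp_ge_one_minus_x_over_n_power_n[of 1 "Suc n"] by simp
  finally have power_le: "exp 1 * real n ^ Suc n \<le> ?m ^ Suc n"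
    by (simp add: power_divide divide_le_eq exp_minus field_simps del: power_Suc of_nat_Suc)
  have "fact (Suc n) \<le> ?m * (exp 1 * real n * (real n / exp 1) ^ n)"
    using Suc.IH by (simp only: fact_Suc of_nat_mult mult_left_mono of_nat_0_le_iff)
  also have "\<dots> = ?m * (exp 1 * real n ^ Suc n) / exp 1 ^ n"
    by (simp add: power_divide)
  also have "\<dots> \<le> ?m * ?m ^ Suc n / exp 1 ^ n"
    using power_le by (intro divide_right_mono mult_left_mono) auto
  also have "\<dots> = exp 1 * ?m * (?m / exp 1) ^ Suc n"
    by (simp add: power_divide)
  finally show ?case .
qed simp

lemma prod_fact_mult_power_le:
  fixes m :: "'b \<Rightarrow> nat"
  assumes "finite B" and sum: "(\<Sum>b\<in>B. m b) = N"
  shows "(\<Prod>b\<in>B. fact (m b)) * real N ^ N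
    \<le> fact N * (exp 1 * real (N + 1)) ^ card B * (\<Prod>b\<in>B. real (m b) ^ m b)"
proof -
  have fact_le: "fact (m b) \<le> exp 1 * real (N + 1) * (real (m b) / exp 1) ^ m b" if "b \<in> B" for b
  proof (cases "m b = 0")
    case True
    have "1 * 1 \<le> exp 1 * real (N + 1)" by (intro mult_mono) auto
    then show ?thesis using True by simp
  next
    case False
    have "m b \<le> N" using member_le_sum[of b B m] that assms by auto
    have "fact (m b) \<le> exp 1 * real (m b) * (real (m b) / exp 1) ^ m b"
      using False by (intro fact_le_power_div_exp) simp
    also have "\<dots> \<le> exp 1 * real (N + 1) * (real (m b) / exp 1) ^ m b"
      using \<open>m b \<le> N\<close> by (intro mult_right_mono mult_left_mono) auto
    finally show ?thesis .
  qed
  have "(\<Prod>b\<in>B. fact (m b)) * real N ^ N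
    \<le> (\<Prod>b\<in>B. (exp 1 * real (N + 1)) * (real (m b) / exp 1) ^ m b) * real N ^ N"
    using fact_le by (intro mult_right_mono prod_mono) auto
  also have "\<dots> = (real N / exp 1) ^ N * (exp 1 * real (N + 1)) ^ card B * (\<Prod>b\<in>B. real (m b) ^ m b)"
    using sum by (simp add: prod.distrib power_divide prod_dividef flip: power_sum)
  also have "\<dots> \<le> fact N * (exp 1 * real (N + 1)) ^ card B * (\<Prod>b\<in>B. real (m b) ^ m b)"
    by (intro mult_right_mono power_div_exp_le_fact prod_nonneg) auto
  finally show ?thesis .
qed

lemma card_perms: "card (perms N) = fact N"
  unfolding perms_def using card_permutations[of "{..<N}" N] by simp

lemma finite_perms [simp]: "finite (perms N)"
  unfolding perms_def by (rule finite_permutations) simp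

lemma inv_perms: "\<sigma> \<in> perms N \<Longrightarrow> inv \<sigma> \<in> perms N"
  by (simp add: perms_def permutes_inv)

lemma perms_less: "\<sigma> \<in> perms N \<Longrightarrow> j < N \<Longrightarrow> \<sigma> j < N"
  using permutes_in_image[of \<sigma> "{..<N}" j] by (simp add: perms_def)

lemma perms_inverses:
  assumes "\<sigma> \<in> perms N"
  shows "\<sigma> (inv \<sigma> j) = j" "inv \<sigma> (\<sigma> j) = j"
  using assms by (simp_all add: perms_def permutes_inverses)

lemma perms_eqI:
  assumes "\<sigma> \<in> perms N" "\<tau> \<in> perms N" and "\<And>j. j < N \<Longrightarrow> inv \<sigma> j = inv \<tau> j"
  shows "\<sigma> = \<tau>"
proof -
  have "inv \<sigma> j = inv \<tau> j" for j
    using assms(3) inv_perms[OF assms(1)] inv_perms[OF assms(2)]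
    by (cases "j < N") (auto simp: perms_def permutes_not_in)
  then have "inv \<sigma> = inv \<tau>" by (rule ext)
  then show ?thesis
    using assms(1,2) permutes_inv_inv unfolding perms_def mem_Collect_eq by metis
qed

lemma card_colour_class:
  assumes \<sigma>: "\<sigma> \<in> perms N" and colour: "\<And>j. j < N \<Longrightarrow> c (inv \<sigma> j) = t j"
  shows "card {j. j < N \<and> t j = b} = card {k. k < N \<and> c k = b}"
proof (rule card_bij_eq[of "inv \<sigma>" _ _ \<sigma>])
  show "inv \<sigma> ` {j. j < N \<and> t j = b} \<subseteq> {k. k < N \<and> c k = b}"
    using perms_less[OF inv_perms[OF \<sigma>]] colour by auto
  show "\<sigma> ` {k. k < N \<and> c k = b} \<subseteq> {j. j < N \<and> t j = b}"
    using perms_less[OF \<sigma>] colour perms_inverses[OF \<sigma>] by force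
qed (auto intro: inj_on_inverseI[of _ \<sigma>] inj_on_inverseI[of _ "inv \<sigma>"] simp: perms_inverses[OF \<sigma>])

lemma card_perms_pattern_le_prod_card_inj:
  fixes c t :: "nat \<Rightarrow> 'b"
  assumes "finite B" and colours: "c ` {..<N} \<subseteq> B"
  shows "card {\<sigma>\<in>perms N. \<forall>j<N. c (inv \<sigma> j) = t j}
    \<le> (\<Prod>b\<in>B. card {g \<in> {j. j < N \<and> t j = b} \<rightarrow>\<^sub>E {k. k < N \<and> c k = b}. inj_on g {j. j < N \<and> t j = b}})"
    (is "card ?S \<le> (\<Prod>b\<in>B. card (?I b))")
proof -
  define \<Phi> where "\<Phi> \<sigma> = (\<lambda>b\<in>B. restrict (inv \<sigma>) {j. j < N \<and> t j = b})" for \<sigma> :: "nat \<Rightarrow> nat"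
  have inv_mem: "inv \<sigma> j < N" "c (inv \<sigma> j) = t j" if "\<sigma> \<in> ?S" "j < N" for \<sigma> j
    using that perms_less[OF inv_perms] by auto
  have "inj_on \<Phi> ?S"
  proof (rule inj_onI)
    fix \<sigma> \<tau> assume \<sigma>: "\<sigma> \<in> ?S" and \<tau>: "\<tau> \<in> ?S" and same_image: "\<Phi> \<sigma> = \<Phi> \<tau>"
    show "\<sigma> = \<tau>"
    proof (rule perms_eqI)
      fix j assume "j < N"
      then have "t j \<in> B" using inv_mem[OF \<sigma>] colours by force
      moreover have "\<Phi> \<sigma> (t j) j = \<Phi> \<tau> (t j) j" using same_image by simp
      ultimately show "inv \<sigma> j = inv \<tau> j" using \<open>j < N\<close> by (simp add: \<Phi>_def)
    qed (use \<sigma> \<tau> in auto)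
  qed
  moreover have "\<Phi> ` ?S \<subseteq> PiE B ?I"
  proof (rule image_subsetI)
    fix \<sigma> assume \<sigma>: "\<sigma> \<in> ?S"
    then have "inj_on (inv \<sigma>) A" for A
      by (intro inj_on_inverseI[of _ \<sigma>]) (auto simp: perms_inverses)
    then show "\<Phi> \<sigma> \<in> PiE B ?I"
      using inv_mem[OF \<sigma>] unfolding \<Phi>_def restrict_PiE_iff by (auto simp: inj_on_restrict_eq)
  qed
  moreover have "finite (PiE B ?I)"
    using \<open>finite B\<close> by (intro finite_PiE finite_subset[OF Collect_restrict] finite_PiE) auto
  ultimately show ?thesis
    unfolding card_PiE[OF \<open>finite B\<close>, symmetric] by (rule card_inj_on_le)
qed

lemma card_perms_pattern_le:
  fixes c t :: "nat \<Rightarrow> 'b"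
  assumes "finite B" and "c ` {..<N} \<subseteq> B"
  shows "card {\<sigma>\<in>perms N. \<forall>j<N. c (inv \<sigma> j) = t j} \<le> (\<Prod>b\<in>B. fact (card {k. k < N \<and> c k = b}))"
    (is "card ?S \<le> _")
proof (cases "?S = {}")
  case False
  then obtain \<sigma> where \<sigma>: "\<sigma> \<in> perms N" "\<And>j. j < N \<Longrightarrow> c (inv \<sigma> j) = t j" by auto
  have "card {g \<in> {j. j < N \<and> t j = b} \<rightarrow>\<^sub>E {k. k < N \<and> c k = b}. inj_on g {j. j < N \<and> t j = b}}
      = fact (card {k. k < N \<and> c k = b})" for b
  proof -
    have "card {j. j < N \<and> t j = b} = card {k. k < N \<and> c k = b}"
      using card_colour_class[of \<sigma> N c t] \<sigma> by simp
    then show ?thesis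
      by (subst card_inj_on_subset_funcset) (auto simp: fact_prod_rev)
  qed
  then show ?thesis
    using card_perms_pattern_le_prod_card_inj[OF assms, of t] by simp
next
  case True
  show ?thesis unfolding True by simp
qed

lemma card_maps_pattern:
  fixes c t :: "nat \<Rightarrow> 'b"
  assumes "finite B" and colours: "c ` {..<N} \<subseteq> B"
    and \<sigma>: "\<sigma> \<in> perms N" "\<And>j. j < N \<Longrightarrow> c (inv \<sigma> j) = t j"
  shows "card {f \<in> {..<N} \<rightarrow>\<^sub>E {..<N}. \<forall>j<N. c (f j) = t j}
    = (\<Prod>b\<in>B. card {k. k < N \<and> c k = b} ^ card {k. k < N \<and> c k = b})"
proof -
  let ?T = "\<lambda>b. {j. j < N \<and> t j = b}" and ?K = "\<lambda>b. {k. k < N \<and> c k = b}"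
  have "{f \<in> {..<N} \<rightarrow>\<^sub>E {..<N}. \<forall>j<N. c (f j) = t j} = PiE {..<N} (\<lambda>j. ?K (t j))"
    by (simp only: set_eq_iff PiE_iff mem_Collect_eq lessThan_iff Ball_def) blast
  then have "card {f \<in> {..<N} \<rightarrow>\<^sub>E {..<N}. \<forall>j<N. c (f j) = t j} = (\<Prod>j<N. card (?K (t j)))"
    by (simp add: card_PiE)
  also have "\<dots> = (\<Prod>b\<in>B. \<Prod>j\<in>{j\<in>{..<N}. t j = b}. card (?K (t j)))"
    using \<open>finite B\<close> colours \<sigma> perms_less[OF inv_perms[OF \<sigma>(1)]] by (intro prod.group[symmetric]) force+
  also have "\<dots> = (\<Prod>b\<in>B. card (?K b) ^ card (?T b))"
    by (intro prod.cong) (auto simp: lessThan_def)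
  finally show ?thesis using card_colour_class[of \<sigma> N c t] \<sigma> by simp
qed

text \<open>A pattern with \<open>m\<^sub>b\<close> points of colour \<open>b\<close> is realised by at most \<open>\<Prod> m\<^sub>b!\<close> of the \<open>N!\<close> permutations and
  by \<open>\<Prod> m\<^sub>b ^ m\<^sub>b\<close> of the \<open>N ^ N\<close> maps, and \<open>m!\<close> equals \<open>(m / e) ^ m\<close> up to a polynomial factor.\<close>

lemma card_perms_pattern_le_card_maps_pattern:
  fixes c t :: "nat \<Rightarrow> 'b"
  assumes B: "finite B" "c ` {..<N} \<subseteq> B"
  shows "real (card {\<sigma>\<in>perms N. \<forall>j<N. c (inv \<sigma> j) = t j}) * real N ^ N
    \<le> fact N * (exp 1 * real (N + 1)) ^ card B
       * real (card {f\<in>{..<N} \<rightarrow>\<^sub>E {..<N}. \<forall>j<N. c (f j) = t j})"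
    (is "real (card ?S) * _ \<le> _ * real (card ?F)")
proof (cases "?S = {}")
  case False
  then obtain \<sigma> where \<sigma>: "\<sigma> \<in> perms N" "\<And>j. j < N \<Longrightarrow> c (inv \<sigma> j) = t j" by auto
  let ?m = "\<lambda>b. card {k. k < N \<and> c k = b}"
  have "(\<Sum>b\<in>B. ?m b) = card (\<Union>b\<in>B. {k. k < N \<and> c k = b})"
    using B by (intro card_UN_disjoint[symmetric]) auto
  also have "(\<Union>b\<in>B. {k. k < N \<and> c k = b}) = {..<N}" using B by auto
  finally have sum: "(\<Sum>b\<in>B. ?m b) = N" by simp
  have "real (card ?S) \<le> (\<Prod>b\<in>B. fact (?m b))"
    using of_nat_mono[OF card_perms_pattern_le[OF B, of t], where 'a = real] by simp
  then have "real (card ?S) * real N ^ N \<le> (\<Prod>b\<in>B. fact (?m b)) * real N ^ N"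
    by (rule mult_right_mono) simp
  also have "\<dots> \<le> fact N * (exp 1 * real (N + 1)) ^ card B * (\<Prod>b\<in>B. real (?m b) ^ ?m b)"
    by (rule prod_fact_mult_power_le[OF B(1) sum])
  also have "(\<Prod>b\<in>B. real (?m b) ^ ?m b) = real (card ?F)"
    by (simp add: card_maps_pattern[OF B \<sigma>])
  finally show ?thesis .
next
  case True
  show ?thesis unfolding True by simp
qed

lemma sum_le_sum_fibrewise:
  fixes F :: "'a \<Rightarrow> real" and G :: "'b \<Rightarrow> real"
  assumes fin: "finite S" "finite T" and nonneg: "0 \<le> A" "\<And>t. t \<in> T \<Longrightarrow> 0 \<le> G t"
    and card: "\<And>x. real (card {s\<in>S. \<phi> s = x}) \<le> C * real (card {t\<in>T. \<psi> t = x})"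
    and fibre_le: "\<And>s t. s \<in> S \<Longrightarrow> t \<in> T \<Longrightarrow> \<phi> s = \<psi> t \<Longrightarrow> F s \<le> A * G t"
  shows "sum F S \<le> C * A * sum G T"
proof -
  have fibre: "sum F {s\<in>S. \<phi> s = x} \<le> C * A * sum G {t\<in>T. \<psi> t = x}" for x
  proof (cases "{t\<in>T. \<psi> t = x} = {}")
    case True
    then have "card {s\<in>S. \<phi> s = x} = 0" using card[of x] by (simp only: card.empty)
    then have "{s\<in>S. \<phi> s = x} = {}" using fin by simp
    then show ?thesis unfolding True by (simp only: sum.empty)
  next
    case False
    let ?S = "{s\<in>S. \<phi> s = x}" and ?T = "{t\<in>T. \<psi> t = x}"
    have card_T: "real (card ?T) > 0" using False fin by (simp add: card_gt_0_iff)
    have "real (card ?T) * sum F ?S = (\<Sum>s\<in>?S. \<Sum>t\<in>?T. F s)"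
      by (simp add: sum_distrib_left)
    also have "\<dots> \<le> (\<Sum>s\<in>?S. \<Sum>t\<in>?T. A * G t)"
      using fibre_le by (intro sum_mono) auto
    also have "\<dots> = real (card ?S) * (A * sum G ?T)"
      by (simp add: sum_distrib_left)
    also have "\<dots> \<le> C * real (card ?T) * (A * sum G ?T)"
      using nonneg by (intro mult_right_mono card mult_nonneg_nonneg sum_nonneg) auto
    finally have "real (card ?T) * sum F ?S \<le> real (card ?T) * (C * A * sum G ?T)"
      by (simp add: mult_ac)
    then show ?thesis using card_T by (simp only: mult_le_cancel_left_pos)
  qed
  let ?X = "\<phi> ` S \<union> \<psi> ` T"
  have "sum F S = (\<Sum>x\<in>?X. sum F {s\<in>S. \<phi> s = x})"
    using fin by (subst sum.group) auto
  also have "\<dots> \<le> (\<Sum>x\<in>?X. C * A * sum G {t\<in>T. \<psi> t = x})"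
    by (intro sum_mono fibre)
  also have "\<dots> = C * A * sum G T"
    using fin by (simp add: sum.group flip: sum_distrib_left)
  finally show ?thesis .
qed

definition pattern :: "nat \<Rightarrow> nat \<Rightarrow> (nat \<Rightarrow> nat \<Rightarrow> 'b) \<Rightarrow> (nat \<Rightarrow> nat \<Rightarrow> nat) \<Rightarrow> nat \<Rightarrow> nat \<Rightarrow> 'b" where
  "pattern n N c a = (\<lambda>i\<in>{..<n}. \<lambda>j\<in>{..<N}. c i (a i j))"

lemma pattern_eq_iff:
  "pattern n N c a = t \<longleftrightarrow>
    t \<in> extensional {..<n} \<and> (\<forall>i<n. t i \<in> extensional {..<N} \<and> (\<forall>j<N. c i (a i j) = t i j))"
  unfolding pattern_def fun_eq_iff restrict_apply extensional_def by (auto split: if_splits)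

lemma pattern_eqD: "pattern n N c a = pattern n N c a' \<Longrightarrow> i < n \<Longrightarrow> j < N \<Longrightarrow> c i (a i j) = c i (a' i j)"
  unfolding pattern_eq_iff by (auto simp: pattern_def)

lemma finite_perms_PiE [simp]: "finite (PiE {..<n::nat} (\<lambda>_. perms N))"
  by (intro finite_PiE) auto

lemma card_perms_PiE: "card (PiE {..<n::nat} (\<lambda>_. perms N)) = fact N ^ n"
  by (simp add: card_PiE card_perms)

lemma card_perms_PiE_pattern_le:
  fixes c :: "nat \<Rightarrow> nat \<Rightarrow> 'b"
  assumes B: "finite B" "\<And>i. i < n \<Longrightarrow> c i ` {..<N} \<subseteq> B"
  shows "real (card {s \<in> PiE {..<n} (\<lambda>_. perms N). pattern n N c (\<lambda>i. inv (s i)) = t}) * (real N ^ N) ^ n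
    \<le> (fact N * (exp 1 * real (N + 1)) ^ card B) ^ n *
       real (card {f \<in> PiE {..<n} (\<lambda>_. {..<N} \<rightarrow>\<^sub>E {..<N}). pattern n N c f = t})"
proof (cases "t \<in> extensional {..<n} \<and> (\<forall>i<n. t i \<in> extensional {..<N})")
  case True
  then have perms: "{s \<in> PiE {..<n} (\<lambda>_. perms N). pattern n N c (\<lambda>i. inv (s i)) = t}
      = PiE {..<n} (\<lambda>i. {\<sigma>\<in>perms N. \<forall>j<N. c i (inv \<sigma> j) = t i j})"
    and maps: "{f \<in> PiE {..<n} (\<lambda>_. {..<N} \<rightarrow>\<^sub>E {..<N}). pattern n N c f = t}
      = PiE {..<n} (\<lambda>i. {f\<in>{..<N} \<rightarrow>\<^sub>E {..<N}. \<forall>j<N. c i (f j) = t i j})"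
    by (simp_all only: set_eq_iff pattern_eq_iff PiE_iff mem_Collect_eq lessThan_iff) blast+
  have "(\<Prod>i<n. real (card {\<sigma>\<in>perms N. \<forall>j<N. c i (inv \<sigma> j) = t i j}) * real N ^ N)
    \<le> (\<Prod>i<n. fact N * (exp 1 * real (N + 1)) ^ card B *
           real (card {f\<in>{..<N} \<rightarrow>\<^sub>E {..<N}. \<forall>j<N. c i (f j) = t i j}))"
    by (intro prod_mono conjI card_perms_pattern_le_card_maps_pattern B) auto
  then show ?thesis
    unfolding perms maps by (simp add: card_PiE prod.distrib)
next
  case False
  then have "{s \<in> PiE {..<n} (\<lambda>_. perms N). pattern n N c (\<lambda>i. inv (s i)) = t} = {}"
    unfolding pattern_eq_iff by blast
  then show ?thesis by (simp only: card.empty) simp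
qed

lemma sum_perms_le_sum_maps:
  fixes c :: "nat \<Rightarrow> nat \<Rightarrow> 'b" and F :: "(nat \<Rightarrow> nat \<Rightarrow> nat) \<Rightarrow> real"
  assumes B: "finite B" "\<And>i. i < n \<Longrightarrow> c i ` {..<N} \<subseteq> B" and "N > 0"
    and nonneg: "0 \<le> A" "\<And>a. 0 \<le> F a"
    and pattern_le: "\<And>a b. pattern n N c a = pattern n N c b \<Longrightarrow> (\<And>i j. i < n \<Longrightarrow> j < N \<Longrightarrow> a i j < N) \<Longrightarrow>
      (\<And>i j. i < n \<Longrightarrow> j < N \<Longrightarrow> b i j < N) \<Longrightarrow> F a \<le> A * F b"
  shows "(\<Sum>s\<in>PiE {..<n} (\<lambda>_. perms N). F (\<lambda>i. inv (s i))) / fact N ^ n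
    \<le> A * ((exp 1 * real (N + 1)) ^ card B) ^ n * ((\<Sum>f\<in>PiE {..<n} (\<lambda>_. {..<N} \<rightarrow>\<^sub>E {..<N}). F f)
      / (real N ^ N) ^ n)"
proof -
  let ?P = "PiE {..<n} (\<lambda>_. perms N)" and ?Q = "PiE {..<n} (\<lambda>_. {..<N} \<rightarrow>\<^sub>E {..<N})"
  define C where "C = (exp 1 * real (N + 1)) ^ card B"
  have "(\<Sum>s\<in>?P. F (\<lambda>i. inv (s i))) \<le> (fact N * C) ^ n / (real N ^ N) ^ n * A * (\<Sum>f\<in>?Q. F f)"
  proof (rule sum_le_sum_fibrewise)
    show "real (card {s \<in> ?P. pattern n N c (\<lambda>i. inv (s i)) = t})
      \<le> (fact N * C) ^ n / (real N ^ N) ^ n * real (card {f \<in> ?Q. pattern n N c f = t})" for t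
      using card_perms_PiE_pattern_le[OF B, where t = t] \<open>N > 0\<close> by (simp add: C_def pos_le_divide_eq)
    fix s f assume s: "s \<in> ?P" and f: "f \<in> ?Q" and "pattern n N c (\<lambda>i. inv (s i)) = pattern n N c f"
    then show "F (\<lambda>i. inv (s i)) \<le> A * F f"
      using perms_less[OF inv_perms[OF PiE_mem[OF s]]] PiE_mem[OF PiE_mem[OF f]] by (intro pattern_le) auto
  qed (auto intro!: finite_PiE nonneg)
  then have "(\<Sum>s\<in>?P. F (\<lambda>i. inv (s i))) / fact N ^ n
    \<le> ((fact N * C) ^ n / (real N ^ N) ^ n * A * (\<Sum>f\<in>?Q. F f)) / fact N ^ n"
    by (rule divide_right_mono) simp
  then show ?thesis by (simp add: C_def power_mult_distrib mult_ac)
qed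

subsection \<open>Bounded Borel functions as limits of continuous functions\<close>

inductive bounded_Baire :: "('a::metric_space \<Rightarrow> real) \<Rightarrow> bool" where
  continuous: "continuous_on UNIV g \<Longrightarrow> (\<And>x. \<bar>g x\<bar> \<le> B) \<Longrightarrow> bounded_Baire g"
| limit: "(\<And>n. bounded_Baire (f n)) \<Longrightarrow> (\<And>n x. \<bar>f n x\<bar> \<le> B) \<Longrightarrow> (\<And>x. (\<lambda>n. f n x) \<longlonglongrightarrow> h x) \<Longrightarrow>
    bounded_Baire h"

lemma bounded_Baire_measurable: "bounded_Baire h \<Longrightarrow> h \<in> borel_measurable borel"
proof (induction rule: bounded_Baire.induct)
  case (limit f B h)
  show ?case by (rule borel_measurable_LIMSEQ_real[OF limit(3) limit.IH])
qed (rule borel_measurable_continuous_onI)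

lemma bounded_Baire_bounded:
  assumes "bounded_Baire h"
  obtains B where "\<And>x. \<bar>h x\<bar> \<le> B"
  using assms
proof (cases rule: bounded_Baire.cases)
  case (limit f B)
  have "\<bar>h x\<bar> \<le> B" for x
    using limit by (intro tendsto_le[OF _ tendsto_const tendsto_rabs[OF limit(3)]]) auto
  then show ?thesis by (rule that)
qed (rule that)

lemma abs_lincomb_le:
  fixes a b u v :: real
  assumes "\<bar>u\<bar> \<le> U" "\<bar>v\<bar> \<le> V"
  shows "\<bar>a * u + b * v\<bar> \<le> \<bar>a\<bar> * U + \<bar>b\<bar> * V"
proof -
  have "\<bar>a * u + b * v\<bar> \<le> \<bar>a\<bar> * \<bar>u\<bar> + \<bar>b\<bar> * \<bar>v\<bar>"
    using abs_triangle_ineq[of "a * u" "b * v"] by (simp add: abs_mult)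
  also have "\<dots> \<le> \<bar>a\<bar> * U + \<bar>b\<bar> * V"
    using assms by (intro add_mono mult_left_mono) auto
  finally show ?thesis .
qed

lemma bounded_Baire_lincomb:
  assumes "bounded_Baire u" "bounded_Baire v"
  shows "bounded_Baire (\<lambda>x. a * u x + b * v x)"
  using assms(1)
proof (induction rule: bounded_Baire.induct)
  case (continuous g B)
  show ?case
    using assms(2)
  proof (induction rule: bounded_Baire.induct)
    case (continuous g' B')
    then show ?case
      using \<open>continuous_on UNIV g\<close> \<open>\<And>x. \<bar>g x\<bar> \<le> B\<close>
      by (intro bounded_Baire.continuous[OF _ abs_lincomb_le] continuous_intros)
  next
    case (limit f B' h)
    show ?case
      by (rule bounded_Baire.limit[where f = "\<lambda>n x. a * g x + b * f n x"])
        (rule limit.IH abs_lincomb_le[OF continuous(2) limit.hyps(2)] | intro tendsto_intros limit.hyps(3))+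
  qed
next
  case (limit f B h)
  obtain C where C: "\<And>x. \<bar>v x\<bar> \<le> C" using bounded_Baire_bounded[OF assms(2)] by blast
  show ?case
    by (rule bounded_Baire.limit[where f = "\<lambda>n x. a * f n x + b * v x"])
      (rule limit.IH abs_lincomb_le[OF limit.hyps(2) C] | intro tendsto_intros limit.hyps(3))+
qed

lemma bounded_Baire_const: "bounded_Baire (\<lambda>x. c)"
  by (rule bounded_Baire.continuous[of _ "\<bar>c\<bar>"]) auto

lemma bounded_Baire_sum:
  assumes "finite I" "\<And>i. i \<in> I \<Longrightarrow> bounded_Baire (f i)"
  shows "bounded_Baire (\<lambda>x. \<Sum>i\<in>I. c i * f i x)"
  using assms
proof (induction rule: finite_induct)
  case (insert i I)
  then show ?case
    using bounded_Baire_lincomb[of "f i" "\<lambda>x. \<Sum>i\<in>I. c i * f i x" "c i" 1] by simp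
qed (simp add: bounded_Baire_const)

lemma bounded_Baire_indicator_closed:
  assumes "closed C"
  shows "bounded_Baire (indicator C)"
proof (cases "C = {}")
  case True
  then show ?thesis using bounded_Baire_const[of 0] by (simp add: indicator_def[abs_def])
next
  case False
  let ?f = "\<lambda>n x. max 0 (1 - real n * infdist x C)"
  show ?thesis
  proof (rule bounded_Baire.limit)
    show "\<bar>?f n x\<bar> \<le> 1" for n x by (auto simp: infdist_nonneg max_def)
    then show "bounded_Baire (?f n)" for n
      by (intro bounded_Baire.continuous continuous_intros)
    show "(\<lambda>n. ?f n x) \<longlonglongrightarrow> indicator C x" for x
    proof (cases "x \<in> C")
      case outside: False
      then have "infdist x C > 0"
        using assms False in_closed_iff_infdist_zero[of C x] infdist_nonneg[of x C] by force
      then have "filterlim (\<lambda>n. infdist x C * real n) at_top sequentially"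
        by (rule filterlim_tendsto_pos_mult_at_top[OF tendsto_const _ filterlim_real_sequentially])
      then have "\<forall>\<^sub>F n in sequentially. 1 \<le> infdist x C * real n"
        by (simp add: filterlim_at_top)
      then have "\<forall>\<^sub>F n in sequentially. ?f n x = 0"
        by eventually_elim (simp add: mult.commute)
      then show ?thesis using outside by (simp add: tendsto_eventually)
    qed simp
  qed
qed

lemma indicator_UN_lessThan_Suc:
  assumes "disjoint_family A"
  shows "indicator (\<Union>i<Suc n. A i) x = indicator (\<Union>i<n. A i) x + (indicator (A n) x :: real)"
proof -
  have "A i \<inter> A n = {}" if "i < n" for i
    using that by (intro disjoint_family_onD[OF assms]) auto
  then have "(\<Union>i<n. A i) \<inter> A n = {}" by blast
  then show ?thesis by (auto simp: lessThan_Suc indicator_def)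
qed

lemma bounded_Baire_indicator:
  assumes "A \<in> sets borel"
  shows "bounded_Baire (indicator A :: 'a::metric_space \<Rightarrow> real)"
proof -
  have "Int_stable (Collect closed :: 'a set set)" by (auto simp: Int_stable_def)
  moreover have "(Collect closed :: 'a set set) \<subseteq> Pow UNIV" by simp
  moreover have "A \<in> sigma_sets UNIV (Collect closed)" using assms by (simp add: borel_eq_closed)
  ultimately show ?thesis
  proof (induction rule: sigma_sets_induct_disjoint)
    case (compl A)
    have "bounded_Baire (\<lambda>x. 1 * 1 + (-1) * indicator A x)"
      by (intro bounded_Baire_lincomb bounded_Baire_const compl)
    also have "(\<lambda>x. 1 * 1 + (-1) * indicator A x) = (indicator (UNIV - A) :: 'a \<Rightarrow> real)"
      by (auto simp: fun_eq_iff split: split_indicator)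
    finally show ?case .
  next
    case (union A)
    have finite_union: "bounded_Baire (indicator (\<Union>i<n. A i) :: 'a \<Rightarrow> real)" for n
    proof (induction n)
      case (Suc n)
      then show ?case
        using bounded_Baire_lincomb[OF Suc union.IH[of n], of 1 1]
        by (simp flip: indicator_UN_lessThan_Suc[OF union.hyps(1)])
    qed (simp add: bounded_Baire_const)
    show ?case
    proof (rule bounded_Baire.limit[OF finite_union])
      show "(\<lambda>n. indicator (\<Union>i<n. A i) x :: real) \<longlonglongrightarrow> indicator (\<Union>i. A i) x" for x
        by (rule LIMSEQ_indicator_UN)
      show "\<bar>indicator (\<Union>i<n. A i) x :: real\<bar> \<le> 1" for n x
        by (simp split: split_indicator)
    qed
  qed (simp_all add: bounded_Baire_indicator_closed bounded_Baire_const)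
qed

lemma bounded_Baire_floor:
  fixes h :: "'a::metric_space \<Rightarrow> real"
  assumes [measurable]: "h \<in> borel_measurable borel" and B: "\<And>x. \<bar>h x\<bar> \<le> B"
  shows "bounded_Baire (\<lambda>x. of_int \<lfloor>h x\<rfloor>)"
proof -
  let ?I = "{\<lfloor>- B\<rfloor>..\<lfloor>B\<rfloor>}"
  have "of_int \<lfloor>h x\<rfloor> = (\<Sum>i\<in>?I. of_int i * indicator {x. \<lfloor>h x\<rfloor> = i} x :: real)" for x
  proof -
    have "\<lfloor>h x\<rfloor> \<in> ?I"
      using B[of x] unfolding abs_le_iff by (auto intro!: floor_mono simp: minus_le_iff)
    then have "of_int \<lfloor>h x\<rfloor> = (\<Sum>i\<in>?I. if i = \<lfloor>h x\<rfloor> then of_int i else 0 :: real)"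
      by (simp add: sum.delta)
    also have "\<dots> = (\<Sum>i\<in>?I. of_int i * indicator {x. \<lfloor>h x\<rfloor> = i} x)"
      by (intro sum.cong) auto
    finally show ?thesis .
  qed
  then have "(\<lambda>x. of_int \<lfloor>h x\<rfloor>) = (\<lambda>x. \<Sum>i\<in>?I. of_int i * indicator {x. \<lfloor>h x\<rfloor> = i} x :: real)"
    by (rule ext)
  then show ?thesis
    by (simp only:) (intro bounded_Baire_sum bounded_Baire_indicator; measurable)
qed

lemma bounded_Baire_if_bounded_measurable:
  fixes h :: "'a::metric_space \<Rightarrow> real"
  assumes [measurable]: "h \<in> borel_measurable borel" and B: "\<And>x. \<bar>h x\<bar> \<le> B"
  shows "bounded_Baire h"
proof (rule bounded_Baire.limit)
  define f where "f k x = of_int \<lfloor>real (Suc k) * h x\<rfloor> / real (Suc k)" for k x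
  have diff: "f k x \<le> h x" "h x \<le> f k x + 1 / real (Suc k)" for k x
  proof -
    have "real (Suc k) * f k x \<le> real (Suc k) * h x" by (simp add: f_def del: of_nat_Suc)
    then show "f k x \<le> h x" by (simp only: mult_le_cancel_left_pos of_nat_0_less_iff zero_less_Suc)
    have "real (Suc k) * h x \<le> real (Suc k) * (f k x + 1 / real (Suc k))"
      unfolding distrib_left by (simp add: f_def del: of_nat_Suc)
    then show "h x \<le> f k x + 1 / real (Suc k)"
      by (simp only: mult_le_cancel_left_pos of_nat_0_less_iff zero_less_Suc)
  qed
  show "bounded_Baire (f k)" for k
  proof -
    have "\<bar>real (Suc k) * h x\<bar> \<le> real (Suc k) * B" for x
      unfolding abs_mult using B[of x] by (intro mult_mono) auto
    then have "bounded_Baire (\<lambda>x. of_int \<lfloor>real (Suc k) * h x\<rfloor>)"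
      by (intro bounded_Baire_floor) measurable
    from bounded_Baire_lincomb[OF this bounded_Baire_const[of 0], of "1 / real (Suc k)" 0] show ?thesis
      by (simp add: f_def[abs_def] del: of_nat_Suc)
  qed
  show "\<bar>f k x\<bar> \<le> B + 1" for k x
  proof -
    have "1 / real (Suc k) \<le> 1" by simp
    then show ?thesis using diff[where k = k and x = x] B[of x] by linarith
  qed
  show "(\<lambda>k. f k x) \<longlonglongrightarrow> h x" for x
  proof (rule tendsto_sandwich)
    show "(\<lambda>k. h x - 1 / real (Suc k)) \<longlonglongrightarrow> h x"
      using tendsto_diff[OF tendsto_const LIMSEQ_Suc[OF lim_1_over_n]] by simp
    show "\<forall>\<^sub>F k in sequentially. h x - 1 / real (Suc k) \<le> f k x" "\<forall>\<^sub>F k in sequentially. f k x \<le> h x"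
      using diff[where x = x] by (simp_all add: algebra_simps)
  qed simp
qed

lemma bounded_borel_measurable_induct [consumes 2, case_names continuous limit]:
  fixes h :: "'a::metric_space \<Rightarrow> real"
  assumes "h \<in> borel_measurable borel" "\<And>x. \<bar>h x\<bar> \<le> B"
    and continuous: "\<And>g B. continuous_on UNIV g \<Longrightarrow> (\<And>x. \<bar>g x\<bar> \<le> B) \<Longrightarrow> P g"
    and limit: "\<And>f g B. (\<And>n. f n \<in> borel_measurable borel) \<Longrightarrow> (\<And>n x. \<bar>f n x\<bar> \<le> B) \<Longrightarrow>
      (\<And>n. P (f n)) \<Longrightarrow> (\<And>x. (\<lambda>n. f n x) \<longlonglongrightarrow> g x) \<Longrightarrow> P g"
  shows "P h"
  using bounded_Baire_if_bounded_measurable[OF assms(1,2)]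
proof (induction rule: bounded_Baire.induct)
  case (limit f B h)
  then show ?case by (intro assms(4)[of f B h] bounded_Baire_measurable)
qed (rule continuous)

subsection \<open>The Donsker-Varadhan formula\<close>

definition gibbs_bound :: "'a measure \<Rightarrow> 'a measure \<Rightarrow> real \<Rightarrow> bool" where
  "gibbs_bound M N c \<longleftrightarrow> (\<forall>h\<in>borel_measurable N. \<forall>B. (\<forall>x. \<bar>h x\<bar> \<le> B) \<longrightarrow>
     (\<integral>x. h x \<partial>M) - ln (\<integral>x. exp (h x) \<partial>N) \<le> c)"

lemma gibbs_boundI:
  assumes "\<And>h B. h \<in> borel_measurable N \<Longrightarrow> (\<And>x. \<bar>h x\<bar> \<le> B) \<Longrightarrow>
    (\<integral>x. h x \<partial>M) - ln (\<integral>x. exp (h x) \<partial>N) \<le> c"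
  shows "gibbs_bound M N c"
  using assms unfolding gibbs_bound_def by blast

lemma gibbs_boundD:
  assumes "gibbs_bound M N c" "h \<in> borel_measurable N" "\<And>x. \<bar>h x\<bar> \<le> B"
  shows "(\<integral>x. h x \<partial>M) - ln (\<integral>x. exp (h x) \<partial>N) \<le> c"
  using assms unfolding gibbs_bound_def by blast

lemma (in finite_measure) integrable_bounded:
  fixes f :: "'a \<Rightarrow> real"
  assumes "f \<in> borel_measurable M" "\<And>x. \<bar>f x\<bar> \<le> B"
  shows "integrable M f"
  using assms by (intro integrable_const_bound[of _ B]) auto

lemma (in prob_space)
  fixes h :: "'a \<Rightarrow> real"
  assumes [measurable]: "h \<in> borel_measurable M" and B: "\<And>x. \<bar>h x\<bar> \<le> B"
  shows integrable_exp: "integrable M (\<lambda>x. exp (h x))" and integral_exp_pos: "0 < (\<integral>x. exp (h x) \<partial>M)"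
proof -
  have exp_h: "\<bar>exp (h x)\<bar> \<le> exp B" "exp (- B) \<le> exp (h x)" for x using B[of x] by auto
  show integrable: "integrable M (\<lambda>x. exp (h x))"
    by (rule integrable_bounded[OF _ exp_h(1)]) simp
  have "exp (- B) = (\<integral>x. exp (- B) \<partial>M)" by (simp add: prob_space)
  also have "\<dots> \<le> (\<integral>x. exp (h x) \<partial>M)"
    by (intro integral_mono integrable exp_h) simp
  finally show "0 < (\<integral>x. exp (h x) \<partial>M)"
    using exp_gt_zero[of "- B"] by linarith
qed

lemma gibbs_bound_continuous_imp_measurable:
  fixes T :: "'b \<Rightarrow> 'a::metric_space" and h :: "'a \<Rightarrow> real" and c :: real
  assumes M: "prob_space M" and N: "prob_space N"
    and T[measurable]: "T \<in> borel_measurable M" "T \<in> borel_measurable N"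
    and continuous: "\<And>g B. continuous_on UNIV g \<Longrightarrow> (\<And>x. \<bar>g x\<bar> \<le> B) \<Longrightarrow>
      (\<integral>x. g (T x) \<partial>M) - ln (\<integral>x. exp (g (T x)) \<partial>N) \<le> c"
    and "h \<in> borel_measurable borel" "\<And>x. \<bar>h x\<bar> \<le> B"
  shows "(\<integral>x. h (T x) \<partial>M) - ln (\<integral>x. exp (h (T x)) \<partial>N) \<le> c"
  using assms(6,7)
proof (induction h rule: bounded_borel_measurable_induct)
  case (limit f g B)
  interpret M: prob_space M by fact
  interpret N: prob_space N by fact
  note [measurable] = limit(1)
  have [measurable]: "g \<in> borel_measurable borel"
    by (rule borel_measurable_LIMSEQ_real[OF limit(3,1)])
  have g_bounded: "\<bar>g x\<bar> \<le> B" for x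
    using limit(2) by (intro tendsto_le[OF _ tendsto_const tendsto_rabs[OF limit(3)]]) auto
  have exp_le: "exp (f k x) \<le> exp B" for k x
    using limit(2)[of k x] by simp
  have "(\<lambda>k. \<integral>x. f k (T x) \<partial>M) \<longlonglongrightarrow> (\<integral>x. g (T x) \<partial>M)"
    using limit by (intro integral_dominated_convergence[where w = "\<lambda>_. B"]) auto
  moreover have "(\<lambda>k. \<integral>x. exp (f k (T x)) \<partial>N) \<longlonglongrightarrow> (\<integral>x. exp (g (T x)) \<partial>N)"
    using exp_le limit by (intro integral_dominated_convergence[where w = "\<lambda>_. exp B"])
      (auto intro!: tendsto_exp)
  moreover have "(\<integral>x. exp (g (T x)) \<partial>N) > 0"
    using g_bounded by (intro N.integral_exp_pos[where B = B]) auto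
  ultimately have "(\<lambda>k. (\<integral>x. f k (T x) \<partial>M) - ln (\<integral>x. exp (f k (T x)) \<partial>N))
      \<longlonglongrightarrow> (\<integral>x. g (T x) \<partial>M) - ln (\<integral>x. exp (g (T x)) \<partial>N)"
    by (intro tendsto_intros) auto
  then show ?case
    by (rule LIMSEQ_le_const2) (use limit(4) in auto)
qed (rule continuous)

lemma mult_ln_diff_le:
  fixes x y :: real
  assumes "0 \<le> x" "0 < y"
  shows "x * (ln y - ln x) \<le> y - x"
proof (cases "x = 0")
  case False
  with \<open>0 \<le> x\<close> have "x > 0" by simp
  have "ln y - ln x \<le> y / x - 1"
    using ln_le_minus_one[of "y / x"] \<open>x > 0\<close> \<open>0 < y\<close> by (simp add: ln_div)
  then have "x * (ln y - ln x) \<le> x * (y / x - 1)"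
    using \<open>x > 0\<close> by (intro mult_left_mono) auto
  then show ?thesis using \<open>x > 0\<close> by (simp add: algebra_simps)
qed (use assms in simp)

lemma mult_ln_ge: "0 \<le> (x::real) \<Longrightarrow> x - 1 \<le> x * ln x"
  using mult_ln_diff_le[of x 1] by simp

locale prob_density = prob_space N for N :: "'a measure" +
  fixes f :: "'a \<Rightarrow> real"
  assumes density_measurable [measurable]: "f \<in> borel_measurable N"
    and density_nonneg: "0 \<le> f x"
    and prob_space_density: "prob_space (density N f)"
begin

sublocale density: prob_space "density N f"
  by (rule prob_space_density)

lemma integrable_density_iff:
  fixes g :: "'a \<Rightarrow> real"
  assumes "g \<in> borel_measurable N"
  shows "integrable (density N f) g \<longleftrightarrow> integrable N (\<lambda>x. f x * g x)"
  using assms density_nonneg by (intro integrable_real_density) auto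

lemma integral_density:
  fixes g :: "'a \<Rightarrow> real"
  assumes "g \<in> borel_measurable N"
  shows "(\<integral>x. g x \<partial>density N f) = (\<integral>x. f x * g x \<partial>N)"
  using assms density_nonneg by (intro integral_real_density) auto

lemma integrable_density_fun: "integrable N f" and integral_density_fun: "(\<integral>x. f x \<partial>N) = 1"
  using integrable_density_iff[of "\<lambda>_. 1"] integral_density[of "\<lambda>_. 1"]
  by (simp_all add: density.prob_space[unfolded space_density])

lemma AE_density_pos: "AE x in density N f. 0 < f x"
  using density_nonneg by (subst AE_density) (auto simp: less_le)

lemma gibbs_bound_density:
  assumes ln: "integrable (density N f) (\<lambda>x. ln (f x))"
  shows "gibbs_bound (density N f) N (\<integral>x. ln (f x) \<partial>density N f)"
proof (rule gibbs_boundI)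
  fix h :: "'a \<Rightarrow> real" and B assume h[measurable]: "h \<in> borel_measurable N" and B: "\<And>x. \<bar>h x\<bar> \<le> B"
  define Z where "Z = (\<integral>x. exp (h x) \<partial>N)"
  have Z: "Z > 0" and exp_h: "integrable N (\<lambda>x. exp (h x))"
    unfolding Z_def by (rule integral_exp_pos[OF h B] integrable_exp[OF h B])+
  have h_integrable: "integrable (density N f) h"
    using B by (intro density.integrable_bounded[of _ B]) auto
  have "(\<integral>x. h x \<partial>density N f) - ln Z - (\<integral>x. ln (f x) \<partial>density N f)
      = (\<integral>x. h x - ln Z - ln (f x) \<partial>density N f)"
    using h_integrable ln by (simp add: density.prob_space[unfolded space_density])
  also have "\<dots> = (\<integral>x. f x * (h x - ln Z - ln (f x)) \<partial>N)"
    by (intro integral_density) simp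
  also have "\<dots> \<le> (\<integral>x. exp (h x) / Z - f x \<partial>N)"
  proof (rule integral_mono)
    show "integrable N (\<lambda>x. f x * (h x - ln Z - ln (f x)))"
      using h_integrable ln by (subst integrable_density_iff[symmetric]) auto
    show "f x * (h x - ln Z - ln (f x)) \<le> exp (h x) / Z - f x" for x
      using mult_ln_diff_le[OF density_nonneg[of x], of "exp (h x) / Z"] Z by (simp add: ln_div)
  qed (use exp_h integrable_density_fun in simp)
  also have "\<dots> = 0"
    using exp_h integrable_density_fun integral_density_fun Z by (simp add: Z_def)
  finally show "(\<integral>x. h x \<partial>density N f) - ln (\<integral>x. exp (h x) \<partial>N) \<le> (\<integral>x. ln (f x) \<partial>density N f)"
    by (simp add: Z_def)
qed

lemma rel_entropy_density:
  "rel_entropy (density N f) N =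
    (if integrable (density N f) (\<lambda>x. ln (f x)) then ereal (\<integral>x. ln (f x) \<partial>density N f) else \<infinity>)"
proof -
  let ?g = "\<lambda>x. enn2real (RN_deriv N (density N f) x)"
  have "absolutely_continuous N (density N f)"
    by (rule absolutely_continuousI_density) simp
  moreover have "AE x in N. ennreal (f x) = RN_deriv N (density N f) x"
    by (rule RN_deriv_unique) auto
  then have "AE x in N. ?g x * ln (?g x) = f x * ln (f x)"
    using density_nonneg by (auto elim!: eventually_mono) (metis enn2real_ennreal)
  then have "integrable N (\<lambda>x. ?g x * ln (?g x)) \<longleftrightarrow> integrable N (\<lambda>x. f x * ln (f x))"
    and "(\<integral>x. ?g x * ln (?g x) \<partial>N) = (\<integral>x. f x * ln (f x) \<partial>N)"
    by (intro integrable_cong_AE integral_cong_AE; simp)+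
  ultimately show ?thesis
    by (simp add: rel_entropy_def Let_def integrable_density_iff integral_density)
qed

end

lemma absolutely_continuousE:
  assumes M: "prob_space M" and N: "prob_space N" and sets: "sets M = sets N"
    and ac: "absolutely_continuous N M"
  obtains f where "prob_density N f" "M = density N f"
proof -
  interpret M: prob_space M by fact
  interpret N: prob_space N by fact
  define f where "f x = enn2real (RN_deriv N M x)" for x
  have "AE x in N. RN_deriv N M x \<noteq> \<infinity>"
    by (rule N.RN_deriv_finite) (use ac sets in \<open>auto intro: M.sigma_finite_measure_axioms\<close>)
  then have "density N f = density N (RN_deriv N M)"
    unfolding f_def by (intro density_cong) (auto elim!: eventually_mono simp: less_top)
  also have "\<dots> = M" by (rule N.density_RN_deriv[OF ac sets])
  finally have "density N f = M" .
  moreover have "f \<in> borel_measurable N" "0 \<le> f x" for x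
    by (simp_all add: f_def[abs_def])
  then have "prob_density N f"
    using M \<open>density N f = M\<close> by (intro prob_density.intro prob_density_axioms.intro N) simp_all
  ultimately show ?thesis using that by simp
qed

lemma rel_entropy_finiteE:
  assumes M: "prob_space M" and N: "prob_space N" and fin: "rel_entropy M N < \<infinity>"
  obtains f where "prob_density N f" "M = density N f" "integrable M (\<lambda>x. ln (f x))"
    "rel_entropy M N = ereal (\<integral>x. ln (f x) \<partial>M)"
proof -
  have "sets M = sets N" "absolutely_continuous N M"
    using fin by (auto simp: rel_entropy_def split: if_splits)
  then obtain f where f: "prob_density N f" "M = density N f"
    using absolutely_continuousE[OF M N] by blast
  then show ?thesis
    using that[OF f] prob_density.rel_entropy_density[OF f(1)] fin by (auto split: if_splits)
qed

lemma rel_entropy_not_MInf: "rel_entropy M N \<noteq> -\<infinity>"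
  by (auto simp: rel_entropy_def Let_def)

lemma gibbs_bound_event:
  assumes bound: "gibbs_bound M N c" and M: "prob_space M" and N: "prob_space N"
    and sets: "sets M = sets N" and A: "A \<in> sets N"
  shows "t * measure M A \<le> c + ln (1 + (exp t - 1) * measure N A)"
proof -
  interpret N: prob_space N by fact
  interpret M: prob_space M by fact
  have [measurable]: "A \<in> sets N" "A \<in> sets M" using A sets by auto
  have "(\<integral>x. exp (t * indicator A x) \<partial>N) = (\<integral>x. 1 + (exp t - 1) * indicator A x \<partial>N)"
    by (intro Bochner_Integration.integral_cong) (auto split: split_indicator)
  also have "\<dots> = 1 + (exp t - 1) * measure N A"
    by (subst Bochner_Integration.integral_add) (auto simp: N.prob_space N.emeasure_eq_measure)
  finally have "(\<integral>x. exp (t * indicator A x) \<partial>N) = 1 + (exp t - 1) * measure N A" .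
  moreover have "(\<integral>x. t * indicator A x \<partial>M) - ln (\<integral>x. exp (t * indicator A x) \<partial>N) \<le> c"
    by (rule gibbs_boundD[OF bound, where B = "\<bar>t\<bar>"]) (auto split: split_indicator)
  ultimately show ?thesis by simp
qed

lemma gibbs_bound_imp_absolutely_continuous:
  assumes bound: "gibbs_bound M N c" and M: "prob_space M" and N: "prob_space N" and sets: "sets M = sets N"
  shows "absolutely_continuous N M"
  unfolding absolutely_continuous_def
proof
  fix A assume A: "A \<in> null_sets N"
  interpret M: prob_space M by fact
  have "t * measure M A \<le> c" for t
    using gibbs_bound_event[OF bound M N sets, where A = A and t = t] A
    by (simp add: null_setsD1 null_setsD2 measure_def)
  then have "\<not> 0 < measure M A"
    using reals_Archimedean3[of "measure M A"] by (metis not_less)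
  then have "measure M A = 0"
    using measure_nonneg[of M A] by linarith
  then show "A \<in> null_sets M"
    using A sets by (auto intro!: null_setsI simp: M.emeasure_eq_measure)
qed

lemma integrable_limit_nonneg:
  fixes u :: "nat \<Rightarrow> 'a \<Rightarrow> real"
  assumes integrable: "\<And>k. integrable M (u k)" and nonneg: "\<And>k x. 0 \<le> u k x"
    and pointwise: "\<And>x. (\<lambda>k. u k x) \<longlonglongrightarrow> v x" and integral_le: "\<And>k. (\<integral>x. u k x \<partial>M) \<le> c k"
    and bound_tendsto: "c \<longlonglongrightarrow> C"
  shows "integrable M v" and "(\<integral>x. v x \<partial>M) \<le> C"
proof -
  have [measurable]: "u k \<in> borel_measurable M" for k using integrable by simp
  have [measurable]: "v \<in> borel_measurable M" by (rule borel_measurable_LIMSEQ_real[OF pointwise]) simp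
  have v_nonneg: "0 \<le> v x" for x
    using nonneg by (intro tendsto_le[OF _ pointwise tendsto_const]) auto
  have "0 \<le> c k" for k
    using Bochner_Integration.integral_nonneg[of M "u k", OF nonneg] integral_le[of k] by linarith
  then have "0 \<le> C"
    using bound_tendsto by (intro LIMSEQ_le_const) auto
  have "(\<integral>\<^sup>+x. ennreal (v x) \<partial>M) = (\<integral>\<^sup>+x. liminf (\<lambda>k. ennreal (u k x)) \<partial>M)"
    by (intro nn_integral_cong lim_imp_Liminf[symmetric] tendsto_ennrealI pointwise) simp
  also have "\<dots> \<le> liminf (\<lambda>k. \<integral>\<^sup>+x. ennreal (u k x) \<partial>M)"
    by (rule nn_integral_liminf) simp
  also have "\<dots> \<le> liminf (\<lambda>k. ennreal (c k))"
    using nonneg integrable integral_le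
    by (intro Liminf_mono always_eventually allI) (simp add: nn_integral_eq_integral ennreal_leI)
  also have "\<dots> = ennreal C"
    by (intro lim_imp_Liminf tendsto_ennrealI bound_tendsto) simp
  finally have nn_le: "(\<integral>\<^sup>+x. ennreal (v x) \<partial>M) \<le> ennreal C" .
  then show "integrable M v"
    using v_nonneg by (intro integrableI_bounded) (auto simp: le_less_trans)
  show "(\<integral>x. v x \<partial>M) \<le> C"
    using nn_le \<open>0 \<le> C\<close> by (rule integral_real_bounded[rotated])
qed

lemma (in finite_measure) integrable_limit_bounded_below:
  fixes u :: "nat \<Rightarrow> 'a \<Rightarrow> real"
  assumes integrable: "\<And>k. integrable M (u k)" and lower: "\<And>k x. - b \<le> u k x"
    and pointwise: "\<And>x. (\<lambda>k. u k x) \<longlonglongrightarrow> v x" and integral_le: "\<And>k. (\<integral>x. u k x \<partial>M) \<le> c k"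
    and bound_tendsto: "c \<longlonglongrightarrow> C"
  shows "integrable M v \<and> (\<integral>x. v x \<partial>M) \<le> C"
proof -
  let ?d = "b * measure M (space M)"
  have "integrable M (\<lambda>x. u k x + b)" "(\<integral>x. u k x + b \<partial>M) \<le> c k + ?d" "0 \<le> u k x + b" for k x
    using integrable integral_le[of k] lower[of k x] by (simp_all add: mult.commute)
  note shifted = integrable_limit_nonneg[of M "\<lambda>k x. u k x + b" "\<lambda>x. v x + b" "\<lambda>k. c k + ?d" "C + ?d",
      OF this(1,3) tendsto_add[OF pointwise tendsto_const] this(2)
      tendsto_add[OF bound_tendsto tendsto_const]]
  from Bochner_Integration.integrable_diff[OF shifted(1) integrable_const[of b]]
  have "integrable M v" by simp
  with shifted(2) show ?thesis by (simp add: mult.commute)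
qed

definition truncate :: "nat \<Rightarrow> real \<Rightarrow> real" where
  "truncate k y = max (1 / real (Suc k)) (min y (real (Suc k)))"

lemma truncate_pos: "0 < truncate k y"
  by (simp add: truncate_def less_max_iff_disj)

lemma truncate_measurable [measurable]: "truncate k \<in> borel_measurable borel"
  unfolding truncate_def by measurable

lemma truncate_le_add: "0 \<le> y \<Longrightarrow> truncate k y \<le> y + 1 / real (Suc k)"
  unfolding truncate_def by (intro max.boundedI order_trans[OF min.cobounded1]) auto

lemma abs_ln_truncate_le: "\<bar>ln (truncate k y)\<bar> \<le> ln (real (Suc k))"
proof -
  have "1 / real (Suc k) \<le> real (Suc k)"
    by (rule order_trans[of _ 1]) simp_all
  then have "1 / real (Suc k) \<le> truncate k y" "truncate k y \<le> real (Suc k)"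
    by (auto simp: truncate_def simp del: of_nat_Suc)
  then have "ln (1 / real (Suc k)) \<le> ln (truncate k y)" "ln (truncate k y) \<le> ln (real (Suc k))"
    using truncate_pos[of k y] by (auto simp del: of_nat_Suc)
  then show ?thesis by (simp add: ln_div del: of_nat_Suc)
qed

lemma mult_ln_truncate_ge:
  assumes "0 \<le> y"
  shows "- 1 \<le> y * ln (truncate k y)"
proof (cases "y = 0")
  case False
  with assms have y: "y > 0" by simp
  show ?thesis
  proof (cases "y \<le> real (Suc k)")
    case True
    then have "y \<le> truncate k y" by (auto simp: truncate_def)
    then have "y * ln y \<le> y * ln (truncate k y)" using y by (intro mult_left_mono) auto
    with mult_ln_ge[of y] y show ?thesis by linarith
  next
    case False
    then have "1 \<le> truncate k y" by (auto simp: truncate_def)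
    then have "0 \<le> y * ln (truncate k y)" using y by simp
    then show ?thesis by linarith
  qed
qed simp

lemma tendsto_mult_ln_truncate:
  assumes "0 \<le> y"
  shows "(\<lambda>k. y * ln (truncate k y)) \<longlonglongrightarrow> y * ln y"
proof (cases "y = 0")
  case False
  with assms have "0 < y" by simp
  have "\<forall>\<^sub>F k in sequentially. 1 / real (Suc k) < y"
    using LIMSEQ_Suc[OF lim_1_over_n] \<open>0 < y\<close> by (rule order_tendstoD)
  moreover have "\<forall>\<^sub>F k in sequentially. y < real (Suc k)"
    using filterlim_compose[OF filterlim_real_sequentially filterlim_Suc]
    by (simp add: filterlim_at_top_dense)
  ultimately have "\<forall>\<^sub>F k in sequentially. y * ln (truncate k y) = y * ln y"
    by eventually_elim (auto simp: truncate_def)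
  then show ?thesis by (rule tendsto_eventually)
qed simp

text \<open>The optimal test function \<open>ln f\<close> is unbounded; the bound is tested on its truncations instead.\<close>

lemma (in prob_density) gibbs_bound_imp_entropy_le:
  assumes bound: "gibbs_bound (density N f) N c"
  shows "integrable N (\<lambda>x. f x * ln (f x)) \<and> (\<integral>x. f x * ln (f x) \<partial>N) \<le> c"
proof (rule integrable_limit_bounded_below)
  let ?g = "\<lambda>k x. truncate k (f x)"
  show "(\<lambda>k. f x * ln (?g k x)) \<longlonglongrightarrow> f x * ln (f x)" and "- 1 \<le> f x * ln (?g k x)" for k x
    by (rule tendsto_mult_ln_truncate mult_ln_truncate_ge; rule density_nonneg)+
  show "(\<lambda>k. c + 1 / real (Suc k)) \<longlonglongrightarrow> c"
    using tendsto_add[OF tendsto_const LIMSEQ_Suc[OF lim_1_over_n]] by simp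
  fix k
  have "integrable (density N f) (\<lambda>x. ln (?g k x))"
    by (rule density.integrable_bounded[OF _ abs_ln_truncate_le]) simp
  then show "integrable N (\<lambda>x. f x * ln (?g k x))"
    by (subst (asm) integrable_density_iff) auto
  have exp_ln: "exp (ln (?g k x)) = ?g k x" for x
    by (simp add: truncate_pos)
  have g: "integrable N (?g k)" and g_pos: "0 < (\<integral>x. ?g k x \<partial>N)"
    using integrable_exp[where h = "\<lambda>x. ln (?g k x)", OF _ abs_ln_truncate_le]
      integral_exp_pos[where h = "\<lambda>x. ln (?g k x)", OF _ abs_ln_truncate_le] by (simp_all add: exp_ln)
  have "(\<integral>x. ?g k x \<partial>N) \<le> (\<integral>x. f x + 1 / real (Suc k) \<partial>N)"
    using integrable_density_fun by (intro integral_mono g truncate_le_add density_nonneg) auto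
  also have "\<dots> = 1 + 1 / real (Suc k)"
    using integrable_density_fun by (simp add: integral_density_fun prob_space)
  finally have "ln (\<integral>x. ?g k x \<partial>N) \<le> 1 / real (Suc k)"
    using ln_le_minus_one[OF g_pos] by linarith
  moreover have "(\<integral>x. ln (?g k x) \<partial>density N f) - ln (\<integral>x. exp (ln (?g k x)) \<partial>N) \<le> c"
    by (rule gibbs_boundD[OF bound _ abs_ln_truncate_le]) simp
  ultimately show "(\<integral>x. f x * ln (?g k x) \<partial>N) \<le> c + 1 / real (Suc k)"
    by (simp add: exp_ln integral_density)
qed

theorem rel_entropy_le_iff_gibbs_bound:
  assumes M: "prob_space M" and N: "prob_space N" and sets: "sets M = sets N"
  shows "rel_entropy M N \<le> ereal c \<longleftrightarrow> gibbs_bound M N c"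
proof
  assume entropy_le: "rel_entropy M N \<le> ereal c"
  then have "rel_entropy M N < \<infinity>" by auto
  then obtain f where f: "prob_density N f" "M = density N f" "integrable M (\<lambda>x. ln (f x))"
    "rel_entropy M N = ereal (\<integral>x. ln (f x) \<partial>M)"
    using rel_entropy_finiteE[OF M N] by blast
  then have "gibbs_bound M N (\<integral>x. ln (f x) \<partial>M)"
    using prob_density.gibbs_bound_density[OF f(1)] by simp
  then show "gibbs_bound M N c"
    using entropy_le f(4) unfolding gibbs_bound_def by fastforce
next
  assume bound: "gibbs_bound M N c"
  obtain f where f: "prob_density N f" "M = density N f"
    using absolutely_continuousE[OF M N sets gibbs_bound_imp_absolutely_continuous[OF bound M N sets]] .
  interpret prob_density N f by fact
  show "rel_entropy M N \<le> ereal c"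
    using gibbs_bound_imp_entropy_le bound
    by (simp add: f(2) rel_entropy_density integrable_density_iff integral_density)
qed

lemma rel_entropy_distr_le:
  fixes M N :: "'a measure" and K :: "'b measure"
  assumes M: "prob_space M" and N: "prob_space N" and sets: "sets M = sets N"
    and T[measurable]: "T \<in> measurable N K"
  shows "rel_entropy (distr M K T) (distr N K T) \<le> rel_entropy M N"
proof (rule ereal_le_real)
  fix c assume "rel_entropy M N \<le> ereal c"
  then have bound: "gibbs_bound M N c" using rel_entropy_le_iff_gibbs_bound[OF M N sets] by simp
  have TM[measurable]: "T \<in> measurable M K" using T sets by (simp cong: measurable_cong_sets)
  have "gibbs_bound (distr M K T) (distr N K T) c"
  proof (rule gibbs_boundI)
    fix h :: "'b \<Rightarrow> real" and B assume "h \<in> borel_measurable (distr N K T)" and B: "\<And>x. \<bar>h x\<bar> \<le> B"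
    then have [measurable]: "h \<in> borel_measurable K" by simp
    show "(\<integral>x. h x \<partial>distr M K T) - ln (\<integral>x. exp (h x) \<partial>distr N K T) \<le> c"
      using gibbs_boundD[OF bound, of "\<lambda>x. h (T x)" B] B by (simp add: integral_distr)
  qed
  then show "rel_entropy (distr M K T) (distr N K T) \<le> ereal c"
    using prob_space.prob_space_distr[OF M TM] prob_space.prob_space_distr[OF N T]
    by (subst rel_entropy_le_iff_gibbs_bound) auto
qed

lemma gibbs_bound_0_imp_measure_le:
  assumes bound: "gibbs_bound M N 0" and M: "prob_space M" and N: "prob_space N"
    and sets: "sets M = sets N" and A: "A \<in> sets N"
  shows "measure M A \<le> measure N A"
proof (rule field_le_epsilon)
  fix e :: real assume "e > 0"
  define t where "t = min 1 e"
  have t: "0 < t" "t \<le> 1" "t \<le> e" using \<open>e > 0\<close> by (auto simp: t_def)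
  let ?q = "measure N A"
  have "t * measure M A \<le> ln (1 + (exp t - 1) * ?q)"
    using gibbs_bound_event[OF bound M N sets A, of t] by simp
  also have "\<dots> \<le> (exp t - 1) * ?q"
    using t by (intro ln_add_one_self_le_self) auto
  also have "\<dots> \<le> (t + t\<^sup>2) * ?q"
    using exp_bound[of t] t by (intro mult_right_mono) auto
  also have "\<dots> = t * (?q + t * ?q)"
    by (simp add: power2_eq_square algebra_simps)
  finally have "measure M A \<le> ?q + t * ?q"
    using t by simp
  also have "t * ?q \<le> e * 1"
    using t prob_space.prob_le_1[OF N] by (intro mult_mono) auto
  finally show "measure M A \<le> ?q + e" by simp
qed

lemma rel_entropy_eq_0_iff:
  assumes M: "prob_space M" and N: "prob_space N"
  shows "rel_entropy M N = 0 \<longleftrightarrow> M = N"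
proof
  interpret M: prob_space M by fact
  interpret N: prob_space N by fact
  assume zero: "rel_entropy M N = 0"
  then have sets: "sets M = sets N" by (auto simp: rel_entropy_def split: if_splits)
  then have space: "space M = space N" by (rule sets_eq_imp_space_eq)
  have "gibbs_bound M N 0"
    using zero rel_entropy_le_iff_gibbs_bound[OF M N sets, of 0] by (simp add: zero_ereal_def)
  then have measure_le: "measure M A \<le> measure N A" if "A \<in> sets N" for A
    using gibbs_bound_0_imp_measure_le[OF _ M N sets that] by blast
  show "M = N"
  proof (rule measure_eqI[OF sets])
    fix A assume A: "A \<in> sets M"
    have "measure N A \<le> measure M A"
      using measure_le[of "space M - A"] A sets space M.prob_compl[of A] N.prob_compl[of A] by auto
    with measure_le[of A] A sets show "emeasure M A = emeasure N A"
      by (simp add: M.emeasure_eq_measure N.emeasure_eq_measure)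
  qed
next
  assume "M = N"
  moreover have "prob_density N (\<lambda>_. 1)"
    using N by (intro prob_density.intro prob_density_axioms.intro) (auto simp: density_1)
  ultimately show "rel_entropy M N = 0"
    using prob_density.rel_entropy_density[of N "\<lambda>_. 1"] by (simp add: density_1)
qed

lemma rel_entropy_event_bound:
  assumes M: "prob_space M" and N: "prob_space N" and sets: "sets M = sets N"
    and entropy_le: "rel_entropy M N \<le> ereal c" and A: "A \<in> sets N" and pos: "0 < measure M A"
  shows "0 < measure N A" and "- measure M A * ln (measure N A) \<le> c + ln 2"
proof -
  interpret N: prob_space N by fact
  let ?p = "measure M A" and ?q = "measure N A"
  have event: "t * ?p \<le> c + ln (1 + (exp t - 1) * ?q)" for t
    using entropy_le
    by (intro gibbs_bound_event M N sets A) (simp add: rel_entropy_le_iff_gibbs_bound[OF M N sets])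
  show q: "0 < ?q"
  proof (rule ccontr)
    assume "\<not> 0 < ?q"
    then have "?q = 0" using measure_nonneg[of N A] by linarith
    then show False using event[of "(c + 1) / ?p"] pos by simp
  qed
  have "exp (- ln ?q) = 1 / ?q" using q by (simp add: exp_minus inverse_eq_divide)
  then have "1 + (exp (- ln ?q) - 1) * ?q = 2 - ?q" using q by (simp add: algebra_simps)
  moreover have "ln (2 - ?q) \<le> ln 2"
    using q by (intro ln_mono) (auto intro: le_less_trans[OF N.prob_le_1])
  ultimately show "- ?p * ln ?q \<le> c + ln 2"
    using event[of "- ln ?q"] by (simp add: algebra_simps)
qed

subsection \<open>Products of densities\<close>

lemma PiM_density_of_all:
  fixes f :: "'i \<Rightarrow> 'a \<Rightarrow> real"
  assumes I: "finite I" and N: "\<And>i. sigma_finite_measure (N i)"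
    and f[measurable]: "\<And>i. f i \<in> borel_measurable (N i)" and nonneg: "\<And>i x. 0 \<le> f i x"
    and density: "\<And>i. sigma_finite_measure (density (N i) (f i))"
  shows "PiM I (\<lambda>i. density (N i) (f i)) = density (PiM I N) (\<lambda>X. \<Prod>i\<in>I. f i (X i))"
proof -
  interpret N: product_sigma_finite N by (intro product_sigma_finite.intro N)
  interpret density: product_sigma_finite "\<lambda>i. density (N i) (f i)"
    by (intro product_sigma_finite.intro density)
  let ?D = "density (PiM I N) (\<lambda>X. \<Prod>i\<in>I. f i (X i))"
  show ?thesis
  proof (rule density.PiM_eqI[symmetric, OF I])
    show "sets ?D = sets (PiM I (\<lambda>i. density (N i) (f i)))"
      by (auto intro!: sets_PiM_cong)
    fix A assume "\<And>i. i \<in> I \<Longrightarrow> A i \<in> sets (density (N i) (f i))"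
    then have A: "A i \<in> sets (N i)" if "i \<in> I" for i using that by simp
    have [measurable]: "PiE I A \<in> sets (PiM I N)" using A I by (intro sets_PiM_I_finite) auto
    have box: "ennreal (\<Prod>i\<in>I. f i (X i)) * indicator (PiE I A) X
        = (\<Prod>i\<in>I. ennreal (f i (X i)) * indicator (A i) (X i))"
      if X: "X \<in> space (PiM I N)" for X
    proof (cases "X \<in> PiE I A")
      case True
      then show ?thesis by (auto simp: prod_ennreal nonneg PiE_iff intro!: prod.cong)
    next
      case False
      then obtain i where "i \<in> I" "X i \<notin> A i" using X by (auto simp: space_PiM PiE_iff)
      then have "(\<Prod>i\<in>I. ennreal (f i (X i)) * indicator (A i) (X i)) = 0"
        using I by (intro prod_zero) (auto intro!: bexI[of _ i])
      then show ?thesis using False by simp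
    qed
    have "emeasure ?D (PiE I A) = (\<integral>\<^sup>+X. ennreal (\<Prod>i\<in>I. f i (X i)) * indicator (PiE I A) X \<partial>PiM I N)"
      by (rule emeasure_density) auto
    also have "\<dots> = (\<integral>\<^sup>+X. (\<Prod>i\<in>I. ennreal (f i (X i)) * indicator (A i) (X i)) \<partial>PiM I N)"
      by (intro nn_integral_cong box)
    also have "\<dots> = (\<Prod>i\<in>I. \<integral>\<^sup>+x. ennreal (f i x) * indicator (A i) x \<partial>N i)"
      using A I by (intro N.product_nn_integral_prod) auto
    also have "\<dots> = (\<Prod>i\<in>I. emeasure (density (N i) (f i)) (A i))"
      using A by (intro prod.cong) (auto simp: emeasure_density)
    finally show "emeasure ?D (PiE I A) = (\<Prod>i\<in>I. emeasure (density (N i) (f i)) (A i))" .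
  qed
qed

text \<open>The locale for products of \<open>\<sigma>\<close>-finite measures constrains the factors outside \<open>I\<close> as well, so these
  are replaced by a point mass.\<close>

lemma PiM_density:
  fixes f :: "'i \<Rightarrow> 'a \<Rightarrow> real"
  assumes I: "finite I" and N: "\<And>i. i \<in> I \<Longrightarrow> sigma_finite_measure (N i)"
    and f: "\<And>i. i \<in> I \<Longrightarrow> f i \<in> borel_measurable (N i)" "\<And>i x. i \<in> I \<Longrightarrow> 0 \<le> f i x"
    and density: "\<And>i. i \<in> I \<Longrightarrow> sigma_finite_measure (density (N i) (f i))"
  shows "PiM I (\<lambda>i. density (N i) (f i)) = density (PiM I N) (\<lambda>X. \<Prod>i\<in>I. f i (X i))"
proof -
  define N' where "N' i = (if i \<in> I then N i else return (count_space UNIV) undefined)" for i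
  define f' where "f' i = (if i \<in> I then f i else (\<lambda>_. 1))" for i
  have return: "sigma_finite_measure (return (count_space UNIV) undefined)"
    by (intro prob_space_imp_sigma_finite prob_space_return) simp
  have "PiM I (\<lambda>i. density (N i) (f i)) = PiM I (\<lambda>i. density (N' i) (f' i))"
    by (intro PiM_cong) (auto simp: N'_def f'_def)
  also have "\<dots> = density (PiM I N') (\<lambda>X. \<Prod>i\<in>I. f' i (X i))"
    using N f density return by (intro PiM_density_of_all I) (auto simp: N'_def f'_def density_1)
  also have "PiM I N' = PiM I N"
    by (intro PiM_cong) (auto simp: N'_def)
  also have "(\<lambda>X. \<Prod>i\<in>I. f' i (X i)) = (\<lambda>X. \<Prod>i\<in>I. f i (X i))"
    by (intro ext prod.cong) (auto simp: f'_def)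
  finally show ?thesis .
qed

lemma integral_ln_prod:
  fixes g :: "'i \<Rightarrow> 'a \<Rightarrow> real"
  assumes I: "finite I" and g[measurable]: "\<And>i. i \<in> I \<Longrightarrow> g i \<in> borel_measurable M"
    and pos: "\<And>i. i \<in> I \<Longrightarrow> AE x in M. 0 < g i x"
    and ln_integrable: "\<And>i. i \<in> I \<Longrightarrow> integrable M (\<lambda>x. ln (g i x))"
  shows "AE x in M. 0 < (\<Prod>i\<in>I. g i x)" and "integrable M (\<lambda>x. ln (\<Prod>i\<in>I. g i x))"
    and "(\<integral>x. ln (\<Prod>i\<in>I. g i x) \<partial>M) = (\<Sum>i\<in>I. \<integral>x. ln (g i x) \<partial>M)"
proof -
  have all_pos: "AE x in M. \<forall>i\<in>I. 0 < g i x"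
    using I pos by (simp add: AE_finite_all)
  then show "AE x in M. 0 < (\<Prod>i\<in>I. g i x)"
    by eventually_elim (auto intro: prod_pos)
  from all_pos have ln_prod: "AE x in M. (\<Sum>i\<in>I. ln (g i x)) = ln (\<Prod>i\<in>I. g i x)"
    by eventually_elim (metis I ln_prod less_irrefl)
  have sum: "integrable M (\<lambda>x. \<Sum>i\<in>I. ln (g i x))"
    by (intro Bochner_Integration.integrable_sum ln_integrable)
  show "integrable M (\<lambda>x. ln (\<Prod>i\<in>I. g i x))"
    by (rule integrable_cong_AE_imp[OF sum _ ln_prod]) measurable
  have "(\<integral>x. ln (\<Prod>i\<in>I. g i x) \<partial>M) = (\<integral>x. (\<Sum>i\<in>I. ln (g i x)) \<partial>M)"
    using ln_prod by (intro integral_cong_AE) auto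
  also have "\<dots> = (\<Sum>i\<in>I. \<integral>x. ln (g i x) \<partial>M)"
    by (intro Bochner_Integration.integral_sum ln_integrable)
  finally show "(\<integral>x. ln (\<Prod>i\<in>I. g i x) \<partial>M) = (\<Sum>i\<in>I. \<integral>x. ln (g i x) \<partial>M)" .
qed

lemma
  fixes g :: "'a \<Rightarrow> real"
  assumes M: "\<And>i. i \<in> I \<Longrightarrow> prob_space (M i)" and i: "i \<in> I" and g: "g \<in> borel_measurable (M i)"
  shows integrable_PiM_component: "integrable (PiM I M) (\<lambda>X. g (X i)) \<longleftrightarrow> integrable (M i) g"
    and integral_PiM_component: "(\<integral>X. g (X i) \<partial>PiM I M) = (\<integral>x. g x \<partial>M i)"
proof -
  have distr: "distr (PiM I M) (M i) (\<lambda>X. X i) = M i"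
    using M i by (rule distr_PiM_component)
  have [measurable]: "(\<lambda>X. X i) \<in> measurable (PiM I M) (M i)"
    using i by (rule measurable_component_singleton)
  show "integrable (PiM I M) (\<lambda>X. g (X i)) \<longleftrightarrow> integrable (M i) g"
    using integrable_distr_eq[of "\<lambda>X. X i" "PiM I M" "M i" g] g distr by simp
  show "(\<integral>X. g (X i) \<partial>PiM I M) = (\<integral>x. g x \<partial>M i)"
    using integral_distr[of "\<lambda>X. X i" "PiM I M" "M i" g] g distr by simp
qed

lemma rel_entropy_PiM_of_density:
  fixes f :: "'i \<Rightarrow> 'a \<Rightarrow> real"
  assumes I: "finite I" and f: "\<And>i. i \<in> I \<Longrightarrow> prob_density (N i) (f i)"
    and ln: "\<And>i. i \<in> I \<Longrightarrow> integrable (density (N i) (f i)) (\<lambda>x. ln (f i x))"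
  shows "rel_entropy (PiM I (\<lambda>i. density (N i) (f i))) (PiM I N)
    = ereal (\<Sum>i\<in>I. \<integral>x. ln (f i x) \<partial>density (N i) (f i))"
proof -
  let ?D = "\<lambda>i. density (N i) (f i)" and ?F = "\<lambda>X. \<Prod>i\<in>I. f i (X i)"
  have prob: "prob_space (N i)" "prob_space (?D i)" if "i \<in> I" for i
    using f[OF that] by (simp_all add: prob_density_def prob_density_axioms_def)
  have f_meas: "f i \<in> borel_measurable (N i)" and f_nonneg: "\<And>x. 0 \<le> f i x" if "i \<in> I" for i
    using f[OF that] by (simp_all add: prob_density_def prob_density_axioms_def)
  have PiM_eq: "PiM I ?D = density (PiM I N) ?F"
    using prob f_meas f_nonneg by (intro PiM_density I prob_space_imp_sigma_finite)
  have [measurable]: "(\<lambda>X. f i (X i)) \<in> borel_measurable (PiM I N)" if "i \<in> I" for i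
    using f_meas[OF that] that by measurable
  have ln_meas: "(\<lambda>x. ln (f i x)) \<in> borel_measurable (?D i)" if "i \<in> I" for i
    using f_meas[OF that] by simp
  have component: "AE X in PiM I ?D. 0 < f i (X i)" "integrable (PiM I ?D) (\<lambda>X. ln (f i (X i)))"
    "(\<integral>X. ln (f i (X i)) \<partial>PiM I ?D) = (\<integral>x. ln (f i x) \<partial>?D i)" if "i \<in> I" for i
    using integrable_PiM_component[where M = ?D, OF prob(2) that ln_meas[OF that]] ln[OF that]
      integral_PiM_component[where M = ?D, OF prob(2) that ln_meas[OF that]]
      AE_PiM_component[where M = ?D, OF prob(2) that prob_density.AE_density_pos[OF f[OF that]]]
    by simp_all
  note ln_prod = integral_ln_prod[OF I _ component(1,2)]
  interpret prob_density "PiM I N" ?F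
    using prob f_nonneg
    by (intro prob_density.intro prob_density_axioms.intro prob_space_PiM)
      (auto intro: prod_nonneg prob_space_PiM simp flip: PiM_eq)
  show ?thesis
    using rel_entropy_density ln_prod component(3) by (simp add: PiM_eq)
qed

lemma rel_entropy_PiM_le:
  assumes I: "finite I" and M: "\<And>i. i \<in> I \<Longrightarrow> prob_space (M i)" and N: "\<And>i. i \<in> I \<Longrightarrow> prob_space (N i)"
  shows "rel_entropy (PiM I M) (PiM I N) \<le> (\<Sum>i\<in>I. rel_entropy (M i) (N i))"
proof (cases "\<forall>i\<in>I. rel_entropy (M i) (N i) < \<infinity>")
  case True
  have "\<exists>f. prob_density (N i) f \<and> M i = density (N i) f \<and> integrable (M i) (\<lambda>x. ln (f x))
      \<and> rel_entropy (M i) (N i) = ereal (\<integral>x. ln (f x) \<partial>M i)" if "i \<in> I" for i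
    using rel_entropy_finiteE[OF M[OF that] N[OF that]] True that by metis
  then have "\<forall>i\<in>I. \<exists>f. prob_density (N i) f \<and> M i = density (N i) f \<and> integrable (M i) (\<lambda>x. ln (f x))
      \<and> rel_entropy (M i) (N i) = ereal (\<integral>x. ln (f x) \<partial>M i)" by blast
  then obtain f where f: "\<And>i. i \<in> I \<Longrightarrow> prob_density (N i) (f i)" "\<And>i. i \<in> I \<Longrightarrow> M i = density (N i) (f i)"
    "\<And>i. i \<in> I \<Longrightarrow> integrable (M i) (\<lambda>x. ln (f i x))"
    "\<And>i. i \<in> I \<Longrightarrow> rel_entropy (M i) (N i) = ereal (\<integral>x. ln (f i x) \<partial>M i)"
    unfolding bchoice_iff by blast
  have "PiM I M = PiM I (\<lambda>i. density (N i) (f i))"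
    using f(2) by (intro PiM_cong) auto
  then have "rel_entropy (PiM I M) (PiM I N) = ereal (\<Sum>i\<in>I. \<integral>x. ln (f i x) \<partial>density (N i) (f i))"
    using f(1-3) by (simp add: rel_entropy_PiM_of_density[OF I])
  also have "\<dots> = (\<Sum>i\<in>I. rel_entropy (M i) (N i))"
    using f(2,4) by simp
  finally show ?thesis by simp
next
  case False
  then have "(\<Sum>i\<in>I. rel_entropy (M i) (N i)) = \<infinity>"
    using I by (subst sum_Pinfty) (auto simp: less_top[symmetric])
  then show ?thesis by simp
qed

subsection \<open>Boltzmann-Gibbs entropy and relative entropy\<close>

lemma bg_entropy_density:
  fixes p :: "'a \<Rightarrow> real"
  assumes L: "sigma_finite_measure L" and p[measurable]: "p \<in> borel_measurable L" "\<And>x. 0 \<le> p x"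
  shows "bg_entropy L (density L p) = (if integrable (density L p) (\<lambda>x. ln (p x))
     then ereal (- (\<integral>x. ln (p x) \<partial>density L p)) else -\<infinity>)"
proof -
  let ?Q = "\<lambda>q. q \<in> borel_measurable L \<and> (\<forall>x. 0 \<le> q x) \<and> density L p = density L (\<lambda>x. ennreal (q x))"
  define q where "q = (SOME q. ?Q q)"
  have ex: "\<exists>q. ?Q q" using p by (intro exI[of _ p]) auto
  then have "?Q q" unfolding q_def by (rule someI_ex)
  then have q[measurable]: "q \<in> borel_measurable L" and q_nonneg: "\<And>x. 0 \<le> q x"
    and density_eq: "density L p = density L q" by auto
  have "AE x in L. ennreal (p x) = ennreal (q x)"
    using density_eq by (subst sigma_finite_measure.density_unique_iff[OF L, symmetric]) auto
  then have "AE x in L. q x * ln (q x) = p x * ln (p x)"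
    by eventually_elim (use p(2) q_nonneg in \<open>auto simp: ennreal_inj\<close>)
  then have "integrable L (\<lambda>x. q x * ln (q x)) \<longleftrightarrow> integrable L (\<lambda>x. p x * ln (p x))"
    and "(\<integral>x. q x * ln (q x) \<partial>L) = (\<integral>x. p x * ln (p x) \<partial>L)"
    by (intro integrable_cong_AE integral_cong_AE; simp)+
  then show ?thesis
    using ex p by (simp add: bg_entropy_def Let_def q_def[symmetric]
        integrable_real_density integral_real_density)
qed

lemma bg_entropy_not_PInf: "bg_entropy L M \<noteq> \<infinity>"
  by (auto simp: bg_entropy_def Let_def)

lemma bg_entropy_finiteE:
  assumes L: "sigma_finite_measure L" and fin: "bg_entropy L M > -\<infinity>"
  obtains p :: "'a \<Rightarrow> real" where "p \<in> borel_measurable L" "\<And>x. 0 \<le> p x" "M = density L p"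
    "integrable M (\<lambda>x. ln (p x))" "bg_entropy L M = ereal (- (\<integral>x. ln (p x) \<partial>M))"
proof -
  obtain p where p: "p \<in> borel_measurable L" "\<And>x. 0 \<le> p x" "M = density L (\<lambda>x. ennreal (p x))"
    using fin by (auto simp: bg_entropy_def split: if_splits)
  then show ?thesis
    using that[OF p] bg_entropy_density[OF L p(1,2)] fin by (auto split: if_splits)
qed

lemma absolutely_continuous_density_density:
  fixes p \<pi> :: "'a \<Rightarrow> real"
  assumes [measurable]: "p \<in> borel_measurable L" "\<pi> \<in> borel_measurable L"
    and pos: "AE x in density L p. 0 < \<pi> x"
  shows "absolutely_continuous (density L \<pi>) (density L p)"
  unfolding absolutely_continuous_def
proof
  fix A assume "A \<in> null_sets (density L \<pi>)"
  then have A: "A \<in> sets L" "AE x in L. x \<in> A \<longrightarrow> ennreal (\<pi> x) = 0"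
    by (auto simp: null_sets_density_iff)
  have "AE x in L. 0 < ennreal (p x) \<longrightarrow> 0 < \<pi> x"
    using pos by (subst (asm) AE_density) auto
  with A(2) have "AE x in L. x \<in> A \<longrightarrow> ennreal (p x) = 0"
    by eventually_elim (auto simp: ennreal_eq_0_iff not_gr_zero)
  then show "A \<in> null_sets (density L p)"
    using A(1) by (subst null_sets_density_iff) auto
qed

lemma
  fixes f g :: "'a \<Rightarrow> real"
  assumes [measurable]: "f \<in> borel_measurable M" "g \<in> borel_measurable M"
    and pos: "AE x in M. 0 < f x" "AE x in M. 0 < g x" and ln_f: "integrable M (\<lambda>x. ln (f x))"
  shows integrable_ln_mult_iff: "integrable M (\<lambda>x. ln (f x * g x)) \<longleftrightarrow> integrable M (\<lambda>x. ln (g x))"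
    and integral_ln_mult: "integrable M (\<lambda>x. ln (g x)) \<Longrightarrow>
      (\<integral>x. ln (f x * g x) \<partial>M) = (\<integral>x. ln (f x) \<partial>M) + (\<integral>x. ln (g x) \<partial>M)"
proof -
  have ln_mult: "AE x in M. ln (f x * g x) = ln (f x) + ln (g x)"
    using pos by eventually_elim (simp add: ln_mult)
  have "integrable M (\<lambda>x. ln (f x * g x)) \<longleftrightarrow> integrable M (\<lambda>x. ln (f x) + ln (g x))"
    by (intro integrable_cong_AE ln_mult) simp_all
  also have "\<dots> \<longleftrightarrow> integrable M (\<lambda>x. ln (g x))"
    using ln_f Bochner_Integration.integrable_diff[OF _ ln_f, of "\<lambda>x. ln (f x) + ln (g x)"] by auto
  finally show "integrable M (\<lambda>x. ln (f x * g x)) \<longleftrightarrow> integrable M (\<lambda>x. ln (g x))" .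
  show "(\<integral>x. ln (f x * g x) \<partial>M) = (\<integral>x. ln (f x) \<partial>M) + (\<integral>x. ln (g x) \<partial>M)"
    if "integrable M (\<lambda>x. ln (g x))"
    using ln_f that integral_cong_AE[OF _ _ ln_mult] by simp
qed

lemma bg_entropy_eq_minus_rel_entropy:
  fixes \<pi> :: "'a \<Rightarrow> real"
  assumes L: "sigma_finite_measure L" and \<pi>[measurable]: "\<pi> \<in> borel_measurable L" "\<And>x. 0 \<le> \<pi> x"
    and N: "prob_space (density L \<pi>)" and M: "prob_space M" and sets: "sets M = sets L"
    and pos: "AE x in M. 0 < \<pi> x" and ln_\<pi>: "integrable M (\<lambda>x. ln (\<pi> x))"
  shows "bg_entropy L M = - rel_entropy M (density L \<pi>) - ereal (\<integral>x. ln (\<pi> x) \<partial>M)"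
proof (cases "absolutely_continuous (density L \<pi>) M")
  case True
  have "sets M = sets (density L \<pi>)" using sets by simp
  then obtain f where f: "prob_density (density L \<pi>) f" and M_f: "M = density (density L \<pi>) f"
    using absolutely_continuousE[OF M N _ True] by blast
  interpret prob_density "density L \<pi>" f by fact
  have f_meas[measurable]: "f \<in> borel_measurable L" "f \<in> borel_measurable M"
    using density_measurable sets by (simp_all cong: measurable_cong_sets)
  have [measurable]: "\<pi> \<in> borel_measurable M"
    using \<pi>(1) sets by (simp cong: measurable_cong_sets)
  have M_L: "M = density L (\<lambda>x. \<pi> x * f x)"
    unfolding M_f using \<pi>(2) density_nonneg by (subst density_density_eq) (auto simp: ennreal_mult)
  have f_pos: "AE x in M. 0 < f x" unfolding M_f by (rule AE_density_pos)
  have "rel_entropy M (density L \<pi>) = (if integrable M (\<lambda>x. ln (f x)) then ereal (\<integral>x. ln (f x) \<partial>M) else \<infinity>)"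
    using rel_entropy_density by (simp flip: M_f)
  moreover have "bg_entropy L M = (if integrable M (\<lambda>x. ln (\<pi> x * f x))
      then ereal (- (\<integral>x. ln (\<pi> x * f x) \<partial>M)) else -\<infinity>)"
    using bg_entropy_density[OF L, of "\<lambda>x. \<pi> x * f x"] \<pi>(2) density_nonneg by (simp flip: M_L)
  ultimately show ?thesis
    using ln_\<pi> by (simp add: integrable_ln_mult_iff[OF _ _ pos f_pos] integral_ln_mult[OF _ _ pos f_pos])
next
  case False
  then have "\<not> (\<exists>p. p \<in> borel_measurable L \<and> (\<forall>x. 0 \<le> p x) \<and> M = density L (\<lambda>x. ennreal (p x)))"
    using absolutely_continuous_density_density[OF _ \<pi>(1)] pos by blast
  then have "bg_entropy L M = -\<infinity>" unfolding bg_entropy_def by (rule if_not_P)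
  moreover have "rel_entropy M (density L \<pi>) = \<infinity>" using False by (simp add: rel_entropy_def)
  ultimately show ?thesis by simp
qed

lemma bg_entropy_eq_minus_rel_entropy_const:
  fixes \<pi> :: "'a \<Rightarrow> real"
  assumes "sigma_finite_measure L" and \<pi>[measurable]: "\<pi> \<in> borel_measurable L" "\<And>x. 0 \<le> \<pi> x"
    and "prob_space (density L \<pi>)" and M: "prob_space M" and sets: "sets M = sets L"
    and const: "AE x in M. \<pi> x = c" and "0 < c"
  shows "bg_entropy L M = - rel_entropy M (density L \<pi>) - ereal (ln c)"
proof -
  interpret M: prob_space M by fact
  have [measurable]: "\<pi> \<in> borel_measurable M" using \<pi>(1) sets by (simp cong: measurable_cong_sets)
  have ln_const: "AE x in M. ln c = ln (\<pi> x)" using const by eventually_elim simp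
  have "integrable M (\<lambda>x. ln (\<pi> x))"
    by (rule integrable_cong_AE_imp[OF _ _ ln_const]) simp_all
  moreover have "AE x in M. 0 < \<pi> x" using const by eventually_elim (simp add: \<open>0 < c\<close>)
  ultimately have "bg_entropy L M = - rel_entropy M (density L \<pi>) - ereal (\<integral>x. ln (\<pi> x) \<partial>M)"
    by (intro bg_entropy_eq_minus_rel_entropy assms)
  also have "(\<integral>x. ln (\<pi> x) \<partial>M) = (\<integral>x. ln c \<partial>M)"
    using ln_const by (intro integral_cong_AE) auto
  finally show ?thesis by (simp add: M.prob_space)
qed

subsection \<open>Means determined by moments\<close>

locale continuous_mean =
  fixes S :: "'a::topological_space set" and E :: "('a \<Rightarrow> real) \<Rightarrow> real"
  assumes mean_add: "continuous_on S f \<Longrightarrow> continuous_on S g \<Longrightarrow> E (\<lambda>x. f x + g x) = E f + E g"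
    and mean_scale: "continuous_on S f \<Longrightarrow> E (\<lambda>x. c * f x) = c * E f"
    and mean_nonneg: "continuous_on S f \<Longrightarrow> (\<And>x. x \<in> S \<Longrightarrow> 0 \<le> f x) \<Longrightarrow> 0 \<le> E f"
    and mean_one: "E (\<lambda>_. 1) = 1"
begin

lemma mean_const: "E (\<lambda>_. c) = c"
  using mean_scale[of "\<lambda>_. 1" c] by (simp add: mean_one)

lemma mean_le_add:
  assumes f: "continuous_on S f" and g: "continuous_on S g" and f_le: "\<And>x. x \<in> S \<Longrightarrow> f x \<le> g x + e"
  shows "E f \<le> E g + e"
proof -
  have "0 \<le> E (\<lambda>x. (g x + e) + (-1) * f x)"
    using f_le by (intro mean_nonneg continuous_intros f g) (simp add: add.commute)
  also have "\<dots> = E (\<lambda>x. g x + e) + E (\<lambda>x. (-1) * f x)"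
    by (intro mean_add continuous_intros f g)
  also have "E (\<lambda>x. g x + e) = E g + e"
    by (subst mean_add) (auto simp: g mean_const)
  also have "E (\<lambda>x. (-1) * f x) = - E f"
    by (subst mean_scale) (auto simp: f)
  finally show ?thesis by simp
qed

lemma abs_mean_diff_le:
  assumes "continuous_on S f" "continuous_on S g" and "\<And>x. x \<in> S \<Longrightarrow> \<bar>f x - g x\<bar> \<le> e"
  shows "\<bar>E f - E g\<bar> \<le> e"
proof -
  have "f x \<le> g x + e" "g x \<le> f x + e" if "x \<in> S" for x
    using assms(3)[OF that] by linarith+
  then show ?thesis
    using mean_le_add[OF assms(1,2), of e] mean_le_add[OF assms(2,1), of e] by (simp add: abs_le_iff)
qed

lemma mean_exp_pos:
  assumes "compact S" and h: "continuous_on S h"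
  shows "0 < E (\<lambda>x. exp (h x))"
proof -
  obtain B where B: "\<And>x. x \<in> S \<Longrightarrow> \<bar>h x\<bar> \<le> B"
    using compact_imp_bounded[OF compact_continuous_image[OF h \<open>compact S\<close>]] by (auto simp: bounded_iff)
  then have "exp (- B) \<le> exp (h x)" if "x \<in> S" for x
    using that by (force simp: abs_le_iff)
  then have "E (\<lambda>_. exp (- B)) \<le> E (\<lambda>x. exp (h x)) + 0"
    by (intro mean_le_add continuous_intros h) simp
  then show ?thesis
    using exp_gt_zero[of "- B"] unfolding mean_const by linarith
qed

end

lemma continuous_mean_average:
  assumes "finite J" "J \<noteq> {}" "\<And>j. j \<in> J \<Longrightarrow> x j \<in> S"
  shows "continuous_mean S (\<lambda>h. (\<Sum>j\<in>J. h (x j)) / real (card J))"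
  using assms
  by unfold_locales (auto simp: sum.distrib add_divide_distrib sum_distrib_left
      intro!: divide_nonneg_nonneg sum_nonneg)

lemma continuous_mean_kappa:
  assumes "N > 0" "\<And>j. j < N \<Longrightarrow> x j \<in> S"
  shows "continuous_mean S (\<lambda>h. kappa N (\<lambda>j. h (x j)))"
  using continuous_mean_average[of "{..<N}" x S] assms by (auto simp: kappa_def)

locale monomial_family =
  fixes S :: "'a::t2_space set" and I :: "'i set" and \<phi> :: "'i \<Rightarrow> 'a \<Rightarrow> real"
  assumes compact: "compact S"
    and continuous: "i \<in> I \<Longrightarrow> continuous_on S (\<phi> i)"
    and unit: "\<exists>i\<in>I. \<forall>x. \<phi> i x = 1"
    and product: "i \<in> I \<Longrightarrow> j \<in> I \<Longrightarrow> \<exists>k\<in>I. \<forall>x. \<phi> k x = \<phi> i x * \<phi> j x"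
    and separating: "x \<in> S \<Longrightarrow> y \<in> S \<Longrightarrow> x \<noteq> y \<Longrightarrow> \<exists>i\<in>I. \<phi> i x \<noteq> \<phi> i y"
begin

inductive polynomial :: "('a \<Rightarrow> real) \<Rightarrow> bool" where
  monomial: "i \<in> I \<Longrightarrow> polynomial (\<phi> i)"
| add: "polynomial f \<Longrightarrow> polynomial g \<Longrightarrow> polynomial (\<lambda>x. f x + g x)"
| scale: "polynomial f \<Longrightarrow> polynomial (\<lambda>x. c * f x)"

lemma polynomial_continuous: "polynomial f \<Longrightarrow> continuous_on S f"
  by (induction rule: polynomial.induct) (auto intro: continuous continuous_intros)

lemma polynomial_const: "polynomial (\<lambda>x. c)"
proof -
  obtain i where "i \<in> I" "\<And>x. \<phi> i x = 1" using unit by blast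
  then show ?thesis using scale[OF monomial[of i], of c] by simp
qed

lemma polynomial_mult:
  assumes "polynomial f" "polynomial g"
  shows "polynomial (\<lambda>x. f x * g x)"
  using assms(1)
proof (induction rule: polynomial.induct)
  case (monomial i)
  show ?case
    using assms(2)
  proof (induction rule: polynomial.induct)
    case (monomial j)
    obtain k where "k \<in> I" "\<And>x. \<phi> k x = \<phi> i x * \<phi> j x"
      using product[OF \<open>i \<in> I\<close> \<open>j \<in> I\<close>] by blast
    then have "\<phi> k = (\<lambda>x. \<phi> i x * \<phi> j x)" by auto
    then show ?case using polynomial.monomial[OF \<open>k \<in> I\<close>] by simp
  next
    case (add f g)
    from polynomial.add[OF add.IH] show ?case by (simp add: distrib_left)
  next
    case (scale f c)
    from polynomial.scale[OF scale.IH, of c] show ?case by (simp add: mult_ac)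
  qed
next
  case (add f f')
  from polynomial.add[OF add.IH] show ?case by (simp add: distrib_right)
next
  case (scale f c)
  from polynomial.scale[OF scale.IH, of c] show ?case by (simp add: mult_ac)
qed

lemma polynomial_dense:
  assumes "continuous_on S h" "e > 0"
  obtains f where "polynomial f" "\<And>x. x \<in> S \<Longrightarrow> \<bar>h x - f x\<bar> < e"
proof -
  have "\<exists>f. polynomial f \<and> f x \<noteq> f y" if "x \<in> S" "y \<in> S" "x \<noteq> y" for x y
    using separating[OF that] polynomial.monomial by blast
  then have "\<exists>f. polynomial f \<and> (\<forall>x\<in>S. \<bar>h x - f x\<bar> < e)"
    using assms
    by (intro Stone_Weierstrass_HOL[where P = polynomial])
      (auto intro: compact polynomial_const polynomial_continuous polynomial.add polynomial_mult)
  then show ?thesis using that by blast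
qed

theorem moments_determine_mean:
  assumes h: "continuous_on S h"
    and E: "\<forall>\<^sub>F N in L. continuous_mean S (E N)" and E': "\<forall>\<^sub>F N in L. continuous_mean S (E' N)"
    and moments: "\<And>i. i \<in> I \<Longrightarrow> ((\<lambda>N. E N (\<phi> i) - E' N (\<phi> i)) \<longlongrightarrow> 0) L"
  shows "((\<lambda>N. E N h - E' N h) \<longlongrightarrow> 0) L"
proof (rule tendstoI)
  fix e :: real assume "e > 0"
  have polynomial_lim: "((\<lambda>N. E N f - E' N f) \<longlongrightarrow> 0) L" if "polynomial f" for f
    using that
  proof (induction rule: polynomial.induct)
    case (add f g)
    note f = add.hyps[THEN polynomial_continuous]
    have "\<forall>\<^sub>F N in L. (E N f - E' N f) + (E N g - E' N g) = E N (\<lambda>x. f x + g x) - E' N (\<lambda>x. f x + g x)"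
      using E E' by eventually_elim (simp add: continuous_mean.mean_add f)
    from Lim_transform_eventually[OF tendsto_add[OF add.IH] this] show ?case by simp
  next
    case (scale f c)
    note f = polynomial_continuous[OF scale.hyps]
    have "\<forall>\<^sub>F N in L. c * (E N f - E' N f) = E N (\<lambda>x. c * f x) - E' N (\<lambda>x. c * f x)"
      using E E' by eventually_elim (simp add: continuous_mean.mean_scale f right_diff_distrib)
    from Lim_transform_eventually[OF tendsto_mult[OF tendsto_const scale.IH] this] show ?case by simp
  qed (rule moments)
  obtain f where f: "polynomial f" "\<And>x. x \<in> S \<Longrightarrow> \<bar>h x - f x\<bar> < e / 3"
    using polynomial_dense[OF h, of "e / 3"] \<open>e > 0\<close> by auto
  have near: "\<bar>D h - D f\<bar> \<le> e / 3" if "continuous_mean S D" for D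
    by (intro continuous_mean.abs_mean_diff_le[OF that] h polynomial_continuous f less_imp_le)
  have "\<forall>\<^sub>F N in L. dist (E N f - E' N f) 0 < e / 3"
    using polynomial_lim[OF f(1)] \<open>e > 0\<close> by (intro tendstoD) auto
  with E E' show "\<forall>\<^sub>F N in L. dist (E N h - E' N h) 0 < e"
  proof eventually_elim
    case (elim N)
    then show ?case using near[of "E N"] near[of "E' N"] unfolding dist_real_def by linarith
  qed
qed

end

lemma monomial_family_interval: "monomial_family {a..b} UNIV (\<lambda>k t :: real. t ^ k)"
proof
  show "\<exists>k\<in>UNIV. \<forall>t :: real. t ^ k = 1" by (intro bexI[of _ 0]) auto
  show "\<exists>k\<in>UNIV. \<forall>t :: real. t ^ k = t ^ i * t ^ j" for i j
    by (intro bexI[of _ "i + j"]) (auto simp: power_add)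
  show "\<exists>k\<in>UNIV. x ^ k \<noteq> y ^ k" if "x \<noteq> y" for x y :: real using that by (intro bexI[of _ 1]) auto
qed (auto intro!: continuous_intros)

subsection \<open>Probability measures on the cube\<close>

abbreviation monomial :: "nat list \<Rightarrow> (nat \<Rightarrow> real) \<Rightarrow> real" where
  "monomial is x \<equiv> prod_list (map x is)"

lemma cubeD: "x \<in> cube R n \<Longrightarrow> i < n \<Longrightarrow> \<bar>x i\<bar> \<le> R"
  by (auto simp: cube_def PiE_iff abs_le_iff minus_le_iff)

lemma cube_arb: "x \<in> cube R n \<Longrightarrow> \<not> i < n \<Longrightarrow> x i = undefined"
  by (simp add: cube_def PiE_iff extensional_def)

lemma restrict_in_cube: "(\<And>i. i < n \<Longrightarrow> x i \<in> {-R..R}) \<Longrightarrow> (\<lambda>i\<in>{..<n}. x i) \<in> cube R n"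
  by (simp add: cube_def restrict_PiE_iff)

lemma compact_cube: "compact (cube R n)"
proof -
  have "x \<in> cube R n \<longleftrightarrow> x \<in> PiE UNIV (\<lambda>i. if i < n then {-R..R} else {undefined})" for x
    unfolding cube_def PiE_iff extensional_def
    by (auto simp: all_conj_distrib[symmetric] split: if_split_asm)
  then have "cube R n = PiE UNIV (\<lambda>i. if i < n then {-R..R} else {undefined})"
    by blast
  then have "compactin (product_topology (\<lambda>_. euclidean) UNIV) (cube R n)"
    by (auto simp: compactin_PiE compactin_euclidean_iff)
  then show ?thesis
    by (simp add: euclidean_product_topology compactin_euclidean_iff)
qed

lemma cube_uniformly_continuous:
  fixes h :: "(nat \<Rightarrow> real) \<Rightarrow> real"
  assumes h: "continuous_on (cube R n) h" and "e > 0"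
  obtains \<eta> where "\<eta> > 0"
    "\<And>x y. x \<in> cube R n \<Longrightarrow> y \<in> cube R n \<Longrightarrow> (\<And>i. i < n \<Longrightarrow> \<bar>x i - y i\<bar> \<le> \<eta>) \<Longrightarrow> \<bar>h x - h y\<bar> < e"
proof -
  have "uniformly_continuous_on (cube R n) h"
    by (rule compact_uniformly_continuous[OF h compact_cube])
  then obtain d where d: "d > 0" "\<And>x y. x \<in> cube R n \<Longrightarrow> y \<in> cube R n \<Longrightarrow> dist x y < d \<Longrightarrow> dist (h x) (h y) < e"
    unfolding uniformly_continuous_on_def using \<open>e > 0\<close> by metis
  obtain N where N: "(1 / 2 :: real) ^ N < d / 2"
    using real_arch_pow_inv[of "d / 2" "1 / 2"] d by auto
  show ?thesis
  proof (rule that[of "d / 8"])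
    fix x y assume x: "x \<in> cube R n" and y: "y \<in> cube R n" and close: "\<And>i. i < n \<Longrightarrow> \<bar>x i - y i\<bar> \<le> d / 8"
    have "dist (x i) (y i) \<le> d / 8" for i
      using close[of i] cube_arb[OF x, of i] cube_arb[OF y, of i] d
      by (cases "i < n") (auto simp: dist_real_def)
    then have "Max {dist (x (from_nat m)) (y (from_nat m)) | m. m \<le> N} \<le> d / 8"
      by (subst Max_le_iff) auto
    moreover have "dist x y \<le> 2 * Max {dist (x (from_nat m)) (y (from_nat m)) | m. m \<le> N} + (1 / 2) ^ N"
      by (rule dist_fun_le_dist_first_terms)
    ultimately have "dist x y < d" using N d by simp
    from d(2)[OF x y this] show "\<bar>h x - h y\<bar> < e" by (simp add: dist_real_def)
  qed (use d in simp)
qed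

lemma abs_monomial_le:
  assumes "\<And>i. i \<in> set is \<Longrightarrow> \<bar>x i\<bar> \<le> R"
  shows "\<bar>monomial is x\<bar> \<le> R ^ length is"
  using assms
proof (induction "is")
  case (Cons i "is")
  have "\<bar>x i\<bar> * \<bar>monomial is x\<bar> \<le> R * R ^ length is"
    using Cons.prems[of i] by (intro mult_mono Cons) auto
  then show ?case by (simp add: abs_mult)
qed simp

lemma abs_monomial_diff_le:
  assumes "R \<ge> 1" "set is \<subseteq> {..<n}"
    and "\<And>i. i < n \<Longrightarrow> \<bar>x i\<bar> \<le> R" "\<And>i. i < n \<Longrightarrow> \<bar>y i\<bar> \<le> R"
  shows "\<bar>monomial is x - monomial is y\<bar> \<le> real (length is) * R ^ length is * (\<Sum>i<n. \<bar>x i - y i\<bar>)"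
  using assms(2)
proof (induction "is")
  case (Cons a "is")
  let ?D = "\<Sum>i<n. \<bar>x i - y i\<bar>" and ?l = "real (length is)" and ?p = "R ^ length is"
  have D: "0 \<le> ?D" by (intro sum_nonneg) simp
  have a: "\<bar>x a\<bar> \<le> R" and "\<bar>x a - y a\<bar> \<le> ?D"
    using assms(3) Cons.prems by (auto intro!: member_le_sum)
  moreover have "\<bar>monomial is y\<bar> \<le> ?p"
    using assms(4) Cons.prems by (intro abs_monomial_le) auto
  moreover have "\<bar>monomial is x - monomial is y\<bar> \<le> ?l * ?p * ?D"
    using Cons by simp
  moreover have "monomial (a # is) x - monomial (a # is) y
      = x a * (monomial is x - monomial is y) + (x a - y a) * monomial is y"
    by (simp add: algebra_simps)
  ultimately have "\<bar>monomial (a # is) x - monomial (a # is) y\<bar> \<le> R * (?l * ?p * ?D) + ?D * ?p"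
    using D \<open>R \<ge> 1\<close>
    by (simp only:)
      (intro order_trans[OF abs_triangle_ineq] add_mono, auto simp: abs_mult intro!: mult_mono)
  also have "\<dots> \<le> R * (?l * ?p * ?D) + R * (?D * ?p)"
    using \<open>R \<ge> 1\<close> D mult_right_mono[of 1 R "?D * ?p"] by simp
  finally show ?case by (simp add: algebra_simps)
qed simp

lemma monomial_eq_prod_count:
  assumes "set is \<subseteq> {..<n}"
  shows "monomial is x = (\<Prod>i<n. x i ^ count_list is i)"
  using assms
proof (induction "is")
  case (Cons a "is")
  have "(\<Prod>i<n. x i ^ count_list (a # is) i) = (\<Prod>i<n. (if i = a then x i else 1) * x i ^ count_list is i)"
    by (intro prod.cong) auto
  also have "\<dots> = x a * (\<Prod>i<n. x i ^ count_list is i)"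
    using Cons.prems by (simp add: prod.distrib prod.delta)
  finally show ?case using Cons by simp
qed simp

lemma continuous_on_monomial: "continuous_on S (monomial is)"
  by (induction "is")
    (auto intro!: continuous_intros intro: continuous_on_product_coordinates continuous_on_subset)

lemma monomial_family_cube: "monomial_family (cube R n) {is. set is \<subseteq> {..<n}} monomial"
proof
  show "\<exists>is\<in>{is. set is \<subseteq> {..<n}}. \<forall>x. monomial is x = 1"
    by (intro bexI[of _ "[]"]) auto
  show "\<exists>ks\<in>{is. set is \<subseteq> {..<n}}. \<forall>x. monomial ks x = monomial is x * monomial js x"
    if "is \<in> {is. set is \<subseteq> {..<n}}" "js \<in> {is. set is \<subseteq> {..<n}}" for "is" js
    using that by (intro bexI[of _ "is @ js"]) auto
  show "\<exists>is\<in>{is. set is \<subseteq> {..<n}}. monomial is x \<noteq> monomial is y"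
    if x: "x \<in> cube R n" and y: "y \<in> cube R n" and "x \<noteq> y" for x y
  proof -
    obtain i where i: "x i \<noteq> y i" using \<open>x \<noteq> y\<close> by auto
    then have "i < n" using cube_arb[OF x, of i] cube_arb[OF y, of i] by metis
    with i show ?thesis by (intro bexI[of _ "[i]"]) auto
  qed
qed (rule compact_cube continuous_on_monomial)+

lemma borel_measurable_id_PiM_lborel:
  "(\<lambda>x. x) \<in> borel_measurable (PiM {..<n::nat} (\<lambda>_. lborel :: real measure))"
proof (rule measurable_coordinatewise_then_product)
  fix i
  show "(\<lambda>x. x i) \<in> borel_measurable (PiM {..<n} (\<lambda>_. lborel :: real measure))"
  proof (cases "i < n")
    case True
    then have "(\<lambda>x. x i) \<in> measurable (PiM {..<n} (\<lambda>_. lborel :: real measure)) lborel"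
      by (intro measurable_component_singleton) auto
    then show ?thesis by simp
  next
    case False
    then have "(\<lambda>x. x i) \<in> borel_measurable (PiM {..<n} (\<lambda>_. lborel :: real measure)) \<longleftrightarrow>
      (\<lambda>x. undefined :: real) \<in> borel_measurable (PiM {..<n} (\<lambda>_. lborel :: real measure))"
      by (intro measurable_cong) (auto simp: space_PiM PiE_iff extensional_def)
    then show ?thesis by simp
  qed
qed

locale cube_prob_space = prob_space \<mu> for \<mu> :: "(nat \<Rightarrow> real) measure" +
  fixes R :: real and n :: nat
  assumes sets_\<mu>: "sets \<mu> = sets (lebn n)"
    and emeasure_cube: "emeasure \<mu> (cube R n) = 1"
begin

lemma cube_sets [measurable]: "cube R n \<in> sets \<mu>"
  unfolding sets_\<mu> lebn_def cube_def by (rule sets_PiM_I_finite) auto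

lemma space_\<mu>: "space \<mu> = PiE {..<n} (\<lambda>_. UNIV)"
  using sets_eq_imp_space_eq[OF sets_\<mu>] by (simp add: lebn_def space_PiM)

lemma AE_cube: "AE x in \<mu>. x \<in> cube R n"
  using AE_prob_1[of "cube R n"] emeasure_cube by (simp add: measure_def)

lemma borel_measurable_id: "(\<lambda>x. x) \<in> borel_measurable \<mu>"
  using borel_measurable_id_PiM_lborel[of n] sets_\<mu> by (simp add: lebn_def cong: measurable_cong_sets)

lemma borel_measurable_continuous: "continuous_on UNIV h \<Longrightarrow> h \<in> borel_measurable \<mu>"
  for h :: "(nat \<Rightarrow> real) \<Rightarrow> real"
  by (rule measurable_compose[OF borel_measurable_id borel_measurable_continuous_onI])

lemma coordinate_measurable [measurable]: "(\<lambda>x. x i) \<in> borel_measurable \<mu>"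
  by (intro borel_measurable_continuous continuous_on_product_coordinates)

lemma set_integrable_cube:
  fixes h :: "(nat \<Rightarrow> real) \<Rightarrow> real"
  assumes h: "continuous_on (cube R n) h"
  shows "set_integrable \<mu> (cube R n) h"
proof -
  obtain B where B: "\<And>x. x \<in> cube R n \<Longrightarrow> \<bar>h x\<bar> \<le> B"
    using compact_imp_bounded[OF compact_continuous_image[OF h compact_cube]] by (auto simp: bounded_iff)
  have "(\<lambda>x. indicator (cube R n) x *\<^sub>R h x) \<in> borel_measurable borel"
    by (rule borel_measurable_continuous_on_indicator[OF _ h]) (simp add: compact_cube compact_imp_closed)
  from measurable_compose[OF borel_measurable_id this]
  have "(\<lambda>x. indicator (cube R n) x *\<^sub>R h x) \<in> borel_measurable \<mu>" .
  then show ?thesis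
    unfolding set_integrable_def using AE_cube B by (intro integrable_const_bound[of _ B]) auto
qed

lemma set_integral_cube_eq:
  fixes h :: "(nat \<Rightarrow> real) \<Rightarrow> real"
  assumes "continuous_on UNIV h"
  shows "(LINT x:cube R n|\<mu>. h x) = (\<integral>x. h x \<partial>\<mu>)"
  unfolding set_lebesgue_integral_def using AE_cube borel_measurable_continuous[OF assms]
  by (intro integral_cong_AE) (auto elim!: eventually_mono)

lemma continuous_mean_integral: "continuous_mean (cube R n) (\<lambda>h. LINT x:cube R n|\<mu>. h x)"
proof
  show "0 \<le> (LINT x:cube R n|\<mu>. h x)" if "\<And>x. x \<in> cube R n \<Longrightarrow> 0 \<le> h x" for h :: "(nat \<Rightarrow> real) \<Rightarrow> real"
  proof -
    have "0 \<le> indicator (cube R n) x *\<^sub>R h x" for x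
      using that by (simp split: split_indicator)
    then show ?thesis
      unfolding set_lebesgue_integral_def by (rule Bochner_Integration.integral_nonneg)
  qed
  show "(LINT x:cube R n|\<mu>. 1) = (1 :: real)"
    by (simp add: set_integral_cube_eq prob_space)
qed (auto intro: set_integrable_cube)

lemma prob_space_marg: "prob_space (marg \<mu> i)"
  unfolding marg_def by (rule prob_space_distr) simp

lemma sets_marg [simp, measurable_cong]: "sets (marg \<mu> i) = sets borel"
  by (simp add: marg_def)

lemma AE_marg: "i < n \<Longrightarrow> AE t in marg \<mu> i. t \<in> {-R..R}"
  unfolding marg_def using AE_cube
  by (subst AE_distr_iff) (auto elim!: eventually_mono simp: cube_def PiE_iff)

lemma integrable_marg_iff:
  fixes g :: "real \<Rightarrow> real"
  assumes "g \<in> borel_measurable borel"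
  shows "integrable (marg \<mu> i) g \<longleftrightarrow> integrable \<mu> (\<lambda>x. g (x i))"
  unfolding marg_def using assms by (intro integrable_distr_eq) auto

lemma integral_marg:
  fixes g :: "real \<Rightarrow> real"
  assumes "g \<in> borel_measurable borel"
  shows "(\<integral>t. g t \<partial>marg \<mu> i) = (\<integral>x. g (x i) \<partial>\<mu>)"
  unfolding marg_def using assms by (intro integral_distr) auto

definition \<nu> :: "(nat \<Rightarrow> real) measure" where "\<nu> = PiM {..<n} (\<lambda>i. marg \<mu> i)"

sublocale marg: product_prob_space "\<lambda>i. marg \<mu> i" "{..<n}"
  by (intro product_prob_space.intro product_sigma_finite.intro product_prob_space_axioms.intro
      prob_space_marg prob_space_imp_sigma_finite)

lemma prob_space_\<nu>: "prob_space \<nu>"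
  unfolding \<nu>_def by (rule marg.prob_space_axioms)

lemma sets_\<nu>: "sets \<nu> = sets \<mu>"
  unfolding \<nu>_def sets_\<mu> lebn_def by (intro sets_PiM_cong) auto

lemma cube_prob_space_\<nu>: "cube_prob_space \<nu> R n"
proof (intro cube_prob_space.intro prob_space_\<nu> cube_prob_space_axioms.intro)
  show "sets \<nu> = sets (lebn n)"
    by (simp add: sets_\<nu> sets_\<mu>)
  have "emeasure (marg \<mu> i) {-R..R} = 1" if "i < n" for i
    using AE_marg[OF that] by (intro prob_space.emeasure_eq_1_AE prob_space_marg) auto
  then show "emeasure \<nu> (cube R n) = 1"
    unfolding \<nu>_def cube_def by (subst marg.emeasure_PiM) auto
qed

lemma integral_monomial_\<nu>:
  assumes "set is \<subseteq> {..<n}"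
  shows "(\<integral>x. monomial is x \<partial>\<nu>) = (\<Prod>i<n. \<integral>t. t ^ count_list is i \<partial>marg \<mu> i)"
  unfolding \<nu>_def monomial_eq_prod_count[OF assms]
proof (rule marg.product_integral_prod)
  fix i assume "i \<in> {..<n}"
  then have "AE t in marg \<mu> i. t \<in> {-R..R}" by (intro AE_marg) simp
  then have "AE t in marg \<mu> i. norm (t ^ count_list is i) \<le> R ^ count_list is i"
    by eventually_elim (auto simp: power_abs intro!: power_mono)
  moreover have "(\<lambda>t. t ^ count_list is i) \<in> borel_measurable (marg \<mu> i)"
    by (simp cong: measurable_cong_sets)
  ultimately show "integrable (marg \<mu> i) (\<lambda>t. t ^ count_list is i)"
    using prob_space.finite_measure[OF prob_space_marg] by (intro finite_measure.integrable_const_bound)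
qed simp

end

subsection \<open>The entropy identity\<close>

definition unif_density :: "real \<Rightarrow> real \<Rightarrow> real" where
  "unif_density R t = indicator {-R..R} t / (2 * R)"

lemma unif_density_measurable [measurable]: "unif_density R \<in> borel_measurable borel"
  unfolding unif_density_def[abs_def] by simp

lemma unif_density_nonneg: "0 < R \<Longrightarrow> 0 \<le> unif_density R t"
  by (simp add: unif_density_def)

lemma prob_space_unif_density:
  assumes "0 < R"
  shows "prob_space (density lborel (unif_density R))"
proof
  have "emeasure (density lborel (unif_density R)) (space (density lborel (unif_density R)))
      = (\<integral>\<^sup>+t. ennreal (1 / (2 * R)) * indicator {-R..R} t \<partial>lborel)"
    by (subst emeasure_density)
      (auto intro!: nn_integral_cong simp: unif_density_def split: split_indicator)
  also have "\<dots> = ennreal (1 / (2 * R)) * ennreal (2 * R)"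
    using assms by (subst nn_integral_cmult_indicator) auto
  also have "\<dots> = 1" using assms by (subst ennreal_mult[symmetric]) auto
  finally show "emeasure (density lborel (unif_density R)) (space (density lborel (unif_density R))) = 1" .
qed

lemma sigma_finite_lebn: "sigma_finite_measure (lebn n)"
proof -
  interpret product_sigma_finite "\<lambda>_ :: nat. lborel :: real measure"
    by (intro product_sigma_finite.intro sigma_finite_lborel)
  show ?thesis unfolding lebn_def by (intro sigma_finite) simp
qed

lemma component_measurable_lebn:
  assumes "p \<in> borel_measurable lborel" "i < n"
  shows "(\<lambda>x. p (x i)) \<in> borel_measurable (lebn n)"
  unfolding lebn_def using assms
  by (intro measurable_compose[OF measurable_component_singleton[of i "{..<n}" "\<lambda>_. lborel"]]) auto

context cube_prob_space
begin

lemma bg_entropy_marg_finite: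
  assumes "0 < R" and fin: "bg_entropy (lebn n) \<mu> > -\<infinity>" and i: "i < n"
  shows "bg_entropy lborel (marg \<mu> i) > -\<infinity>"
proof -
  let ?u = "density lborel (unif_density R)"
  let ?U = "PiM {..<n} (\<lambda>_. ?u)" and ?\<pi> = "\<lambda>x. \<Prod>i<n. unif_density R (x i)"
  note prob_u = prob_space_unif_density[OF \<open>0 < R\<close>]
  have prob_U: "prob_space ?U" by (intro prob_space_PiM prob_u)
  have U: "?U = density (lebn n) ?\<pi>"
    unfolding lebn_def using prob_u \<open>0 < R\<close>
    by (intro PiM_density) (auto intro: sigma_finite_lborel prob_space_imp_sigma_finite unif_density_nonneg)
  have "AE x in \<mu>. ?\<pi> x = (1 / (2 * R)) ^ n"
    using AE_cube by eventually_elim (auto simp: unif_density_def cube_def PiE_iff)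
  then have "bg_entropy (lebn n) \<mu> = - rel_entropy \<mu> ?U - ereal (ln ((1 / (2 * R)) ^ n))"
    unfolding U using prob_U U \<open>0 < R\<close>
    by (intro bg_entropy_eq_minus_rel_entropy_const sigma_finite_lebn prob_space_axioms sets_\<mu>)
      (auto intro!: prod_nonneg unif_density_nonneg borel_measurable_prod component_measurable_lebn)
  then have "rel_entropy \<mu> ?U < \<infinity>"
    using fin by (cases "rel_entropy \<mu> ?U") auto
  have sets_U: "sets \<mu> = sets ?U" by (simp add: U sets_\<mu>)
  have "(\<lambda>x. x i) \<in> measurable ?U ?u"
    using i by (intro measurable_component_singleton) auto
  then have "rel_entropy (distr \<mu> lborel (\<lambda>x. x i)) (distr ?U lborel (\<lambda>x. x i)) \<le> rel_entropy \<mu> ?U"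
    by (intro rel_entropy_distr_le prob_space_axioms prob_U sets_U) simp
  also have "distr ?U lborel (\<lambda>x. x i) = distr ?U ?u (\<lambda>x. x i)"
    by (intro distr_cong) auto
  also have "\<dots> = ?u"
    using i prob_u by (intro distr_PiM_component) auto
  finally have "rel_entropy (marg \<mu> i) ?u < \<infinity>"
    using \<open>rel_entropy \<mu> ?U < \<infinity>\<close> unfolding marg_def by (rule le_less_trans)
  moreover have "AE t in marg \<mu> i. unif_density R t = 1 / (2 * R)"
    using AE_marg[OF i] by eventually_elim (simp add: unif_density_def)
  then have "bg_entropy lborel (marg \<mu> i) = - rel_entropy (marg \<mu> i) ?u - ereal (ln (1 / (2 * R)))"
    using \<open>0 < R\<close>
    by (intro bg_entropy_eq_minus_rel_entropy_const sigma_finite_lborel prob_u prob_space_marg)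
      (auto intro: unif_density_nonneg)
  ultimately show ?thesis
    using rel_entropy_not_MInf[of "marg \<mu> i" ?u] by (cases "rel_entropy (marg \<mu> i) ?u") auto
qed

lemma
  fixes p :: "real \<Rightarrow> real"
  assumes p[measurable]: "p \<in> borel_measurable borel" and nonneg: "\<And>t. 0 \<le> p t"
    and density: "marg \<mu> i = density lborel p"
  shows AE_marg_density_pos: "AE x in \<mu>. 0 < p (x i)"
    and integrable_ln_marg_density: "integrable (marg \<mu> i) (\<lambda>t. ln (p t)) \<longleftrightarrow> integrable \<mu> (\<lambda>x. ln (p (x i)))"
    and integral_ln_marg_density: "(\<integral>t. ln (p t) \<partial>marg \<mu> i) = (\<integral>x. ln (p (x i)) \<partial>\<mu>)"
proof -
  have "AE t in marg \<mu> i. 0 < p t"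
    unfolding density using nonneg by (subst AE_density) (auto simp: less_le)
  then show "AE x in \<mu>. 0 < p (x i)"
    unfolding marg_def by (rule AE_distrD[rotated]) simp
  show "integrable (marg \<mu> i) (\<lambda>t. ln (p t)) \<longleftrightarrow> integrable \<mu> (\<lambda>x. ln (p (x i)))"
    "(\<integral>t. ln (p t) \<partial>marg \<mu> i) = (\<integral>x. ln (p (x i)) \<partial>\<mu>)"
    by (simp_all add: integrable_marg_iff integral_marg)
qed

lemma bg_entropy_eq_if_finite_marginals:
  assumes fin: "\<And>i. i < n \<Longrightarrow> bg_entropy lborel (marg \<mu> i) > -\<infinity>"
  shows "bg_entropy (lebn n) \<mu> = - rel_entropy \<mu> \<nu> + (\<Sum>i<n. bg_entropy lborel (marg \<mu> i))"
proof -
  have "\<exists>p. p \<in> borel_measurable lborel \<and> (\<forall>t. 0 \<le> p t) \<and> marg \<mu> i = density lborel p \<and>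
      integrable (marg \<mu> i) (\<lambda>t. ln (p t))
      \<and> bg_entropy lborel (marg \<mu> i) = ereal (- (\<integral>t. ln (p t) \<partial>marg \<mu> i))"
    if "i < n" for i
    using bg_entropy_finiteE[OF sigma_finite_lborel fin[OF that]] by metis
  then obtain p where p: "\<And>i. i < n \<Longrightarrow> p i \<in> borel_measurable lborel" "\<And>i t. i < n \<Longrightarrow> 0 \<le> p i t"
    "\<And>i. i < n \<Longrightarrow> marg \<mu> i = density lborel (p i)"
    "\<And>i. i < n \<Longrightarrow> integrable (marg \<mu> i) (\<lambda>t. ln (p i t))"
    "\<And>i. i < n \<Longrightarrow> bg_entropy lborel (marg \<mu> i) = ereal (- (\<integral>t. ln (p i t) \<partial>marg \<mu> i))"
    by metis
  let ?\<pi> = "\<lambda>x. \<Prod>i<n. p i (x i)"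
  have "\<nu> = PiM {..<n} (\<lambda>i. density lborel (p i))"
    unfolding \<nu>_def using p(3) by (intro PiM_cong) auto
  also have "\<dots> = density (lebn n) ?\<pi>"
    unfolding lebn_def using p(1,2) prob_space_imp_sigma_finite[OF prob_space_marg] p(3)
    by (intro PiM_density) (auto intro: sigma_finite_lborel simp flip: p(3))
  finally have \<nu>_eq: "\<nu> = density (lebn n) ?\<pi>" .
  have component: "AE x in \<mu>. 0 < p i (x i)" "integrable \<mu> (\<lambda>x. ln (p i (x i)))"
    "bg_entropy lborel (marg \<mu> i) = ereal (- (\<integral>x. ln (p i (x i)) \<partial>\<mu>))" if i: "i < n" for i
    using AE_marg_density_pos[OF _ p(2,3)[OF i]] integrable_ln_marg_density[OF _ p(2,3)[OF i]]
      integral_ln_marg_density[OF _ p(2,3)[OF i]] p(1,4,5)[OF i]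
    by simp_all
  have p_meas: "(\<lambda>x. p i (x i)) \<in> borel_measurable (lebn n)" if "i < n" for i
    using p(1)[OF that] that by (rule component_measurable_lebn)
  then have "(\<lambda>x. p i (x i)) \<in> borel_measurable \<mu>" if "i < n" for i
    using that sets_\<mu> by (simp cong: measurable_cong_sets)
  note ln_prod = integral_ln_prod[of "{..<n}" "\<lambda>i x. p i (x i)" \<mu>, OF _ this component(1,2)]
  have "bg_entropy (lebn n) \<mu> = - rel_entropy \<mu> \<nu> - ereal (\<integral>x. ln (?\<pi> x) \<partial>\<mu>)"
    unfolding \<nu>_eq using prob_space_\<nu> \<nu>_eq p_meas p(2) ln_prod
    by (intro bg_entropy_eq_minus_rel_entropy[OF sigma_finite_lebn _ _ _ prob_space_axioms sets_\<mu>])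
      (auto intro!: prod_nonneg)
  also have "\<dots> = - rel_entropy \<mu> \<nu> + (\<Sum>i<n. bg_entropy lborel (marg \<mu> i))"
    using ln_prod(3) component(3) by (simp add: minus_ereal_def sum_negf)
  finally show ?thesis .
qed

theorem bg_entropy_eq_minus_rel_entropy_marginals:
  assumes "0 < R"
  shows "bg_entropy (lebn n) \<mu> = - rel_entropy \<mu> \<nu> + (\<Sum>i<n. bg_entropy lborel (marg \<mu> i))"
proof (cases "\<forall>i<n. bg_entropy lborel (marg \<mu> i) > -\<infinity>")
  case True
  then show ?thesis by (intro bg_entropy_eq_if_finite_marginals) auto
next
  case False
  then obtain i where i: "i < n" "bg_entropy lborel (marg \<mu> i) = -\<infinity>" by auto
  have "bg_entropy (lebn n) \<mu> = -\<infinity>"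
    using bg_entropy_marg_finite[OF assms _ i(1)] i(2) by force
  moreover have "(\<Sum>i<n. bg_entropy lborel (marg \<mu> i)) = -\<infinity>"
  proof -
    have "\<bar>\<Sum>i<n. bg_entropy lborel (marg \<mu> i)\<bar> = \<infinity>"
      unfolding sum_Inf using i by (intro conjI finite_lessThan bexI[of _ i]) auto
    moreover have "(\<Sum>i<n. bg_entropy lborel (marg \<mu> i)) \<noteq> \<infinity>"
      by (simp add: sum_Pinfty bg_entropy_not_PInf)
    ultimately show ?thesis by auto
  qed
  ultimately show ?thesis
    using rel_entropy_not_MInf[of \<mu> \<nu>] by (cases "rel_entropy \<mu> \<nu>") auto
qed

end

subsection \<open>Upper bound for the mutual pressure\<close>

definition transpose_on :: "'i set \<Rightarrow> 'j set \<Rightarrow> ('i \<Rightarrow> 'j \<Rightarrow> 'a) \<Rightarrow> 'j \<Rightarrow> 'i \<Rightarrow> 'a" where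
  "transpose_on I J X = (\<lambda>j\<in>J. \<lambda>i\<in>I. X i j)"

lemma transpose_on_in_PiE:
  "X \<in> PiE I (\<lambda>_. PiE J (\<lambda>_. A)) \<Longrightarrow> transpose_on I J X \<in> PiE J (\<lambda>_. PiE I (\<lambda>_. A))"
  unfolding transpose_on_def restrict_PiE_iff by blast

lemma transpose_on_transpose_on:
  assumes X: "X \<in> PiE I (\<lambda>_. PiE J (\<lambda>_. A))"
  shows "transpose_on J I (transpose_on I J X) = X"
proof (intro ext)
  fix i j
  show "transpose_on J I (transpose_on I J X) i j = X i j"
    using PiE_arb[OF X, of i] PiE_arb[OF PiE_mem[OF X], of i j]
    by (cases "i \<in> I"; cases "j \<in> J") (auto simp: transpose_on_def)
qed

lemma sum_prod_columns:
  fixes g :: "('i \<Rightarrow> 'a) \<Rightarrow> real"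
  assumes "finite I" "finite J" "finite A"
  shows "(\<Sum>X\<in>PiE I (\<lambda>_. PiE J (\<lambda>_. A)). \<Prod>j\<in>J. g (\<lambda>i\<in>I. X i j)) = (\<Sum>k\<in>PiE I (\<lambda>_. A). g k) ^ card J"
proof -
  have "(\<Sum>X\<in>PiE I (\<lambda>_. PiE J (\<lambda>_. A)). \<Prod>j\<in>J. g (\<lambda>i\<in>I. X i j))
      = (\<Sum>Y\<in>PiE J (\<lambda>_. PiE I (\<lambda>_. A)). \<Prod>j\<in>J. g (Y j))"
    by (rule sum.reindex_bij_witness[where i = "transpose_on J I" and j = "transpose_on I J"])
      (auto simp: transpose_on_transpose_on transpose_on_in_PiE, simp add: transpose_on_def)
  also have "\<dots> = (\<Prod>j\<in>J. \<Sum>k\<in>PiE I (\<lambda>_. A). g k)"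
    using assms by (intro prod_sum_PiE[symmetric] finite_PiE) auto
  finally show ?thesis by simp
qed

locale approximating_sequence = cube_prob_space \<mu> R n for \<mu> R n +
  fixes \<Xi> :: "nat \<Rightarrow> nat \<Rightarrow> nat \<Rightarrow> real"
  assumes R_pos: "0 < R" and approx: "approx_seq R n \<mu> \<Xi>"
begin

sublocale \<nu>: cube_prob_space \<nu> R n
  by (rule cube_prob_space_\<nu>)

lemma \<Xi>_range: "i < n \<Longrightarrow> j < N \<Longrightarrow> \<Xi> i N j \<in> {-R..R}"
  using approx unfolding approx_seq_def by blast

lemma \<Xi>_mono: "i < n \<Longrightarrow> j \<le> k \<Longrightarrow> k < N \<Longrightarrow> \<Xi> i N j \<le> \<Xi> i N k"
  using approx unfolding approx_seq_def by blast

lemma \<Xi>_moment_tendsto: "i < n \<Longrightarrow> (\<lambda>N. kappa N (\<lambda>j. \<Xi> i N j ^ k)) \<longlonglongrightarrow> (\<integral>t. t ^ k \<partial>marg \<mu> i)"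
  using approx unfolding approx_seq_def by blast

definition grid_point :: "nat \<Rightarrow> (nat \<Rightarrow> nat) \<Rightarrow> nat \<Rightarrow> real" where
  "grid_point N k = (\<lambda>i\<in>{..<n}. \<Xi> i N (k i))"

lemma grid_point_in_cube: "(\<And>i. i < n \<Longrightarrow> k i < N) \<Longrightarrow> grid_point N k \<in> cube R n"
  unfolding grid_point_def by (intro restrict_in_cube \<Xi>_range)

lemma grid_point_restrict: "grid_point N (\<lambda>i\<in>{..<n}. k i) = grid_point N k"
  unfolding grid_point_def by (intro restrict_ext) simp

definition grid_mean :: "nat \<Rightarrow> ((nat \<Rightarrow> real) \<Rightarrow> real) \<Rightarrow> real" where
  "grid_mean N h = (\<Sum>k\<in>PiE {..<n} (\<lambda>_. {..<N}). h (grid_point N k)) / real N ^ n"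

lemma continuous_mean_grid_mean:
  assumes "N > 0"
  shows "continuous_mean (cube R n) (grid_mean N)"
proof -
  have "PiE {..<n} (\<lambda>_. {..<N}) \<noteq> {}" using assms by (auto simp: PiE_eq_empty_iff)
  then have "continuous_mean (cube R n)
    (\<lambda>h. (\<Sum>k\<in>PiE {..<n} (\<lambda>_. {..<N}). h (grid_point N k)) / real (card (PiE {..<n} (\<lambda>_. {..<N}))))"
    by (intro continuous_mean_average finite_PiE grid_point_in_cube) auto
  then show ?thesis by (simp add: grid_mean_def[abs_def] card_PiE)
qed

lemma grid_mean_monomial:
  assumes "set is \<subseteq> {..<n}"
  shows "grid_mean N (monomial is) = (\<Prod>i<n. kappa N (\<lambda>j. \<Xi> i N j ^ count_list is i))"
proof -
  have "(\<Sum>k\<in>PiE {..<n} (\<lambda>_. {..<N}). monomial is (grid_point N k))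
    = (\<Sum>k\<in>PiE {..<n} (\<lambda>_. {..<N}). \<Prod>i<n. \<Xi> i N (k i) ^ count_list is i)"
    unfolding monomial_eq_prod_count[OF assms] by (intro sum.cong prod.cong) (auto simp: grid_point_def)
  also have "\<dots> = (\<Prod>i<n. \<Sum>j<N. \<Xi> i N j ^ count_list is i)"
    by (rule prod_sum_PiE[symmetric]) auto
  finally show ?thesis by (simp add: grid_mean_def kappa_def prod_dividef)
qed

lemma grid_mean_tendsto:
  assumes h: "continuous_on (cube R n) h"
  shows "(\<lambda>N. grid_mean N h) \<longlonglongrightarrow> (LINT x:cube R n|\<nu>. h x)"
proof -
  interpret monomial_family "cube R n" "{is. set is \<subseteq> {..<n}}" monomial
    by (rule monomial_family_cube)
  have "(\<lambda>N. grid_mean N (monomial is) - (LINT x:cube R n|\<nu>. monomial is x)) \<longlonglongrightarrow> 0"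
    if "is \<in> {is. set is \<subseteq> {..<n}}" for "is"
  proof -
    have "set is \<subseteq> {..<n}" using that by simp
    then have "(\<lambda>N. grid_mean N (monomial is)) \<longlonglongrightarrow> (\<integral>x. monomial is x \<partial>\<nu>)"
      by (simp only: grid_mean_monomial integral_monomial_\<nu>) (intro tendsto_prod \<Xi>_moment_tendsto, simp)
    then show ?thesis
      by (simp add: \<nu>.set_integral_cube_eq continuous_on_monomial LIM_zero)
  qed
  moreover have grid: "\<forall>\<^sub>F N in sequentially. continuous_mean (cube R n) (grid_mean N)"
    using eventually_gt_at_top[of 0] by eventually_elim (rule continuous_mean_grid_mean)
  ultimately have "(\<lambda>N. grid_mean N h - (LINT x:cube R n|\<nu>. h x)) \<longlonglongrightarrow> 0"
    using \<nu>.continuous_mean_integral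
    by (intro moments_determine_mean[where E = grid_mean
        and E' = "\<lambda>_ h. LINT x:cube R n|\<nu>. h x", OF h grid]) simp_all
  then show ?thesis by (rule LIM_zero_cancel)
qed

lemma act_xi_vec:
  assumes "\<sigma> \<in> perms N" "j < N"
  shows "act \<sigma> (xi_vec \<Xi> i N) j = \<Xi> i N (inv \<sigma> j)"
  using perms_less[OF inv_perms[OF assms(1)] assms(2)] by (simp add: act_def xi_vec_def)

lemma microstate_eq_grid_point:
  assumes "s \<in> PiE {..<n} (\<lambda>_. perms N)" "j < N"
  shows "(\<lambda>i\<in>{..<n}. act (s i) (xi_vec \<Xi> i N) j) = grid_point N (\<lambda>i. inv (s i) j)"
  unfolding grid_point_def using assms by (intro restrict_ext act_xi_vec) auto

lemma inv_perms_PiE_less: "s \<in> PiE {..<n} (\<lambda>_. perms N) \<Longrightarrow> i < n \<Longrightarrow> j < N \<Longrightarrow> inv (s i) j < N"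
  by (intro perms_less[OF inv_perms]) auto

definition boltzmann_weight :: "((nat \<Rightarrow> real) \<Rightarrow> real) \<Rightarrow> nat \<Rightarrow> (nat \<Rightarrow> nat \<Rightarrow> nat) \<Rightarrow> real" where
  "boltzmann_weight h N a = exp (\<Sum>j<N. h (grid_point N (\<lambda>i. a i j)))"

lemma exp_sum_microstate:
  assumes "s \<in> PiE {..<n} (\<lambda>_. perms N)"
  shows "exp (\<Sum>j<N. h (\<lambda>i\<in>{..<n}. act (s i) (xi_vec \<Xi> i N) j)) = boltzmann_weight h N (\<lambda>i. inv (s i))"
  unfolding boltzmann_weight_def using assms by (simp add: microstate_eq_grid_point)

definition partition_function :: "((nat \<Rightarrow> real) \<Rightarrow> real) \<Rightarrow> nat \<Rightarrow> real" where
  "partition_function h N = (\<Sum>s\<in>PiE {..<n} (\<lambda>_. perms N). boltzmann_weight h N (\<lambda>i. inv (s i)))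
    / fact N ^ n"

lemma partition_function_pos: "0 < partition_function h N"
proof -
  have "card (PiE {..<n} (\<lambda>_. perms N)) \<noteq> 0"
    by (simp add: card_perms_PiE)
  then have "PiE {..<n} (\<lambda>_. perms N) \<noteq> {}" by fastforce
  then show ?thesis
    unfolding partition_function_def boltzmann_weight_def by (intro divide_pos_pos sum_pos) auto
qed

lemma Psym_eq: "Psym n \<Xi> h = limsup (\<lambda>N. ereal (ln (partition_function h N) / real N))"
proof -
  have "ereal (1 / real N) * elog (partition_function h N)
      = ereal (ln (partition_function h N) / real N)" for N
    using partition_function_pos[of h N] by (simp add: elog_def)
  then show ?thesis
    by (simp add: Psym_def exp_sum_microstate partition_function_def)
qed

lemma boltzmann_weight_le_if_pattern_eq:
  assumes "0 < \<eta>" and pattern: "pattern n N (\<lambda>i k. \<lfloor>\<Xi> i N k / \<eta>\<rfloor>) a = pattern n N (\<lambda>i k. \<lfloor>\<Xi> i N k / \<eta>\<rfloor>) b"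
    and a: "\<And>i j. i < n \<Longrightarrow> j < N \<Longrightarrow> a i j < N" and b: "\<And>i j. i < n \<Longrightarrow> j < N \<Longrightarrow> b i j < N"
    and h: "\<And>x y. x \<in> cube R n \<Longrightarrow> y \<in> cube R n \<Longrightarrow> (\<And>i. i < n \<Longrightarrow> \<bar>x i - y i\<bar> \<le> \<eta>) \<Longrightarrow> \<bar>h x - h y\<bar> < e"
  shows "boltzmann_weight h N a \<le> exp (real N * e) * boltzmann_weight h N b"
proof -
  have "(\<Sum>j<N. h (grid_point N (\<lambda>i. a i j))) \<le> (\<Sum>j<N. e + h (grid_point N (\<lambda>i. b i j)))"
  proof (rule sum_mono)
    fix j assume "j \<in> {..<N}"
    then have j: "j < N" by simp
    have "\<bar>h (grid_point N (\<lambda>i. a i j)) - h (grid_point N (\<lambda>i. b i j))\<bar> < e"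
    proof (intro h grid_point_in_cube a b j)
      fix i assume i: "i < n"
      have "\<bar>\<Xi> i N (a i j) / \<eta> - \<Xi> i N (b i j) / \<eta>\<bar> < 1"
        using pattern_eqD[OF pattern i j] by linarith
      then show "\<bar>grid_point N (\<lambda>i. a i j) i - grid_point N (\<lambda>i. b i j) i\<bar> \<le> \<eta>"
        using \<open>0 < \<eta>\<close> i by (simp add: grid_point_def abs_divide flip: diff_divide_distrib)
    qed
    then show "h (grid_point N (\<lambda>i. a i j)) \<le> e + h (grid_point N (\<lambda>i. b i j))" by linarith
  qed
  also have "\<dots> = real N * e + (\<Sum>j<N. h (grid_point N (\<lambda>i. b i j)))"
    by (simp add: sum.distrib)
  finally show ?thesis
    by (simp add: boltzmann_weight_def flip: exp_add)
qed

lemma sum_maps_boltzmann_weight: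
  "(\<Sum>f\<in>PiE {..<n} (\<lambda>_. {..<N} \<rightarrow>\<^sub>E {..<N}). boltzmann_weight h N f) / (real N ^ N) ^ n
    = grid_mean N (\<lambda>x. exp (h x)) ^ N"
proof -
  have "(\<Sum>f\<in>PiE {..<n} (\<lambda>_. {..<N} \<rightarrow>\<^sub>E {..<N}). boltzmann_weight h N f)
      = (\<Sum>k\<in>PiE {..<n} (\<lambda>_. {..<N}). exp (h (grid_point N k))) ^ N"
    using sum_prod_columns[of "{..<n}" "{..<N}" "{..<N}" "\<lambda>k. exp (h (grid_point N k))"]
    by (simp add: boltzmann_weight_def exp_sum grid_point_restrict)
  then show ?thesis
    by (simp add: grid_mean_def power_divide mult.commute flip: power_mult)
qed

lemma partition_function_le:
  assumes h: "continuous_on (cube R n) h" and "e > 0"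
  obtains K where "\<And>N. N > 0 \<Longrightarrow>
    partition_function h N \<le> exp (real N * e) * ((exp 1 * real (N + 1)) ^ K) ^ n
      * grid_mean N (\<lambda>x. exp (h x)) ^ N"
proof -
  obtain \<eta> where "\<eta> > 0" and \<eta>: "\<And>x y. x \<in> cube R n \<Longrightarrow> y \<in> cube R n \<Longrightarrow>
      (\<And>i. i < n \<Longrightarrow> \<bar>x i - y i\<bar> \<le> \<eta>) \<Longrightarrow> \<bar>h x - h y\<bar> < e"
    using cube_uniformly_continuous[OF h \<open>e > 0\<close>] by blast
  define B where "B = {\<lfloor>- R / \<eta>\<rfloor>..\<lfloor>R / \<eta>\<rfloor>}"
  have colours: "(\<lambda>k. \<lfloor>\<Xi> i N k / \<eta>\<rfloor>) ` {..<N} \<subseteq> B" if "i < n" for i N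
  proof (rule image_subsetI)
    fix k assume "k \<in> {..<N}"
    then have "- R / \<eta> \<le> \<Xi> i N k / \<eta>" "\<Xi> i N k / \<eta> \<le> R / \<eta>"
      using \<Xi>_range[OF that, of k N] \<open>k \<in> {..<N}\<close> \<open>\<eta> > 0\<close> by (intro divide_right_mono; simp)+
    then show "\<lfloor>\<Xi> i N k / \<eta>\<rfloor> \<in> B"
      unfolding B_def atLeastAtMost_iff by (intro conjI floor_mono)
  qed
  show ?thesis
  proof (rule that)
    fix N :: nat assume "N > 0"
    show "partition_function h N \<le> exp (real N * e) * ((exp 1 * real (N + 1)) ^ card B) ^ n
      * grid_mean N (\<lambda>x. exp (h x)) ^ N"
      unfolding partition_function_def sum_maps_boltzmann_weight[symmetric]
    proof (rule sum_perms_le_sum_maps[OF _ colours \<open>N > 0\<close>])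
      show "boltzmann_weight h N a \<le> exp (real N * e) * boltzmann_weight h N b"
        if "pattern n N (\<lambda>i k. \<lfloor>\<Xi> i N k / \<eta>\<rfloor>) a = pattern n N (\<lambda>i k. \<lfloor>\<Xi> i N k / \<eta>\<rfloor>) b"
          "\<And>i j. i < n \<Longrightarrow> j < N \<Longrightarrow> a i j < N" "\<And>i j. i < n \<Longrightarrow> j < N \<Longrightarrow> b i j < N" for a b
        using \<open>0 < \<eta>\<close> that \<eta> by (rule boltzmann_weight_le_if_pattern_eq)
    qed (simp_all add: B_def boltzmann_weight_def)
  qed
qed

theorem Psym_le:
  assumes h: "continuous_on (cube R n) h"
  shows "Psym n \<Xi> h \<le> ereal (ln (LINT x:cube R n|\<nu>. exp (h x)))"
proof (rule ereal_le_epsilon2)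
  fix e :: real assume "e > 0"
  let ?Z = "LINT x:cube R n|\<nu>. exp (h x)" and ?g = "\<lambda>N. grid_mean N (\<lambda>x. exp (h x))"
  obtain K where K: "\<And>N. N > 0 \<Longrightarrow>
    partition_function h N \<le> exp (real N * e) * ((exp 1 * real (N + 1)) ^ K) ^ n * ?g N ^ N"
    using partition_function_le[OF h \<open>e > 0\<close>] by blast
  have Z: "0 < ?Z"
    by (rule continuous_mean.mean_exp_pos[OF \<nu>.continuous_mean_integral compact_cube h])
  have g: "?g \<longlonglongrightarrow> ?Z"
    by (intro grid_mean_tendsto continuous_intros h)
  let ?b = "\<lambda>N. e + real (K * n) * ((1 + ln (real (N + 1))) / real N) + ln (?g N)"
  have "\<forall>\<^sub>F N in sequentially. ereal (ln (partition_function h N) / real N) \<le> ereal (?b N)"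
    using order_tendstoD(1)[OF g Z] eventually_gt_at_top[of 0]
  proof eventually_elim
    case (elim N)
    have pos: "0 < (exp 1 * real (N + 1)) ^ (K * n)" "0 < ?g N ^ N"
      using elim by auto
    have "ln (partition_function h N) \<le> ln (exp (real N * e) * (exp 1 * real (N + 1)) ^ (K * n) * ?g N ^ N)"
      using K[OF elim(2)] partition_function_pos[of h N] by (intro ln_mono) (auto simp: power_mult)
    also have "\<dots> = real N * e + real (K * n) * (1 + ln (real (N + 1))) + real N * ln (?g N)"
      using pos elim by (simp add: ln_mult ln_realpow)
    finally show ?case using elim(2) by (simp add: field_simps)
  qed
  then have "Psym n \<Xi> h \<le> limsup (\<lambda>N. ereal (?b N))"
    unfolding Psym_eq by (rule Limsup_mono)
  also have "\<dots> = ereal (e + real (K * n) * 0 + ln ?Z)"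
  proof (rule lim_imp_Limsup)
    have "(\<lambda>N. (1 + ln (real (N + 1))) / real N) \<longlonglongrightarrow> 0"
      by real_asymp
    then show "(\<lambda>N. ereal (?b N)) \<longlonglongrightarrow> ereal (e + real (K * n) * 0 + ln ?Z)"
      using g Z by (intro tendsto_ereal tendsto_intros) auto
  qed simp
  finally show "Psym n \<Xi> h \<le> ereal (ln ?Z) + ereal e" by (simp add: add.commute)
qed

lemma Isym_cal_le_imp_gibbs_bound:
  assumes Isym_cal_le: "Isym_cal R n \<mu> \<Xi> \<le> ereal c"
  shows "gibbs_bound \<mu> \<nu> c"
proof (rule gibbs_boundI)
  fix h :: "(nat \<Rightarrow> real) \<Rightarrow> real" and B
  assume h: "h \<in> borel_measurable \<nu>" and B: "\<And>x. \<bar>h x\<bar> \<le> B"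
  define g where "g x = h (restrict x {..<n})" for x
  have g_eq: "g x = h x" if "x \<in> space \<mu>" for x
    using that by (simp add: g_def space_\<mu> PiE_restrict)
  have g_bounded: "\<bar>g x\<bar> \<le> B" for x
    unfolding g_def by (rule B)
  have "(\<lambda>x :: nat \<Rightarrow> real. restrict x {..<n}) \<in> measurable borel (lebn n)"
    unfolding lebn_def by (intro measurable_restrict) simp
  then have g: "g \<in> borel_measurable borel"
    unfolding g_def[abs_def] using h \<nu>.sets_\<mu>
    by (intro measurable_compose[OF _ h]) (simp cong: measurable_cong_sets)
  have "(\<integral>x. g x \<partial>\<mu>) - ln (\<integral>x. exp (g x) \<partial>\<nu>) \<le> c"
  proof (rule gibbs_bound_continuous_imp_measurable[where T = "\<lambda>x. x"])
    fix k :: "(nat \<Rightarrow> real) \<Rightarrow> real" assume k: "continuous_on UNIV k"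
    then have k_cube: "continuous_on (cube R n) k" by (rule continuous_on_subset) simp
    have "ereal (LINT x:cube R n|\<mu>. k x) - ereal (ln (LINT x:cube R n|\<nu>. exp (k x)))
        \<le> ereal (LINT x:cube R n|\<mu>. k x) - Psym n \<Xi> k"
      by (intro ereal_minus_mono Psym_le k_cube) simp
    also have "\<dots> \<le> Isym_cal R n \<mu> \<Xi>"
      unfolding Isym_cal_def using k_cube by (intro SUP_upper) simp
    also note Isym_cal_le
    finally show "(\<integral>x. k x \<partial>\<mu>) - ln (\<integral>x. exp (k x) \<partial>\<nu>) \<le> c"
      using k by (simp add: set_integral_cube_eq \<nu>.set_integral_cube_eq continuous_on_exp)
  qed (rule prob_space_axioms \<nu>.prob_space_axioms borel_measurable_id \<nu>.borel_measurable_id g g_bounded)+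
  moreover have "(\<integral>x. g x \<partial>\<mu>) = (\<integral>x. h x \<partial>\<mu>)" "(\<integral>x. exp (g x) \<partial>\<nu>) = (\<integral>x. exp (h x) \<partial>\<nu>)"
    by (auto intro!: Bochner_Integration.integral_cong simp: g_eq sets_eq_imp_space_eq[OF sets_\<nu>])
  ultimately show "(\<integral>x. h x \<partial>\<mu>) - ln (\<integral>x. exp (h x) \<partial>\<nu>) \<le> c" by simp
qed

theorem rel_entropy_le_Isym_cal: "rel_entropy \<mu> \<nu> \<le> Isym_cal R n \<mu> \<Xi>"
proof (rule ereal_le_real)
  fix c assume "Isym_cal R n \<mu> \<Xi> \<le> ereal c"
  then show "rel_entropy \<mu> \<nu> \<le> ereal c"
    using Isym_cal_le_imp_gibbs_bound rel_entropy_le_iff_gibbs_bound[OF prob_space_axioms prob_space_\<nu>]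
    by (simp add: sets_\<nu>)
qed

end

subsection \<open>Mean values on microstates\<close>

context approximating_sequence
begin

definition index_lists :: "nat \<Rightarrow> nat list set" where
  "index_lists m = {is. set is \<subseteq> {..<n} \<and> 1 \<le> length is \<and> length is \<le> m}"

lemma finite_index_lists: "finite (index_lists m)"
  unfolding index_lists_def
  by (rule finite_subset[OF _ finite_lists_length_le[of "{..<n}" m]]) auto

definition moment_gap :: "nat \<Rightarrow> (nat \<Rightarrow> nat \<Rightarrow> real) \<Rightarrow> nat list \<Rightarrow> real" where
  "moment_gap N X is = \<bar>kappa N (\<lambda>j. monomial is (\<lambda>i. X i j)) - (\<integral>x. monomial is x \<partial>\<mu>)\<bar>"

lemma Delta_R_iff:
  "X \<in> Delta_R R \<mu> n N m \<delta> \<longleftrightarrow>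
    X \<in> PiE {..<n} (\<lambda>_. PiE {..<N} (\<lambda>_. {-R..R})) \<and> (\<forall>is\<in>index_lists m. moment_gap N X is < \<delta>)"
  unfolding Delta_R_def index_lists_def moment_gap_def by blast

lemma moment_gap_cong:
  assumes "set is \<subseteq> {..<n}" and "\<And>i j. i < n \<Longrightarrow> j < N \<Longrightarrow> X i j = Y i j"
  shows "moment_gap N X is = moment_gap N Y is"
proof -
  have "monomial is (\<lambda>i. X i j) = monomial is (\<lambda>i. Y i j)" if "j < N" for j
    using assms that by (intro arg_cong[where f = prod_list] map_cong) auto
  then show ?thesis by (simp add: moment_gap_def kappa_def)
qed

lemma Delta_sym_moment_close:
  assumes s: "s \<in> Delta_sym R \<mu> \<Xi> n N m \<delta>" and "is": "set is \<subseteq> {..<n}" "length is \<le> m"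
    and pos: "N > 0" "\<delta> > 0"
  shows "\<bar>kappa N (\<lambda>j. monomial is (grid_point N (\<lambda>i. inv (s i) j))) - (\<integral>x. monomial is x \<partial>\<mu>)\<bar> < \<delta>"
proof (cases "is = []")
  case True
  then show ?thesis using pos by (simp add: kappa_def prob_space)
next
  case False
  let ?X = "\<lambda>i\<in>{..<n}. act (s i) (xi_vec \<Xi> i N)"
  have "is \<in> index_lists m" using False "is" by (cases "is") (auto simp: index_lists_def)
  then have "moment_gap N ?X is < \<delta>" using s unfolding Delta_sym_def Delta_R_iff by blast
  moreover have "s i \<in> perms N" if "i < n" for i using s that by (auto simp: Delta_sym_def)
  then have "moment_gap N ?X is = moment_gap N (\<lambda>i j. grid_point N (\<lambda>i. inv (s i) j) i) is"
    by (intro moment_gap_cong "is"(1)) (simp add: act_xi_vec grid_point_def)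
  ultimately show ?thesis by (simp add: moment_gap_def)
qed

lemma Delta_sym_mean_close:
  assumes h: "continuous_on (cube R n) h" and "e > 0"
  obtains m \<delta> where "\<delta> > 0" "\<And>N s. N > 0 \<Longrightarrow> s \<in> Delta_sym R \<mu> \<Xi> n N m \<delta> \<Longrightarrow>
     \<bar>kappa N (\<lambda>j. h (grid_point N (\<lambda>i. inv (s i) j))) - (LINT x:cube R n|\<mu>. h x)\<bar> < e"
proof (rule ccontr)
  let ?E = "\<lambda>N s h. kappa N (\<lambda>j. h (grid_point N (\<lambda>i. inv (s i) j)))"
  assume "\<not> thesis"
  then have "\<exists>N s. N > 0 \<and> s \<in> Delta_sym R \<mu> \<Xi> n N k (1 / real (Suc k)) \<and>
      e \<le> \<bar>?E N s h - (LINT x:cube R n|\<mu>. h x)\<bar>" for k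
    using that[of "1 / real (Suc k)" k] by (force simp: not_less)
  then obtain N s where N: "\<And>k. N k > 0" and s: "\<And>k. s k \<in> Delta_sym R \<mu> \<Xi> n (N k) k (1 / real (Suc k))"
    and far: "\<And>k. e \<le> \<bar>?E (N k) (s k) h - (LINT x:cube R n|\<mu>. h x)\<bar>"
    by metis
  interpret monomial_family "cube R n" "{is. set is \<subseteq> {..<n}}" monomial
    by (rule monomial_family_cube)
  have mean: "continuous_mean (cube R n) (?E (N k) (s k))" for k
    using s[of k]
    by (intro continuous_mean_kappa N grid_point_in_cube inv_perms_PiE_less) (auto simp: Delta_sym_def)
  have "(\<lambda>k. ?E (N k) (s k) (monomial is) - (LINT x:cube R n|\<mu>. monomial is x)) \<longlonglongrightarrow> 0"
    if "is": "is \<in> {is. set is \<subseteq> {..<n}}" for "is"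
  proof (rule Lim_null_comparison)
    show "(\<lambda>k. 1 / real (Suc k)) \<longlonglongrightarrow> 0"
      by (rule LIMSEQ_Suc[OF lim_1_over_n])
    show "\<forall>\<^sub>F k in sequentially. norm (?E (N k) (s k) (monomial is) - (LINT x:cube R n|\<mu>. monomial is x))
        \<le> 1 / real (Suc k)"
      using eventually_ge_at_top[of "length is"]
    proof eventually_elim
      case (elim k)
      show ?case
        using Delta_sym_moment_close[OF s, of "is" k] "is" elim N
        by (simp add: set_integral_cube_eq continuous_on_monomial less_imp_le)
    qed
  qed
  then have "(\<lambda>k. ?E (N k) (s k) h - (LINT x:cube R n|\<mu>. h x)) \<longlonglongrightarrow> 0"
    using mean continuous_mean_integral
    by (intro moments_determine_mean[where E = "\<lambda>k. ?E (N k) (s k)"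
        and E' = "\<lambda>_ h. LINT x:cube R n|\<mu>. h x", OF h]) simp_all
  from tendstoD[OF this \<open>e > 0\<close>] obtain k where "\<bar>?E (N k) (s k) h - (LINT x:cube R n|\<mu>. h x)\<bar> < e"
    by (auto simp: eventually_sequentially)
  with far[of k] show False by simp
qed

definition Delta_sym_prob :: "nat \<Rightarrow> real \<Rightarrow> nat \<Rightarrow> real" where
  "Delta_sym_prob m \<delta> N = real (card (Delta_sym R \<mu> \<Xi> n N m \<delta>)) / fact N ^ n"

definition Delta_sym_rate :: "nat \<Rightarrow> real \<Rightarrow> nat \<Rightarrow> ereal" where
  "Delta_sym_rate m \<delta> N = ereal (1 / real N) * elog (Delta_sym_prob m \<delta> N)"

lemma Isym_eq: "Isym R n \<mu> \<Xi> = - (INF m. INF \<delta>\<in>{0<..}. limsup (Delta_sym_rate m \<delta>))"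
  unfolding Isym_def Delta_sym_rate_def Delta_sym_prob_def ..

lemma Delta_sym_rate_eq:
  "0 < Delta_sym_prob m \<delta> N \<Longrightarrow> Delta_sym_rate m \<delta> N = ereal (ln (Delta_sym_prob m \<delta> N) / real N)"
  by (simp add: Delta_sym_rate_def elog_def)

lemma Delta_sym_prob_mult_exp_le:
  assumes "N > 0"
    and mean_ge: "\<And>s. s \<in> Delta_sym R \<mu> \<Xi> n N m \<delta> \<Longrightarrow> c \<le> kappa N (\<lambda>j. h (grid_point N (\<lambda>i. inv (s i) j)))"
  shows "Delta_sym_prob m \<delta> N * exp (real N * c) \<le> partition_function h N"
proof -
  let ?D = "Delta_sym R \<mu> \<Xi> n N m \<delta>"
  have "real (card ?D) * exp (real N * c) = (\<Sum>s\<in>?D. exp (real N * c))" by simp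
  also have "\<dots> \<le> (\<Sum>s\<in>?D. boltzmann_weight h N (\<lambda>i. inv (s i)))"
    using mean_ge \<open>N > 0\<close> by (intro sum_mono) (simp add: boltzmann_weight_def kappa_def field_simps)
  also have "\<dots> \<le> (\<Sum>s\<in>PiE {..<n} (\<lambda>_. perms N). boltzmann_weight h N (\<lambda>i. inv (s i)))"
    by (intro sum_mono2) (auto simp: Delta_sym_def boltzmann_weight_def)
  finally show ?thesis
    unfolding partition_function_def Delta_sym_prob_def
    by (simp add: divide_right_mono)
qed

lemma Delta_sym_rate_le:
  assumes "N > 0"
    and "\<And>s. s \<in> Delta_sym R \<mu> \<Xi> n N m \<delta> \<Longrightarrow> c \<le> kappa N (\<lambda>j. h (grid_point N (\<lambda>i. inv (s i) j)))"
  shows "Delta_sym_rate m \<delta> N \<le> ereal (ln (partition_function h N) / real N) + ereal (- c)"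
proof (cases "0 < Delta_sym_prob m \<delta> N")
  case True
  have "ln (Delta_sym_prob m \<delta> N) + real N * c = ln (Delta_sym_prob m \<delta> N * exp (real N * c))"
    using True by (simp add: ln_mult_pos)
  also have "\<dots> \<le> ln (partition_function h N)"
    using True by (intro ln_mono Delta_sym_prob_mult_exp_le assms) simp_all
  finally have "ln (Delta_sym_prob m \<delta> N) / real N \<le> (ln (partition_function h N) - real N * c) / real N"
    by (intro divide_right_mono) simp_all
  then show ?thesis
    using True \<open>N > 0\<close> by (simp add: Delta_sym_rate_eq diff_divide_distrib)
next
  case False
  then show ?thesis using \<open>N > 0\<close> by (simp add: Delta_sym_rate_def elog_def)
qed

theorem Isym_cal_le_Isym: "Isym_cal R n \<mu> \<Xi> \<le> Isym R n \<mu> \<Xi>"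
  unfolding Isym_cal_def
proof (rule SUP_least)
  fix h :: "(nat \<Rightarrow> real) \<Rightarrow> real" assume "h \<in> {h. continuous_on (cube R n) h}"
  then have h: "continuous_on (cube R n) h" by simp
  let ?I = "LINT x:cube R n|\<mu>. h x" and ?J = "INF m. INF \<delta>\<in>{0<..}. limsup (Delta_sym_rate m \<delta>)"
  have "?J \<le> (Psym n \<Xi> h + ereal (- ?I)) + ereal e" if "e > 0" for e :: real
  proof -
    obtain m \<delta> where "\<delta> > 0" and close: "\<And>N s. N > 0 \<Longrightarrow> s \<in> Delta_sym R \<mu> \<Xi> n N m \<delta> \<Longrightarrow>
       \<bar>kappa N (\<lambda>j. h (grid_point N (\<lambda>i. inv (s i) j))) - ?I\<bar> < e"
      by (rule Delta_sym_mean_close[OF h \<open>e > 0\<close>]) (rule that)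
    have "?J \<le> limsup (Delta_sym_rate m \<delta>)"
      using \<open>\<delta> > 0\<close> by (intro INF_lower2[of m] INF_lower2[of \<delta>]) auto
    also have "\<dots> \<le> limsup (\<lambda>N. ereal (ln (partition_function h N) / real N) + ereal (- (?I - e)))"
    proof (rule Limsup_mono)
      show "\<forall>\<^sub>F N in sequentially. Delta_sym_rate m \<delta> N
          \<le> ereal (ln (partition_function h N) / real N) + ereal (- (?I - e))"
        using eventually_gt_at_top[of 0]
      proof eventually_elim
        case (elim N)
        show ?case
        proof (rule Delta_sym_rate_le[OF elim])
          fix s assume "s \<in> Delta_sym R \<mu> \<Xi> n N m \<delta>"
          from close[OF elim this] show "?I - e \<le> kappa N (\<lambda>j. h (grid_point N (\<lambda>i. inv (s i) j)))"
            by linarith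
        qed
      qed
    qed
    also have "\<dots> = Psym n \<Xi> h + ereal (- (?I - e))"
      unfolding Psym_eq by (intro Limsup_add_ereal_right) auto
    also have "\<dots> = (Psym n \<Xi> h + ereal (- ?I)) + ereal e" by (simp add: add.assoc)
    finally show ?thesis .
  qed
  then have "?J \<le> Psym n \<Xi> h + ereal (- ?I)" by (rule ereal_le_epsilon2)
  then show "ereal ?I - Psym n \<Xi> h \<le> Isym R n \<mu> \<Xi>"
    unfolding Isym_eq by (cases "Psym n \<Xi> h"; cases ?J) auto
qed

end

subsection \<open>Sorted vectors with close moments\<close>

definition sorted_vectors :: "real \<Rightarrow> nat \<Rightarrow> (nat \<Rightarrow> real) set" where
  "sorted_vectors R N = {x. x ` {..<N} \<subseteq> {-R..R} \<and> mono_on {..<N} x}"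

definition ramp :: "real \<Rightarrow> real \<Rightarrow> real" where
  "ramp w u = max 0 (min w u)"

lemma sum_ramp:
  assumes "0 < w" "0 \<le> u" "u \<le> real K * w"
  shows "(\<Sum>k<K. ramp w (u - real k * w)) = u"
proof -
  have "(\<Sum>k<K. ramp w (u - real k * w)) = min (real K * w) u"
  proof (induction K)
    case (Suc K)
    have "0 \<le> real K * w" using \<open>0 < w\<close> by simp
    then have "min (real K * w) u + ramp w (u - real K * w) = min (real K * w + w) u"
      using \<open>0 < w\<close> \<open>0 \<le> u\<close> by (auto simp: ramp_def max_def min_def)
    then show ?case using Suc by (simp add: distrib_right add.commute)
  qed (use \<open>0 \<le> u\<close> in simp)
  then show ?thesis using assms by simp
qed

lemma ramp_le_step: "0 < w \<Longrightarrow> ramp w (u - t) \<le> w * of_bool (t < u)"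
  by (auto simp: ramp_def)

lemma sum_step_bounds:
  assumes "0 < w" "0 \<le> u" "u \<le> real K * w"
  shows "u \<le> (\<Sum>k<K. w * of_bool (real k * w < u))" and "(\<Sum>k<K. w * of_bool (real k * w < u)) \<le> u + w"
proof -
  define m where "m = nat \<lceil>u / w\<rceil>"
  have less_m: "real k * w < u \<longleftrightarrow> k < m" for k
    using \<open>0 < w\<close> by (simp add: m_def zless_nat_eq_int_zless less_ceiling_iff pos_less_divide_eq)
  have "u / w \<le> real K"
    by (rule pos_divide_le_eq[THEN iffD2]) fact+
  then have "m \<le> K" by (simp add: m_def ceiling_le)
  then have "{..<K} \<inter> {k. k < m} = {..<m}" by auto
  then have "(\<Sum>k<K. w * of_bool (real k * w < u)) = w * real m"
    by (simp add: less_m flip: sum_distrib_left)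
  moreover have "0 \<le> u / w" using assms by simp
  then have "u / w \<le> real m" "real m \<le> u / w + 1"
    unfolding m_def by linarith+
  then have "w * (u / w) \<le> w * real m" "w * real m \<le> w * (u / w + 1)"
    using \<open>0 < w\<close> by (simp_all only: mult_le_cancel_left_pos)
  ultimately show "u \<le> (\<Sum>k<K. w * of_bool (real k * w < u))"
      and "(\<Sum>k<K. w * of_bool (real k * w < u)) \<le> u + w"
    using \<open>0 < w\<close> by (simp_all add: distrib_left mult.commute)
qed

lemma abs_diff_le_sum_step:
  assumes "0 < w" and u: "u \<in> {0..real K * w}" and v: "v \<in> {0..real K * w}"
  shows "\<bar>u - v\<bar> \<le> (\<Sum>k<K. w * \<bar>of_bool (real k * w < u) - of_bool (real k * w < v)\<bar>) + w"
proof -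
  have "\<bar>u - v\<bar> \<le> \<bar>(\<Sum>k<K. w * of_bool (real k * w < u)) - (\<Sum>k<K. w * of_bool (real k * w < v))\<bar> + w"
    using sum_step_bounds[OF \<open>0 < w\<close>, of u K] sum_step_bounds[OF \<open>0 < w\<close>, of v K] u v by auto
  also have "\<bar>(\<Sum>k<K. w * of_bool (real k * w < u)) - (\<Sum>k<K. w * of_bool (real k * w < v))\<bar>
      \<le> (\<Sum>k<K. \<bar>w * of_bool (real k * w < u) - w * of_bool (real k * w < v)\<bar>)"
    unfolding sum_subtractf[symmetric] by (rule sum_abs)
  also have "\<dots> = (\<Sum>k<K. w * \<bar>of_bool (real k * w < u) - of_bool (real k * w < v)\<bar>)"
    using \<open>0 < w\<close> by (simp add: abs_mult flip: right_diff_distrib)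
  finally show ?thesis by simp
qed

lemma sum_abs_diff_eq_abs_sum_diff:
  fixes u v :: "'a \<Rightarrow> real"
  assumes "(\<forall>j\<in>A. u j \<le> v j) \<or> (\<forall>j\<in>A. v j \<le> u j)"
  shows "(\<Sum>j\<in>A. \<bar>u j - v j\<bar>) = \<bar>(\<Sum>j\<in>A. u j) - (\<Sum>j\<in>A. v j)\<bar>"
  using assms
proof
  assume u_le_v: "\<forall>j\<in>A. u j \<le> v j"
  then have "(\<Sum>j\<in>A. \<bar>u j - v j\<bar>) = (\<Sum>j\<in>A. v j - u j)" by (intro sum.cong) auto
  then show ?thesis using sum_mono[of A u v] u_le_v by (simp add: sum_subtractf)
next
  assume v_le_u: "\<forall>j\<in>A. v j \<le> u j"
  then have "(\<Sum>j\<in>A. \<bar>u j - v j\<bar>) = (\<Sum>j\<in>A. u j - v j)" by (intro sum.cong) auto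
  then show ?thesis using sum_mono[of A v u] v_le_u by (simp add: sum_subtractf)
qed

text \<open>The superlevel sets of two sorted vectors are final segments, hence nested.\<close>

lemma sum_abs_diff_step_sorted:
  fixes x y :: "nat \<Rightarrow> real"
  assumes x: "mono_on {..<N} x" and y: "mono_on {..<N} y"
  shows "(\<Sum>j<N. \<bar>of_bool (t < x j) - of_bool (t < y j)\<bar>)
    = \<bar>(\<Sum>j<N. of_bool (t < x j)) - (\<Sum>j<N. of_bool (t < y j) :: real)\<bar>"
proof (rule sum_abs_diff_eq_abs_sum_diff, rule ccontr)
  assume "\<not> ((\<forall>j\<in>{..<N}. (of_bool (t < x j) :: real) \<le> of_bool (t < y j)) \<or>
    (\<forall>j\<in>{..<N}. (of_bool (t < y j) :: real) \<le> of_bool (t < x j)))"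
  then obtain j k where "j < N" "t < x j" "\<not> t < y j" "k < N" "t < y k" "\<not> t < x k"
    by (auto simp: not_le of_bool_def split: if_splits)
  then show False
    using mono_onD[OF x, of j k] mono_onD[OF y, of k j] by (cases "j \<le> k") simp_all
qed

lemma sorted_mean_abs_diff_le:
  assumes "0 < w" and N: "N > 0" and x: "mono_on {..<N} x" and y: "mono_on {..<N} y"
    and range: "\<And>j. j < N \<Longrightarrow> x j \<in> {0..real K * w}" "\<And>j. j < N \<Longrightarrow> y j \<in> {0..real K * w}"
  shows "kappa N (\<lambda>j. \<bar>x j - y j\<bar>) \<le>
    (\<Sum>k<K. \<bar>kappa N (\<lambda>j. ramp w (x j - real k * w)) - kappa N (\<lambda>j. ramp w (y j - real k * w))\<bar>) + 3 * w"
proof -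
  define r where "r z k = (\<Sum>j<N. ramp w (z j - real k * w))" for z k
  define c where "c z k = (\<Sum>j<N. w * of_bool (real k * w < z j))" for z k
  have r_le_c: "r z k \<le> c z k" for z k
    unfolding r_def c_def by (intro sum_mono ramp_le_step \<open>0 < w\<close>)
  have excess: "(\<Sum>k<K. c z k - r z k) \<le> real N * w" if z: "\<And>j. j < N \<Longrightarrow> z j \<in> {0..real K * w}" for z
  proof -
    have "(\<Sum>k<K. c z k - r z k)
        = (\<Sum>j<N. (\<Sum>k<K. w * of_bool (real k * w < z j)) - (\<Sum>k<K. ramp w (z j - real k * w)))"
      unfolding c_def r_def by (simp only: sum_subtractf sum.swap[of _ "{..<N}"])
    also have "\<dots> \<le> (\<Sum>j<N. w)"
      using z \<open>0 < w\<close> sum_step_bounds(2) by (intro sum_mono) (fastforce simp: sum_ramp)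
    finally show ?thesis by simp
  qed
  have "(\<Sum>j<N. \<bar>x j - y j\<bar>)
      \<le> (\<Sum>j<N. (\<Sum>k<K. w * \<bar>of_bool (real k * w < x j) - of_bool (real k * w < y j)\<bar>) + w)"
    using range by (intro sum_mono abs_diff_le_sum_step \<open>0 < w\<close>) simp_all
  also have "\<dots> = (\<Sum>k<K. w * (\<Sum>j<N. \<bar>of_bool (real k * w < x j) - of_bool (real k * w < y j)\<bar>)) + real N * w"
    by (simp add: sum.distrib sum_distrib_left sum.swap[of _ "{..<K}"])
  also have "\<dots> = (\<Sum>k<K. \<bar>c x k - c y k\<bar>) + real N * w"
    using \<open>0 < w\<close> unfolding sum_abs_diff_step_sorted[OF x y] c_def
    by (simp add: abs_mult flip: sum_distrib_left right_diff_distrib)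
  also have "(\<Sum>k<K. \<bar>c x k - c y k\<bar>) \<le> (\<Sum>k<K. \<bar>r x k - r y k\<bar> + (c x k - r x k) + (c y k - r y k))"
    using r_le_c by (intro sum_mono) (smt (verit, best))
  also have "\<dots> \<le> (\<Sum>k<K. \<bar>r x k - r y k\<bar>) + real N * w + real N * w"
    unfolding sum.distrib using range by (intro add_mono excess order_refl)
  finally have "(\<Sum>j<N. \<bar>x j - y j\<bar>) / real N \<le> ((\<Sum>k<K. \<bar>r x k - r y k\<bar>) + real N * (3 * w)) / real N"
    by (intro divide_right_mono) (simp_all add: algebra_simps)
  also have "\<dots> = (\<Sum>k<K. \<bar>r x k / real N - r y k / real N\<bar>) + 3 * w"
    using N by (simp add: add_divide_distrib sum_divide_distrib abs_divide flip: diff_divide_distrib)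
  finally show ?thesis
    by (simp add: kappa_def r_def)
qed

lemma sorted_mean_abs_diff_tendsto:
  assumes "R > 0" and N: "\<And>k. N k > 0"
    and x: "\<And>k. x k \<in> sorted_vectors R (N k)" and y: "\<And>k. y k \<in> sorted_vectors R (N k)"
    and moments: "\<And>i. (\<lambda>k. kappa (N k) (\<lambda>j. x k j ^ i) - kappa (N k) (\<lambda>j. y k j ^ i)) \<longlonglongrightarrow> 0"
    and "e > 0"
  shows "\<forall>\<^sub>F k in sequentially. kappa (N k) (\<lambda>j. \<bar>x k j - y k j\<bar>) < e"
proof -
  interpret monomial_family "{-R..R}" UNIV "\<lambda>k t :: real. t ^ k"
    by (rule monomial_family_interval)
  have mean: "continuous_mean {-R..R} (\<lambda>h. kappa (N k) (\<lambda>j. h (z j)))"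
    if "z \<in> sorted_vectors R (N k)" for k z
    using that by (intro continuous_mean_kappa N) (auto simp: sorted_vectors_def)
  have continuous: "(\<lambda>k. kappa (N k) (\<lambda>j. h (x k j)) - kappa (N k) (\<lambda>j. h (y k j))) \<longlonglongrightarrow> 0"
    if h: "continuous_on {-R..R} h" for h
    using mean[OF x] mean[OF y] moments
    by (intro moments_determine_mean[where E = "\<lambda>k h. kappa (N k) (\<lambda>j. h (x k j))"
          and E' = "\<lambda>k h. kappa (N k) (\<lambda>j. h (y k j))", OF h]) simp_all
  obtain K :: nat where K: "6 * R < real K * e" using reals_Archimedean3[OF \<open>e > 0\<close>] by blast
  then have "K > 0" using \<open>R > 0\<close> by (cases K) auto
  define w where "w = 2 * R / real K"
  have w: "0 < w" "real K * w = 2 * R" "3 * w < e"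
    using K \<open>K > 0\<close> \<open>R > 0\<close> by (auto simp: w_def field_simps)
  let ?D = "\<lambda>k i. \<bar>kappa (N k) (\<lambda>j. ramp w (x k j + R - real i * w))
      - kappa (N k) (\<lambda>j. ramp w (y k j + R - real i * w))\<bar>"
  have ramp_bound: "kappa (N k) (\<lambda>j. \<bar>x k j - y k j\<bar>) \<le> (\<Sum>i<K. ?D k i) + 3 * w" for k
  proof -
    have shift: "mono_on {..<N k} (\<lambda>j. z j + R)" "\<And>j. j < N k \<Longrightarrow> z j + R \<in> {0..real K * w}"
      if "z \<in> sorted_vectors R (N k)" for z
      using that w(2) by (force simp: sorted_vectors_def mono_on_def)+
    have "kappa (N k) (\<lambda>j. \<bar>(x k j + R) - (y k j + R)\<bar>) \<le> (\<Sum>i<K. ?D k i) + 3 * w"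
      by (intro sorted_mean_abs_diff_le w N shift x y)
    then show ?thesis by simp
  qed
  have "(\<lambda>k. (\<Sum>i<K. ?D k i) + 3 * w) \<longlonglongrightarrow> (\<Sum>i<K. 0) + 3 * w"
    unfolding ramp_def by (intro tendsto_intros tendsto_rabs_zero continuous continuous_intros)
  then have "\<forall>\<^sub>F k in sequentially. (\<Sum>i<K. ?D k i) + 3 * w < e"
    using w(3) by (intro order_tendstoD(2)) simp_all
  then show ?thesis
    by eventually_elim (rule le_less_trans[OF ramp_bound])
qed

definition moments_close :: "nat \<Rightarrow> nat \<Rightarrow> real \<Rightarrow> (nat \<Rightarrow> real) \<Rightarrow> (nat \<Rightarrow> real) \<Rightarrow> bool" where
  "moments_close N m \<delta> x y \<longleftrightarrow> (\<forall>i\<in>{1..m}. \<bar>kappa N (\<lambda>j. x j ^ i) - kappa N (\<lambda>j. y j ^ i)\<bar> < \<delta>)"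

lemma moments_close_imp_tendsto:
  assumes "\<And>k. moments_close (N k) k (1 / real (Suc k)) (x k) (y k)"
  shows "(\<lambda>k. kappa (N k) (\<lambda>j. x k j ^ i) - kappa (N k) (\<lambda>j. y k j ^ i)) \<longlonglongrightarrow> 0"
proof (rule Lim_null_comparison)
  show "(\<lambda>k. 1 / real (Suc k)) \<longlonglongrightarrow> 0"
    by (rule LIMSEQ_Suc[OF lim_1_over_n])
  show "\<forall>\<^sub>F k in sequentially.
      norm (kappa (N k) (\<lambda>j. x k j ^ i) - kappa (N k) (\<lambda>j. y k j ^ i)) \<le> 1 / real (Suc k)"
    using eventually_ge_at_top[of i]
  proof eventually_elim
    case (elim k)
    show ?case
      using assms[of k] elim by (cases "i = 0") (auto simp: moments_close_def intro!: less_imp_le)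
  qed
qed

lemma sorted_moments_close:
  assumes "R > 0" and "e > 0"
  obtains \<delta> m where "\<delta> > 0" "\<And>N x y. N > 0 \<Longrightarrow> x \<in> sorted_vectors R N \<Longrightarrow> y \<in> sorted_vectors R N \<Longrightarrow>
     moments_close N m \<delta> x y \<Longrightarrow> kappa N (\<lambda>j. \<bar>x j - y j\<bar>) < e"
proof (rule ccontr)
  assume "\<not> thesis"
  have "\<forall>k. \<exists>N x y. N > 0 \<and> x \<in> sorted_vectors R N \<and> y \<in> sorted_vectors R N \<and>
      moments_close N k (1 / real (Suc k)) x y \<and> \<not> kappa N (\<lambda>j. \<bar>x j - y j\<bar>) < e"
  proof (rule allI, rule ccontr)
    fix k
    assume none: "\<not> (\<exists>N x y. N > 0 \<and> x \<in> sorted_vectors R N \<and> y \<in> sorted_vectors R N \<and>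
      moments_close N k (1 / real (Suc k)) x y \<and> \<not> kappa N (\<lambda>j. \<bar>x j - y j\<bar>) < e)"
    have thesis
    proof (rule that[of "1 / real (Suc k)" k])
      show "kappa N (\<lambda>j. \<bar>x j - y j\<bar>) < e" if "N > 0" "x \<in> sorted_vectors R N"
        "y \<in> sorted_vectors R N" "moments_close N k (1 / real (Suc k)) x y" for N x y
        using none that by blast
    qed simp
    with \<open>\<not> thesis\<close> show False by contradiction
  qed
  then obtain N x y where N: "\<And>k. N k > 0" and x: "\<And>k. x k \<in> sorted_vectors R (N k)"
    and y: "\<And>k. y k \<in> sorted_vectors R (N k)"
    and close: "\<And>k. moments_close (N k) k (1 / real (Suc k)) (x k) (y k)"
    and far: "\<And>k. \<not> kappa (N k) (\<lambda>j. \<bar>x k j - y k j\<bar>) < e"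
    unfolding choice_iff by blast
  have "\<forall>\<^sub>F k in sequentially. kappa (N k) (\<lambda>j. \<bar>x k j - y k j\<bar>) < e"
    by (intro sorted_mean_abs_diff_tendsto[OF \<open>R > 0\<close>] \<open>e > 0\<close> N x y moments_close_imp_tendsto close)
  then show False
    using far by (simp add: eventually_sequentially)
qed

subsection \<open>Samples with prescribed moments\<close>

lemma (in prob_space) Hoeffding_PiM:
  fixes Y :: "'a \<Rightarrow> real"
  assumes Y[measurable]: "Y \<in> borel_measurable M" and range: "AE x in M. Y x \<in> {-B..B}"
    and "B > 0" "N > 0" "e > 0"
  shows "measure (PiM {..<N} (\<lambda>_. M))
      {X \<in> space (PiM {..<N} (\<lambda>_. M)). e \<le> \<bar>kappa N (\<lambda>j. Y (X j)) - expectation Y\<bar>}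
    \<le> 2 * exp (- 2 * real N * e\<^sup>2 / (2 * B)\<^sup>2)"
proof -
  let ?P = "PiM {..<N} (\<lambda>_. M)"
  interpret P: prob_space ?P
    by (intro prob_space_PiM prob_space_axioms)
  have component: "distr ?P M (\<lambda>X. X j) = M" if "j < N" for j
    using that by (intro distr_PiM_component prob_space_axioms) simp
  have "P.indep_vars (\<lambda>_. M) (\<lambda>j X. X j) {..<N}"
  proof (subst P.indep_vars_iff_distr_eq_PiM')
    have "distr ?P ?P (\<lambda>X. \<lambda>j\<in>{..<N}. X j) = distr ?P ?P (\<lambda>X. X)"
      by (intro distr_cong) (auto simp: space_PiM PiE_restrict)
    also have "\<dots> = PiM {..<N} (\<lambda>j. distr ?P M (\<lambda>X. X j))"
      by (subst distr_id2) (auto intro!: PiM_cong simp: component)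
    finally show "distr ?P ?P (\<lambda>X. \<lambda>j\<in>{..<N}. X j) = PiM {..<N} (\<lambda>j. distr ?P M (\<lambda>X. X j))" .
  qed (use \<open>N > 0\<close> in auto)
  then have indep: "P.indep_vars (\<lambda>_. borel) (\<lambda>j X. Y (X j)) {..<N}"
    by (rule P.indep_vars_compose2) simp
  have law: "distr ?P borel (\<lambda>X. Y (X j)) = distr M borel Y" if "j < N" for j
    using distr_distr[of Y M borel "\<lambda>X. X j" ?P] component[OF that] that by (simp add: comp_def)
  have "AE X in ?P. Y (X 0) \<in> {-B..B}"
    using \<open>N > 0\<close> range by (intro AE_PiM_component prob_space_axioms) auto
  then interpret Hoeffding_ineq_iid ?P "{..<N}" "\<lambda>j X. Y (X j)" "\<lambda>X. Y (X 0)" "-B" B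
      "P.expectation (\<lambda>X. Y (X 0))"
    using \<open>N > 0\<close> indep law by unfold_locales auto
  have mean: "P.expectation (\<lambda>X. Y (X 0)) = expectation Y"
    using \<open>N > 0\<close> by (intro integral_PiM_component prob_space_axioms) auto
  have "- B < B" "{..<N} \<noteq> {}"
    using \<open>B > 0\<close> \<open>N > 0\<close> by (auto simp: lessThan_empty_iff)
  from Hoeffding_ineq_abs_ge'[OF less_imp_le[OF \<open>e > 0\<close>] this] show ?thesis
    by (simp only: mean kappa_def card_lessThan diff_minus_eq_add mult_2)
qed

lemma (in prob_space) weak_law_PiM:
  fixes Y :: "'a \<Rightarrow> real"
  assumes "Y \<in> borel_measurable M" "AE x in M. Y x \<in> {-B..B}" "B > 0" "e > 0"
  shows "(\<lambda>N. measure (PiM {..<N} (\<lambda>_. M))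
    {X \<in> space (PiM {..<N} (\<lambda>_. M)). e \<le> \<bar>kappa N (\<lambda>j. Y (X j)) - expectation Y\<bar>}) \<longlonglongrightarrow> 0"
proof (rule tendsto_sandwich[OF _ _ tendsto_const])
  have "(\<lambda>N. 2 * exp (- (c * real N))) \<longlonglongrightarrow> 0" if "c > 0" for c :: real
    using that by real_asymp
  from this[of "2 * e\<^sup>2 / (2 * B)\<^sup>2"] show "(\<lambda>N. 2 * exp (- 2 * real N * e\<^sup>2 / (2 * B)\<^sup>2)) \<longlonglongrightarrow> 0"
    using \<open>B > 0\<close> \<open>e > 0\<close> by (simp add: mult_ac)
  show "\<forall>\<^sub>F N in sequentially. measure (PiM {..<N} (\<lambda>_. M))
      {X \<in> space (PiM {..<N} (\<lambda>_. M)). e \<le> \<bar>kappa N (\<lambda>j. Y (X j)) - expectation Y\<bar>}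
    \<le> 2 * exp (- 2 * real N * e\<^sup>2 / (2 * B)\<^sup>2)"
    using eventually_gt_at_top[of 0] by eventually_elim (intro Hoeffding_PiM assms)
qed simp

definition array :: "'i set \<Rightarrow> 'j set \<Rightarrow> ('j \<Rightarrow> 'i \<Rightarrow> 'a) \<Rightarrow> 'i \<times> 'j \<Rightarrow> 'a" where
  "array I J X = (\<lambda>p\<in>I \<times> J. X (snd p) (fst p))"

lemma measurable_array: "array I J \<in> measurable (PiM J (\<lambda>_. PiM I M)) (PiM (I \<times> J) (\<lambda>p. M (fst p)))"
  unfolding array_def[abs_def]
proof (rule measurable_restrict)
  fix p assume "p \<in> I \<times> J"
  then have [measurable]: "(\<lambda>X. X (snd p)) \<in> measurable (PiM J (\<lambda>_. PiM I M)) (PiM I M)"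
    "(\<lambda>x. x (fst p)) \<in> measurable (PiM I M) (M (fst p))"
    by (auto intro: measurable_component_singleton)
  show "(\<lambda>X. X (snd p) (fst p)) \<in> measurable (PiM J (\<lambda>_. PiM I M)) (M (fst p))"
    by measurable
qed

lemma array_vimage_PiE:
  assumes "\<And>i j. i \<in> I \<Longrightarrow> j \<in> J \<Longrightarrow> A (i, j) \<subseteq> space (M i)"
  shows "array I J -` PiE (I \<times> J) A \<inter> space (PiM J (\<lambda>_. PiM I M)) = PiE J (\<lambda>j. PiE I (\<lambda>i. A (i, j)))"
    (is "?V = ?B")
proof (intro subset_antisym subsetI)
  fix X assume X: "X \<in> ?V"
  then have space: "X \<in> PiE J (\<lambda>_. PiE I (\<lambda>i. space (M i)))" by (simp add: space_PiM)
  have "X j i \<in> A (i, j)" if "i \<in> I" "j \<in> J" for i j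
    using PiE_mem[of "array I J X" "I \<times> J" A "(i, j)"] X that by (simp add: array_def)
  then show "X \<in> ?B"
    using space by (simp add: PiE_iff)
next
  fix X assume X: "X \<in> ?B"
  then have entries: "X j i \<in> A (i, j)" if "i \<in> I" "j \<in> J" for i j
    using that by (simp add: PiE_iff)
  then have "array I J X \<in> PiE (I \<times> J) A"
    unfolding array_def restrict_PiE_iff by auto
  moreover have "X \<in> space (PiM J (\<lambda>_. PiM I M))"
    using X assms entries by (fastforce simp: space_PiM PiE_iff)
  ultimately show "X \<in> ?V" by simp
qed

lemma distr_array:
  assumes I: "finite I" and J: "finite J" and M: "\<And>i. prob_space (M i)"
  shows "distr (PiM J (\<lambda>_. PiM I M)) (PiM (I \<times> J) (\<lambda>p. M (fst p))) (array I J)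
      = PiM (I \<times> J) (\<lambda>p. M (fst p))"
    (is "distr ?P ?Q _ = _")
proof -
  interpret rows: product_prob_space M I
    using M by (intro product_prob_spaceI)
  interpret array: product_prob_space "\<lambda>p. M (fst p)" "I \<times> J"
    using M by (intro product_prob_spaceI)
  interpret columns: product_prob_space "\<lambda>_. PiM I M" J
    using M by (intro product_prob_spaceI prob_space_PiM)
  show ?thesis
  proof (rule array.PiM_eqI)
    fix A assume A: "\<And>p. p \<in> I \<times> J \<Longrightarrow> A p \<in> sets (M (fst p))"
    then have A': "A (i, j) \<in> sets (M i)" if "i \<in> I" "j \<in> J" for i j
      using that by fastforce
    have "emeasure (distr ?P ?Q (array I J)) (PiE (I \<times> J) A)
        = emeasure ?P (array I J -` PiE (I \<times> J) A \<inter> space ?P)"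
      using A I J by (intro emeasure_distr measurable_array sets_PiM_I_finite) auto
    also have "\<dots> = emeasure ?P (PiE J (\<lambda>j. PiE I (\<lambda>i. A (i, j))))"
      using A' by (subst array_vimage_PiE) (auto dest: sets.sets_into_space)
    also have "\<dots> = (\<Prod>j\<in>J. emeasure (PiM I M) (PiE I (\<lambda>i. A (i, j))))"
      using A' I J by (intro columns.emeasure_PiM sets_PiM_I_finite) auto
    also have "\<dots> = (\<Prod>j\<in>J. \<Prod>i\<in>I. emeasure (M i) (A (i, j)))"
      using A' I by (intro prod.cong rows.emeasure_PiM) auto
    also have "\<dots> = (\<Prod>p\<in>I \<times> J. emeasure (M (fst p)) (A p))"
      by (subst prod.swap) (simp add: prod.cartesian_product split_beta)
    finally show "emeasure (distr ?P ?Q (array I J)) (PiE (I \<times> J) A)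
        = (\<Prod>p\<in>I \<times> J. emeasure (M (fst p)) (A p))" .
  qed (use I J in simp_all)
qed

text \<open>Independent permutations of the rows of an array are such an \<open>f\<close>.\<close>

lemma
  assumes M: "\<And>i. prob_space (M i)" and f: "inj_on f K" "f \<in> K \<rightarrow> K" "\<And>p. p \<in> K \<Longrightarrow> fst (f p) = fst p"
  shows measurable_PiM_reindex: "(\<lambda>w. \<lambda>p\<in>K. w (f p))
      \<in> measurable (PiM K (\<lambda>p. M (fst p))) (PiM K (\<lambda>p. M (fst p)))"
    and distr_PiM_reindex_fst: "distr (PiM K (\<lambda>p. M (fst p))) (PiM K (\<lambda>p. M (fst p))) (\<lambda>w. \<lambda>p\<in>K. w (f p))
      = PiM K (\<lambda>p. M (fst p))"
proof -
  have PiM_eq: "PiM K (\<lambda>p. M (fst (f p))) = PiM K (\<lambda>p. M (fst p))"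
    using f(3) by (intro PiM_cong) auto
  show "(\<lambda>w. \<lambda>p\<in>K. w (f p)) \<in> measurable (PiM K (\<lambda>p. M (fst p))) (PiM K (\<lambda>p. M (fst p)))"
  proof (rule measurable_restrict)
    fix p assume "p \<in> K"
    then have "(\<lambda>w. w (f p)) \<in> measurable (PiM K (\<lambda>p. M (fst p))) (M (fst (f p)))"
      using f(2) by (intro measurable_component_singleton) auto
    then show "(\<lambda>w. w (f p)) \<in> measurable (PiM K (\<lambda>p. M (fst p))) (M (fst p))"
      using f(3) \<open>p \<in> K\<close> by simp
  qed
  show "distr (PiM K (\<lambda>p. M (fst p))) (PiM K (\<lambda>p. M (fst p))) (\<lambda>w. \<lambda>p\<in>K. w (f p)) = PiM K (\<lambda>p. M (fst p))"
    using distr_PiM_reindex[of K "\<lambda>p. M (fst p)" f K] M f(1,2) by (simp add: PiM_eq)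
qed

context approximating_sequence
begin

definition samples :: "nat \<Rightarrow> (nat \<times> nat \<Rightarrow> real) measure" where
  "samples N = PiM ({..<n} \<times> {..<N}) (\<lambda>p. marg \<mu> (fst p))"

definition rows :: "nat \<Rightarrow> (nat \<times> nat \<Rightarrow> real) \<Rightarrow> nat \<Rightarrow> nat \<Rightarrow> real" where
  "rows N w = (\<lambda>i\<in>{..<n}. \<lambda>j\<in>{..<N}. w (i, j))"

definition typical_samples :: "nat \<Rightarrow> real \<Rightarrow> nat \<Rightarrow> (nat \<times> nat \<Rightarrow> real) set" where
  "typical_samples m \<delta> N = {w \<in> space (samples N). rows N w \<in> Delta_R R \<mu> n N m \<delta>}"

lemma prob_space_samples: "prob_space (samples N)"
  unfolding samples_def by (intro prob_space_PiM prob_space_marg)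

lemma typical_samples_eq:
  "typical_samples m \<delta> N = {w \<in> space (samples N). (\<forall>p\<in>{..<n} \<times> {..<N}. w p \<in> {-R..R}) \<and>
     (\<forall>is\<in>index_lists m. moment_gap N (\<lambda>i j. w (i, j)) is < \<delta>)}"
proof -
  have "moment_gap N (rows N w) is = moment_gap N (\<lambda>i j. w (i, j)) is" if "is \<in> index_lists m" for w "is"
    using that by (intro moment_gap_cong) (auto simp: rows_def index_lists_def)
  then show ?thesis
    unfolding typical_samples_def Delta_R_iff rows_def restrict_PiE_iff by auto
qed

lemma monomial_samples_measurable:
  assumes "set is \<subseteq> {..<n}" "j < N"
  shows "(\<lambda>w. monomial is (\<lambda>i. w (i, j))) \<in> borel_measurable (samples N)"
  using assms(1)
proof (induction "is")
  case (Cons i "is")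
  have "(\<lambda>w. w (i, j)) \<in> measurable (samples N) (marg \<mu> (fst (i, j)))"
    unfolding samples_def using Cons.prems \<open>j < N\<close> by (intro measurable_component_singleton) auto
  then have [measurable]: "(\<lambda>w. w (i, j)) \<in> borel_measurable (samples N)"
    by (simp cong: measurable_cong_sets)
  have [measurable]: "(\<lambda>w. monomial is (\<lambda>i. w (i, j))) \<in> borel_measurable (samples N)"
    using Cons by simp
  show ?case by simp
qed simp

lemma moment_gap_measurable:
  assumes "set is \<subseteq> {..<n}"
  shows "(\<lambda>w. moment_gap N (\<lambda>i j. w (i, j)) is) \<in> borel_measurable (samples N)"
  unfolding moment_gap_def kappa_def using assms
  by (intro borel_measurable_abs borel_measurable_diff borel_measurable_divide borel_measurable_sum
      monomial_samples_measurable borel_measurable_const) auto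

lemma typical_samples_sets: "typical_samples m \<delta> N \<in> sets (samples N)"
proof -
  have "{w \<in> space (samples N). w p \<in> {-R..R}} \<in> sets (samples N)" if "p \<in> {..<n} \<times> {..<N}" for p
  proof -
    have "(\<lambda>w. w p) \<in> measurable (samples N) (marg \<mu> (fst p))"
      unfolding samples_def using that by (rule measurable_component_singleton)
    from measurable_sets[OF this, of "{-R..R}"] show ?thesis
      by (simp add: vimage_def Int_def conj_commute)
  qed
  moreover have "{w \<in> space (samples N). moment_gap N (\<lambda>i j. w (i, j)) is < \<delta>} \<in> sets (samples N)"
    if "is \<in> index_lists m" for "is"
    using that moment_gap_measurable[of "is" N]
    by (intro borel_measurable_less borel_measurable_const) (auto simp: index_lists_def)
  ultimately show ?thesis
    unfolding typical_samples_eq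
    by (intro sets.sets_Collect_conj sets.sets_Collect_finite_All finite_index_lists) auto
qed

definition joint_samples :: "nat \<Rightarrow> (nat \<times> nat \<Rightarrow> real) measure" where
  "joint_samples N = distr (PiM {..<N} (\<lambda>_. \<mu>)) (samples N) (array {..<n} {..<N})"

lemma sets_PiM_\<nu>: "sets (PiM J (\<lambda>_. \<nu>)) = sets (PiM J (\<lambda>_. \<mu>))"
  by (intro sets_PiM_cong refl sets_\<nu>)

lemma array_measurable_\<nu>: "array {..<n} {..<N} \<in> measurable (PiM {..<N} (\<lambda>_. \<nu>)) (samples N)"
  unfolding samples_def \<nu>_def by (rule measurable_array)

lemma array_measurable: "array {..<n} {..<N} \<in> measurable (PiM {..<N} (\<lambda>_. \<mu>)) (samples N)"
  using array_measurable_\<nu> by (simp add: sets_PiM_\<nu> cong: measurable_cong_sets)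

lemma prob_space_joint_samples: "prob_space (joint_samples N)"
  unfolding joint_samples_def
  by (intro prob_space.prob_space_distr array_measurable prob_space_PiM prob_space_axioms)

lemma rel_entropy_joint_samples_le:
  "rel_entropy (joint_samples N) (samples N) \<le> ereal (real N) * rel_entropy \<mu> \<nu>"
proof -
  have "samples N = distr (PiM {..<N} (\<lambda>_. \<nu>)) (samples N) (array {..<n} {..<N})"
    unfolding samples_def \<nu>_def by (intro distr_array[symmetric] prob_space_marg) auto
  then have "rel_entropy (joint_samples N) (samples N)
      = rel_entropy (distr (PiM {..<N} (\<lambda>_. \<mu>)) (samples N) (array {..<n} {..<N}))
          (distr (PiM {..<N} (\<lambda>_. \<nu>)) (samples N) (array {..<n} {..<N}))"
    by (simp add: joint_samples_def)
  also have "\<dots> \<le> rel_entropy (PiM {..<N} (\<lambda>_. \<mu>)) (PiM {..<N} (\<lambda>_. \<nu>))"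
    by (intro rel_entropy_distr_le prob_space_PiM prob_space_axioms prob_space_\<nu> array_measurable_\<nu>)
      (simp add: sets_PiM_\<nu>)
  also have "\<dots> \<le> (\<Sum>j<N. rel_entropy \<mu> \<nu>)"
    by (intro rel_entropy_PiM_le prob_space_axioms prob_space_\<nu>) simp
  finally show ?thesis
    by (simp add: sum_constant_ereal mult.commute)
qed

lemma moment_gap_array:
  assumes "set is \<subseteq> {..<n}"
  shows "moment_gap N (\<lambda>i j. array {..<n} {..<N} X (i, j)) is
    = \<bar>kappa N (\<lambda>j. monomial is (X j)) - (\<integral>x. monomial is x \<partial>\<mu>)\<bar>"
proof -
  have "moment_gap N (\<lambda>i j. array {..<n} {..<N} X (i, j)) is = moment_gap N (\<lambda>i j. X j i) is"
    using assms by (intro moment_gap_cong) (auto simp: array_def)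
  then show ?thesis by (simp add: moment_gap_def)
qed

lemma measure_typical_joint_samples_ge:
  "measure (joint_samples N) (typical_samples m \<delta> N) \<ge> 1 - (\<Sum>is\<in>index_lists m. measure (PiM {..<N} (\<lambda>_. \<mu>))
     {X \<in> space (PiM {..<N} (\<lambda>_. \<mu>)). \<delta> \<le> \<bar>kappa N (\<lambda>j. monomial is (X j)) - (\<integral>x. monomial is x \<partial>\<mu>)\<bar>})"
    (is "_ \<ge> 1 - (\<Sum>is\<in>_. measure ?P (?bad is))")
proof -
  interpret P: prob_space ?P
    by (intro prob_space_PiM prob_space_axioms)
  let ?V = "array {..<n} {..<N} -` typical_samples m \<delta> N \<inter> space ?P"
  have V: "?V \<in> sets ?P"
    by (rule measurable_sets[OF array_measurable typical_samples_sets])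
  have bad: "?bad is \<in> sets ?P" for "is"
  proof -
    have [measurable]: "monomial is \<in> borel_measurable \<mu>"
      by (intro borel_measurable_continuous continuous_on_monomial)
    show ?thesis unfolding kappa_def by measurable
  qed
  have "AE X in ?P. \<forall>j\<in>{..<N}. X j \<in> cube R n"
    by (intro AE_finite_allI AE_PiM_component prob_space_axioms AE_cube) auto
  then have cover: "AE X in ?P. X \<in> space ?P - ?V \<longrightarrow> X \<in> (\<Union>is\<in>index_lists m. ?bad is)"
  proof eventually_elim
    case (elim X)
    have "array {..<n} {..<N} X p \<in> {-R..R}" if "p \<in> {..<n} \<times> {..<N}" for p
      using elim that by (auto simp: array_def cube_def PiE_iff)
    then show ?case
      using measurable_space[OF array_measurable, of X N]
      by (auto simp: typical_samples_eq moment_gap_array index_lists_def not_less)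
  qed
  have "1 - measure (joint_samples N) (typical_samples m \<delta> N) = 1 - P.prob ?V"
    unfolding joint_samples_def by (simp add: measure_distr[OF array_measurable typical_samples_sets])
  also have "\<dots> = P.prob (space ?P - ?V)"
    by (rule P.prob_compl[OF V, symmetric])
  also have "\<dots> \<le> P.prob (\<Union>is\<in>index_lists m. ?bad is)"
    using cover bad finite_index_lists by (intro P.finite_measure_mono_AE sets.finite_UN) auto
  also have "\<dots> \<le> (\<Sum>is\<in>index_lists m. P.prob (?bad is))"
    using bad by (intro P.finite_measure_subadditive_finite finite_index_lists) auto
  finally show ?thesis by simp
qed

lemma measure_typical_joint_samples_tendsto:
  assumes "\<delta> > 0"
  shows "(\<lambda>N. measure (joint_samples N) (typical_samples m \<delta> N)) \<longlonglongrightarrow> 1"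
proof (rule tendsto_sandwich[OF _ _ _ tendsto_const])
  let ?bound = "\<lambda>N. 1 - (\<Sum>is\<in>index_lists m. measure (PiM {..<N} (\<lambda>_. \<mu>))
      {X \<in> space (PiM {..<N} (\<lambda>_. \<mu>)). \<delta> \<le> \<bar>kappa N (\<lambda>j. monomial is (X j)) - (\<integral>x. monomial is x \<partial>\<mu>)\<bar>})"
  have bounded: "AE x in \<mu>. monomial is x \<in> {- (R ^ length is)..R ^ length is}"
    if "is \<in> index_lists m" for "is"
    using AE_cube
  proof eventually_elim
    case (elim x)
    have "\<bar>monomial is x\<bar> \<le> R ^ length is"
      using elim that by (intro abs_monomial_le cubeD) (auto simp: index_lists_def)
    then show ?case by auto
  qed
  have "?bound \<longlonglongrightarrow> 1 - (\<Sum>is\<in>index_lists m. 0)"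
    using assms R_pos
    by (intro tendsto_diff tendsto_const tendsto_sum weak_law_PiM[OF _ bounded] borel_measurable_continuous
        continuous_on_monomial) auto
  then show "?bound \<longlonglongrightarrow> 1"
    by simp
qed (intro always_eventually allI measure_typical_joint_samples_ge prob_space.prob_le_1
    prob_space_joint_samples)+

subsection \<open>Rearrangements of samples\<close>

definition rearrangements :: "(nat \<Rightarrow> nat \<Rightarrow> real) \<Rightarrow> nat \<Rightarrow> real \<Rightarrow> nat \<Rightarrow> (nat \<Rightarrow> nat \<Rightarrow> nat) set" where
  "rearrangements X m \<delta> N = {s \<in> PiE {..<n} (\<lambda>_. perms N).
    (\<lambda>i\<in>{..<n}. act (s i) (X i)) \<in> Delta_R R \<mu> n N m \<delta>}"

lemma Delta_sym_eq_rearrangements: "Delta_sym R \<mu> \<Xi> n N m \<delta> = rearrangements (\<lambda>i. xi_vec \<Xi> i N) m \<delta> N"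
  unfolding Delta_sym_def rearrangements_def ..

lemma finite_rearrangements [simp]: "finite (rearrangements X m \<delta> N)"
  unfolding rearrangements_def by simp

definition permute_rows :: "nat \<Rightarrow> (nat \<Rightarrow> nat \<Rightarrow> nat) \<Rightarrow> (nat \<times> nat \<Rightarrow> real) \<Rightarrow> nat \<times> nat \<Rightarrow> real" where
  "permute_rows N s w = (\<lambda>p\<in>{..<n} \<times> {..<N}. w (fst p, inv (s (fst p)) (snd p)))"

lemma
  assumes s: "s \<in> PiE {..<n} (\<lambda>_. perms N)"
  shows permute_rows_measurable: "permute_rows N s \<in> measurable (samples N) (samples N)"
    and distr_permute_rows: "distr (samples N) (samples N) (permute_rows N s) = samples N"
proof -
  let ?f = "\<lambda>p. (fst p, inv (s (fst p)) (snd p))"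
  have perms: "s i \<in> perms N" if "i < n" for i using s that by auto
  have "inj_on ?f ({..<n} \<times> {..<N})"
  proof (rule inj_on_inverseI)
    fix p assume "p \<in> {..<n} \<times> {..<N}"
    then show "(\<lambda>p. (fst p, s (fst p) (snd p))) (?f p) = p"
      by (auto simp: perms_inverses[OF perms])
  qed
  moreover have "?f \<in> {..<n} \<times> {..<N} \<rightarrow> {..<n} \<times> {..<N}"
    using inv_perms_PiE_less[OF s] by auto
  ultimately show "permute_rows N s \<in> measurable (samples N) (samples N)"
    and "distr (samples N) (samples N) (permute_rows N s) = samples N"
    unfolding samples_def permute_rows_def[abs_def]
    by (intro measurable_PiM_reindex distr_PiM_reindex_fst prob_space_marg; simp)+
qed

lemma rows_permute_rows:
  assumes s: "s \<in> PiE {..<n} (\<lambda>_. perms N)"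
  shows "rows N (permute_rows N s w) = (\<lambda>i\<in>{..<n}. act (s i) (rows N w i))"
proof (intro ext)
  fix i j
  show "rows N (permute_rows N s w) i j = (\<lambda>i\<in>{..<n}. act (s i) (rows N w i)) i j"
  proof (cases "i < n")
    case True
    then have "inv (s i) \<in> perms N" using s inv_perms by auto
    then have "inv (s i) j < N \<longleftrightarrow> j < N"
      using permutes_in_image[of "inv (s i)" "{..<N}" j] by (simp add: perms_def)
    then show ?thesis
      using True by (simp add: rows_def permute_rows_def act_def)
  qed (simp add: rows_def)
qed

lemma rearrangements_rows:
  assumes "w \<in> space (samples N)"
  shows "rearrangements (rows N w) m \<delta> N = {s \<in> PiE {..<n} (\<lambda>_. perms N).
      permute_rows N s w \<in> typical_samples m \<delta> N}"
  unfolding rearrangements_def typical_samples_def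
  using measurable_space[OF permute_rows_measurable assms] by (auto simp: rows_permute_rows)

lemma ex_many_rearrangements:
  obtains X where "fact N ^ n * measure (samples N) (typical_samples m \<delta> N)
      \<le> real (card (rearrangements X m \<delta> N))"
proof (rule ccontr)
  interpret S: prob_space "samples N" by (rule prob_space_samples)
  let ?S = "PiE {..<n} (\<lambda>_. perms N)" and ?\<Gamma> = "typical_samples m \<delta> N"
  let ?V = "\<lambda>s. permute_rows N s -` ?\<Gamma> \<inter> space (samples N)"
  have V: "?V s \<in> sets (samples N)" "S.prob (?V s) = S.prob ?\<Gamma>" if "s \<in> ?S" for s
    using measurable_sets[OF permute_rows_measurable[OF that] typical_samples_sets]
      measure_distr[OF permute_rows_measurable[OF that] typical_samples_sets] distr_permute_rows[OF that]
    by simp_all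
  assume "\<not> thesis"
  then have few: "real (card (rearrangements X m \<delta> N)) < fact N ^ n * S.prob ?\<Gamma>" for X
    using that by (force simp: not_le[symmetric])
  have "S.expectation (\<lambda>w. \<Sum>s\<in>?S. indicator (?V s) w) = (\<Sum>s\<in>?S. S.prob ?\<Gamma>)"
    using V by (subst Bochner_Integration.integral_sum) (auto simp: S.emeasure_eq_measure)
  then have mean: "S.expectation (\<lambda>w. \<Sum>s\<in>?S. indicator (?V s) w) = fact N ^ n * S.prob ?\<Gamma>"
    by (simp add: card_perms_PiE)
  have "S.expectation (\<lambda>w. \<Sum>s\<in>?S. indicator (?V s) w) < fact N ^ n * S.prob ?\<Gamma>"
  proof (rule S.expectation_less)
    show "integrable (samples N) (\<lambda>w. \<Sum>s\<in>?S. indicator (?V s) w :: real)"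
      using V by (intro Bochner_Integration.integrable_sum) (auto simp: S.emeasure_eq_measure)
    have "(\<Sum>s\<in>?S. indicator (?V s) w) = real (card (rearrangements (rows N w) m \<delta> N))"
      if "w \<in> space (samples N)" for w
      using that by (simp add: rearrangements_rows indicator_def sum.If_cases Int_def)
    then show "AE w in samples N. (\<Sum>s\<in>?S. indicator (?V s) w) < fact N ^ n * S.prob ?\<Gamma>"
      using few by (intro AE_I2) simp
  qed
  with mean show False by simp
qed

end

subsection \<open>Counting microstates\<close>

lemma kappa_inv_perms:
  assumes "\<sigma> \<in> perms N"
  shows "kappa N (\<lambda>j. g (inv \<sigma> j)) = kappa N g"
  using sum.permute[of "inv \<sigma>" "{..<N}" g] inv_perms[OF assms] by (simp add: kappa_def perms_def comp_def)

lemma act_act: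
  assumes "\<sigma> \<in> perms N" "\<tau> \<in> perms N"
  shows "act \<sigma> (act \<tau> x) = act (\<sigma> \<circ> \<tau>) x"
  using assms by (simp add: act_def perms_def o_inv_distrib permutes_bij)

lemma act_in_PiE:
  assumes \<sigma>: "\<sigma> \<in> perms N" and x: "x \<in> PiE {..<N} (\<lambda>_. A)"
  shows "act \<sigma> x \<in> PiE {..<N} (\<lambda>_. A)"
proof (rule PiE_I)
  show "act \<sigma> x j \<in> A" if "j \<in> {..<N}" for j
    using PiE_mem[OF x] perms_less[OF inv_perms[OF \<sigma>]] that by (simp add: act_def)
  show "act \<sigma> x j = undefined" if "j \<notin> {..<N}" for j
    using PiE_arb[OF x that] permutes_not_in[of "inv \<sigma>" _ j] inv_perms[OF \<sigma>] that
    by (simp add: act_def perms_def)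
qed

lemma ex_sorting_permutation:
  obtains \<sigma> where "\<sigma> \<in> perms N" "mono_on {..<N} (act \<sigma> x)"
proof -
  let ?l = "map x [0..<N]"
  obtain p where p: "p permutes {..<N}" "permute_list p ?l = sort ?l"
    using mset_eq_permutation[of "sort ?l" ?l] by auto
  have nth: "sort ?l ! j = x (p j)" if "j < N" for j
    using permute_list_nth[of p ?l j] p that permutes_in_image[OF p(1), of j] by simp
  have "mono_on {..<N} (act (inv p) x)"
  proof (rule mono_onI)
    fix j k assume "j \<in> {..<N}" "k \<in> {..<N}" "j \<le> k"
    then show "act (inv p) x j \<le> act (inv p) x k"
      using sorted_nth_mono[of "sort ?l" j k] by (simp add: act_def nth permutes_inv_inv[OF p(1)])
  qed
  then show ?thesis
    using p(1) by (intro that[of "inv p"]) (simp_all add: perms_def permutes_inv)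
qed

context approximating_sequence
begin

lemma xi_vec_sorted: "i < n \<Longrightarrow> xi_vec \<Xi> i N \<in> sorted_vectors R N"
  using \<Xi>_range \<Xi>_mono by (auto simp: sorted_vectors_def xi_vec_def mono_on_def)

lemma kappa_power_xi_vec: "kappa N (\<lambda>j. xi_vec \<Xi> i N j ^ k) = kappa N (\<lambda>j. \<Xi> i N j ^ k)"
  by (simp add: kappa_def xi_vec_def)

lemma xi_moments_eventually:
  assumes "d > 0"
  shows "\<forall>\<^sub>F N in sequentially. \<forall>i\<in>{..<n}. \<forall>k\<in>{1..m}.
    \<bar>kappa N (\<lambda>j. xi_vec \<Xi> i N j ^ k) - (\<integral>t. t ^ k \<partial>marg \<mu> i)\<bar> < d"
  unfolding kappa_power_xi_vec
proof (intro eventually_ball_finite ballI finite_lessThan finite_atLeastAtMost)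
  fix i k assume "i \<in> {..<n}"
  then show "\<forall>\<^sub>F N in sequentially. \<bar>kappa N (\<lambda>j. \<Xi> i N j ^ k) - (\<integral>t. t ^ k \<partial>marg \<mu> i)\<bar> < d"
    using tendstoD[OF \<Xi>_moment_tendsto[of i k] assms] by (simp add: dist_real_def)
qed

lemma abs_kappa_monomial_diff_le:
  assumes "is": "set is \<subseteq> {..<n}"
    and X: "X \<in> PiE {..<n} (\<lambda>_. PiE {..<N} (\<lambda>_. {-R..R}))"
    and Y: "Y \<in> PiE {..<n} (\<lambda>_. PiE {..<N} (\<lambda>_. {-R..R}))"
  shows "\<bar>kappa N (\<lambda>j. monomial is (\<lambda>i. X i j)) - kappa N (\<lambda>j. monomial is (\<lambda>i. Y i j))\<bar>
    \<le> real (length is) * max 1 R ^ length is * (\<Sum>i<n. kappa N (\<lambda>j. \<bar>X i j - Y i j\<bar>))"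
proof -
  let ?C = "real (length is) * max 1 R ^ length is"
  have range: "\<bar>Z i j\<bar> \<le> max 1 R"
    if "Z \<in> PiE {..<n} (\<lambda>_. PiE {..<N} (\<lambda>_. {-R..R}))" "i < n" "j < N" for Z i j
    using PiE_mem[OF PiE_mem[OF that(1)], of i j] that by auto
  have "\<bar>(\<Sum>j<N. monomial is (\<lambda>i. X i j)) - (\<Sum>j<N. monomial is (\<lambda>i. Y i j))\<bar>
      \<le> (\<Sum>j<N. \<bar>monomial is (\<lambda>i. X i j) - monomial is (\<lambda>i. Y i j)\<bar>)"
    unfolding sum_subtractf[symmetric] by (rule sum_abs)
  also have "\<dots> \<le> (\<Sum>j<N. ?C * (\<Sum>i<n. \<bar>X i j - Y i j\<bar>))"
    using range[OF X] range[OF Y] by (intro sum_mono abs_monomial_diff_le "is") simp_all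
  also have "\<dots> = ?C * (\<Sum>i<n. \<Sum>j<N. \<bar>X i j - Y i j\<bar>)"
    unfolding sum_distrib_left[symmetric] by (subst sum.swap) (rule refl)
  finally have "\<bar>(\<Sum>j<N. monomial is (\<lambda>i. X i j)) - (\<Sum>j<N. monomial is (\<lambda>i. Y i j))\<bar> / real N
      \<le> ?C * (\<Sum>i<n. \<Sum>j<N. \<bar>X i j - Y i j\<bar>) / real N"
    by (rule divide_right_mono) simp
  then show ?thesis
    by (simp add: kappa_def abs_divide flip: sum_divide_distrib diff_divide_distrib)
qed

lemma Delta_R_perturb:
  assumes X: "X \<in> Delta_R R \<mu> n N m d" and Y: "Y \<in> PiE {..<n} (\<lambda>_. PiE {..<N} (\<lambda>_. {-R..R}))"
    and close: "\<And>i. i < n \<Longrightarrow> kappa N (\<lambda>j. \<bar>X i j - Y i j\<bar>) \<le> \<eta>"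
    and \<delta>: "real m * max 1 R ^ m * (real n * \<eta>) + d \<le> \<delta>"
  shows "Y \<in> Delta_R R \<mu> n N m \<delta>"
  unfolding Delta_R_iff
proof (intro conjI ballI Y)
  fix "is" assume "is": "is \<in> index_lists m"
  have X_range: "X \<in> PiE {..<n} (\<lambda>_. PiE {..<N} (\<lambda>_. {-R..R}))" and gap: "moment_gap N X is < d"
    using X "is" unfolding Delta_R_iff by blast+
  let ?s = "\<Sum>i<n. kappa N (\<lambda>j. \<bar>X i j - Y i j\<bar>)"
  have "0 \<le> ?s"
    by (intro sum_nonneg) (simp add: kappa_def sum_nonneg)
  have "?s \<le> real n * \<eta>"
    using sum_bounded_above[of "{..<n}" "\<lambda>i. kappa N (\<lambda>j. \<bar>X i j - Y i j\<bar>)" \<eta>] close by simp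
  have "\<bar>kappa N (\<lambda>j. monomial is (\<lambda>i. X i j)) - kappa N (\<lambda>j. monomial is (\<lambda>i. Y i j))\<bar>
      \<le> real (length is) * max 1 R ^ length is * ?s"
    using "is" X_range Y by (intro abs_kappa_monomial_diff_le) (auto simp: index_lists_def)
  also have "\<dots> \<le> real m * max 1 R ^ m * (real n * \<eta>)"
    using "is" \<open>0 \<le> ?s\<close> \<open>?s \<le> real n * \<eta>\<close> by (intro mult_mono power_increasing) (auto simp: index_lists_def)
  finally show "moment_gap N Y is < \<delta>"
    using gap \<delta> unfolding moment_gap_def by linarith
qed

lemma rearrangementsD:
  assumes "s \<in> rearrangements X m \<delta> N"
  shows "s \<in> PiE {..<n} (\<lambda>_. perms N)" "(\<lambda>i\<in>{..<n}. act (s i) (X i)) \<in> Delta_R R \<mu> n N m \<delta>"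
    "i < n \<Longrightarrow> s i \<in> perms N"
  using assms by (auto simp: rearrangements_def)

lemma rearrangements_antimono:
  "m \<le> m' \<Longrightarrow> rearrangements X m' \<delta> N \<subseteq> rearrangements X m \<delta> N"
  by (auto simp: rearrangements_def Delta_R_iff index_lists_def)

lemma rearrangements_range:
  assumes s: "s \<in> rearrangements X m \<delta> N" and "i < n" "j < N"
  shows "X i j \<in> {-R..R}"
proof -
  note perm = rearrangementsD(3)[OF s \<open>i < n\<close>]
  have "(\<lambda>i\<in>{..<n}. act (s i) (X i)) \<in> PiE {..<n} (\<lambda>_. PiE {..<N} (\<lambda>_. {-R..R}))"
    using rearrangementsD(2)[OF s] by (simp add: Delta_R_iff)
  from PiE_mem[OF PiE_mem[OF this], of i "s i j"] show ?thesis
    using \<open>i < n\<close> perms_less[OF perm \<open>j < N\<close>] by (simp add: act_def perms_inverses[OF perm])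
qed

lemma rearrangements_moment:
  assumes s: "s \<in> rearrangements X m \<delta> N" and "i < n" "k \<in> {1..m}"
  shows "\<bar>kappa N (\<lambda>j. X i j ^ k) - (\<integral>t. t ^ k \<partial>marg \<mu> i)\<bar> < \<delta>"
proof -
  have "replicate k i \<in> index_lists m"
    using assms(2,3) by (auto simp: index_lists_def)
  then have "moment_gap N (\<lambda>i\<in>{..<n}. act (s i) (X i)) (replicate k i) < \<delta>"
    using rearrangementsD(2)[OF s] unfolding Delta_R_iff by blast
  moreover have "kappa N (\<lambda>j. act (s i) (X i) j ^ k) = kappa N (\<lambda>j. X i j ^ k)"
    unfolding act_def by (rule kappa_inv_perms[OF rearrangementsD(3)[OF s \<open>i < n\<close>]])
  ultimately show ?thesis
    using \<open>i < n\<close> by (simp add: moment_gap_def prod_list_replicate integral_marg)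
qed

lemma card_rearrangements_le_act:
  assumes \<tau>: "\<And>i. i < n \<Longrightarrow> \<tau> i \<in> perms N"
  shows "card (rearrangements X m \<delta> N) \<le> card (rearrangements (\<lambda>i. act (\<tau> i) (X i)) m \<delta> N)"
proof (rule card_inj_on_le[OF _ _ finite_rearrangements])
  let ?f = "\<lambda>s. \<lambda>i\<in>{..<n}. s i \<circ> inv (\<tau> i)"
  have cancel: "(s i \<circ> inv (\<tau> i)) \<circ> \<tau> i = s i" if "i < n" for i and s :: "nat \<Rightarrow> nat \<Rightarrow> nat"
    by (simp add: fun_eq_iff perms_inverses[OF \<tau>[OF that]])
  show "inj_on ?f (rearrangements X m \<delta> N)"
  proof (rule inj_on_inverseI)
    fix s assume s: "s \<in> rearrangements X m \<delta> N"
    show "(\<lambda>s. \<lambda>i\<in>{..<n}. s i \<circ> \<tau> i) (?f s) = s"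
      using cancel PiE_arb[OF rearrangementsD(1)[OF s]] by (auto simp: fun_eq_iff)
  qed
  show "?f ` rearrangements X m \<delta> N \<subseteq> rearrangements (\<lambda>i. act (\<tau> i) (X i)) m \<delta> N"
  proof (rule image_subsetI)
    fix s assume s: "s \<in> rearrangements X m \<delta> N"
    have perm: "s i \<circ> inv (\<tau> i) \<in> perms N" if "i < n" for i
      using rearrangementsD(3)[OF s that] inv_perms[OF \<tau>[OF that]] by (simp add: perms_def permutes_compose)
    have "act (s i \<circ> inv (\<tau> i)) (act (\<tau> i) (X i)) = act (s i) (X i)" if "i < n" for i
      unfolding act_act[OF perm[OF that] \<tau>[OF that]] cancel[OF that] ..
    then have "(\<lambda>i\<in>{..<n}. act (?f s i) (act (\<tau> i) (X i))) = (\<lambda>i\<in>{..<n}. act (s i) (X i))"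
      by (intro restrict_ext) simp
    then show "?f s \<in> rearrangements (\<lambda>i. act (\<tau> i) (X i)) m \<delta> N"
      using perm rearrangementsD(2)[OF s] by (simp add: rearrangements_def)
  qed
qed

lemma sorted_rearrangements_moments_close:
  assumes s: "s \<in> rearrangements X m d N" and "i < n" and sorted: "mono_on {..<N} (X i)"
    and \<xi>: "\<forall>k\<in>{1..m}. \<bar>kappa N (\<lambda>j. xi_vec \<Xi> i N j ^ k) - (\<integral>t. t ^ k \<partial>marg \<mu> i)\<bar> < e"
  shows "X i \<in> sorted_vectors R N" and "moments_close N m (d + e) (X i) (xi_vec \<Xi> i N)"
proof -
  show "X i \<in> sorted_vectors R N"
    using sorted rearrangements_range[OF s \<open>i < n\<close>] by (auto simp: sorted_vectors_def)
  show "moments_close N m (d + e) (X i) (xi_vec \<Xi> i N)"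
    unfolding moments_close_def
  proof
    fix k assume "k \<in> {1..m}"
    then show "\<bar>kappa N (\<lambda>j. X i j ^ k) - kappa N (\<lambda>j. xi_vec \<Xi> i N j ^ k)\<bar> < d + e"
      using rearrangements_moment[OF s \<open>i < n\<close>, of k] \<xi>[rule_format, of k] by linarith
  qed
qed

lemma rearrangements_subset_Delta_sym:
  assumes close: "\<And>i. i < n \<Longrightarrow> kappa N (\<lambda>j. \<bar>X i j - xi_vec \<Xi> i N j\<bar>) \<le> \<eta>"
    and \<delta>: "real m * max 1 R ^ m * (real n * \<eta>) + d \<le> \<delta>"
  shows "rearrangements X m d N \<subseteq> Delta_sym R \<mu> \<Xi> n N m \<delta>"
proof
  fix s assume s: "s \<in> rearrangements X m d N"
  have "(\<lambda>i\<in>{..<n}. act (s i) (xi_vec \<Xi> i N)) \<in> Delta_R R \<mu> n N m \<delta>"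
  proof (rule Delta_R_perturb[OF rearrangementsD(2)[OF s] _ _ \<delta>])
    show "(\<lambda>i\<in>{..<n}. act (s i) (xi_vec \<Xi> i N)) \<in> PiE {..<n} (\<lambda>_. PiE {..<N} (\<lambda>_. {-R..R}))"
      using rearrangementsD(3)[OF s] \<Xi>_range
      unfolding restrict_PiE_iff xi_vec_def by (intro ballI act_in_PiE) (auto simp: restrict_PiE_iff)
    show "kappa N (\<lambda>j. \<bar>(\<lambda>i\<in>{..<n}. act (s i) (X i)) i j - (\<lambda>i\<in>{..<n}. act (s i) (xi_vec \<Xi> i N)) i j\<bar>) \<le> \<eta>"
      if "i < n" for i
      using close[OF that] kappa_inv_perms[OF rearrangementsD(3)[OF s that],
          of "\<lambda>j. \<bar>X i j - xi_vec \<Xi> i N j\<bar>"] that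
      by (simp add: act_def)
  qed
  then show "s \<in> Delta_sym R \<mu> \<Xi> n N m \<delta>"
    using rearrangementsD(1)[OF s] by (simp add: Delta_sym_def)
qed

text \<open>Sorting the rows of \<open>X\<close> does not change the number of its rearrangements, and turns a row with almost
  the moments of \<open>\<mu>\<^sub>i\<close> into a vector close to \<open>\<xi>\<^sub>i(N)\<close>.\<close>

lemma card_rearrangements_le_Delta_sym:
  assumes "N > 0" "m \<le> m'" "m0 \<le> m'"
    and close: "\<And>x y. x \<in> sorted_vectors R N \<Longrightarrow> y \<in> sorted_vectors R N \<Longrightarrow> moments_close N m0 (2 * d) x y \<Longrightarrow>
      kappa N (\<lambda>j. \<bar>x j - y j\<bar>) < \<eta>"
    and \<xi>: "\<forall>i\<in>{..<n}. \<forall>k\<in>{1..m0}. \<bar>kappa N (\<lambda>j. xi_vec \<Xi> i N j ^ k) - (\<integral>t. t ^ k \<partial>marg \<mu> i)\<bar> < d"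
    and \<delta>: "real m * max 1 R ^ m * (real n * \<eta>) + d \<le> \<delta>"
  shows "card (rearrangements X m' d N) \<le> card (Delta_sym R \<mu> \<Xi> n N m \<delta>)"
proof -
  have "\<exists>\<sigma>. \<sigma> \<in> perms N \<and> mono_on {..<N} (act \<sigma> (X i))" for i
    by (rule ex_sorting_permutation[of N "X i"]) blast
  then obtain \<tau> where \<tau>: "\<And>i. \<tau> i \<in> perms N" "\<And>i. mono_on {..<N} (act (\<tau> i) (X i))" by metis
  let ?Y = "\<lambda>i. act (\<tau> i) (X i)"
  have "rearrangements ?Y m' d N \<subseteq> Delta_sym R \<mu> \<Xi> n N m \<delta>"
  proof
    fix s assume s: "s \<in> rearrangements ?Y m' d N"
    then have s0: "s \<in> rearrangements ?Y m0 d N"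
      using rearrangements_antimono[OF \<open>m0 \<le> m'\<close>] by blast
    have "kappa N (\<lambda>j. \<bar>?Y i j - xi_vec \<Xi> i N j\<bar>) \<le> \<eta>" if "i < n" for i
      using sorted_rearrangements_moments_close[OF s0 that \<tau>(2), of d] \<xi> that
      by (intro less_imp_le close xi_vec_sorted) simp_all
    then have "rearrangements ?Y m d N \<subseteq> Delta_sym R \<mu> \<Xi> n N m \<delta>"
      by (rule rearrangements_subset_Delta_sym[OF _ \<delta>])
    then show "s \<in> Delta_sym R \<mu> \<Xi> n N m \<delta>"
      using s rearrangements_antimono[OF \<open>m \<le> m'\<close>] by blast
  qed
  then have "card (rearrangements ?Y m' d N) \<le> card (Delta_sym R \<mu> \<Xi> n N m \<delta>)"
    by (intro card_mono) (simp add: Delta_sym_eq_rearrangements)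
  then show ?thesis
    using card_rearrangements_le_act[OF \<tau>(1), where X = X and m = m' and \<delta> = d]
    by (rule order_trans[rotated])
qed

lemma measure_typical_samples_le_Delta_sym_prob:
  assumes "\<delta> > 0"
  obtains m' d where "d > 0"
    "\<forall>\<^sub>F N in sequentially. measure (samples N) (typical_samples m' d N) \<le> Delta_sym_prob m \<delta> N"
proof -
  define C where "C = real m * max 1 R ^ m * real n"
  define \<eta> where "\<eta> = \<delta> / (2 * (C + 1))"
  have "0 \<le> C" by (simp add: C_def)
  then have "\<eta> > 0" "C * \<eta> \<le> \<delta> / 2" using \<open>\<delta> > 0\<close> by (simp_all add: \<eta>_def field_simps)
  obtain e m0 where "e > 0" and close: "\<And>N x y. N > 0 \<Longrightarrow> x \<in> sorted_vectors R N \<Longrightarrow> y \<in> sorted_vectors R N \<Longrightarrow>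
     moments_close N m0 e x y \<Longrightarrow> kappa N (\<lambda>j. \<bar>x j - y j\<bar>) < \<eta>"
    by (rule sorted_moments_close[OF R_pos \<open>\<eta> > 0\<close>]) (rule that)
  define d where "d = min (\<delta> / 2) (e / 2)"
  have "d > 0" "2 * d \<le> e" using \<open>\<delta> > 0\<close> \<open>e > 0\<close> by (simp_all add: d_def)
  have budget: "real m * max 1 R ^ m * (real n * \<eta>) + d \<le> \<delta>"
    using \<open>C * \<eta> \<le> \<delta> / 2\<close> by (simp add: C_def d_def mult.assoc)
  have "\<forall>\<^sub>F N in sequentially. measure (samples N) (typical_samples (max m m0) d N) \<le> Delta_sym_prob m \<delta> N"
    using xi_moments_eventually[OF \<open>d > 0\<close>, of m0] eventually_gt_at_top[of 0]
  proof eventually_elim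
    case (elim N)
    have close_d: "kappa N (\<lambda>j. \<bar>x j - y j\<bar>) < \<eta>"
      if "x \<in> sorted_vectors R N" "y \<in> sorted_vectors R N" "moments_close N m0 (2 * d) x y" for x y
    proof (rule close[OF elim(2) that(1,2)])
      show "moments_close N m0 e x y"
        using that(3) less_le_trans[OF _ \<open>2 * d \<le> e\<close>] unfolding moments_close_def by blast
    qed
    obtain X where "fact N ^ n * measure (samples N) (typical_samples (max m m0) d N)
        \<le> real (card (rearrangements X (max m m0) d N))"
      by (rule ex_many_rearrangements)
    also have "\<dots> \<le> real (card (Delta_sym R \<mu> \<Xi> n N m \<delta>))"
      by (intro of_nat_mono card_rearrangements_le_Delta_sym[OF elim(2) _ _ close_d elim(1) budget])
          simp_all
    finally show ?case
      by (simp add: Delta_sym_prob_def pos_le_divide_eq mult.commute)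
  qed
  with \<open>d > 0\<close> show ?thesis by (rule that)
qed

lemma Delta_sym_rate_ge:
  assumes S: "rel_entropy \<mu> \<nu> \<le> ereal S" and "N > 0"
    and pos: "0 < measure (joint_samples N) (typical_samples m' d N)"
    and typical_le: "measure (samples N) (typical_samples m' d N) \<le> Delta_sym_prob m \<delta> N"
  shows "ereal (- ((S + ln 2 / real N) / measure (joint_samples N) (typical_samples m' d N)))
      \<le> Delta_sym_rate m \<delta> N"
proof -
  let ?p = "measure (joint_samples N) (typical_samples m' d N)"
    and ?q = "measure (samples N) (typical_samples m' d N)"
  have "rel_entropy (joint_samples N) (samples N) \<le> ereal (real N) * ereal S"
    using rel_entropy_joint_samples_le ereal_mult_left_mono[OF S] by (rule order_trans) simp
  then have "rel_entropy (joint_samples N) (samples N) \<le> ereal (real N * S)"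
    by simp
  note bound =
    rel_entropy_event_bound[OF prob_space_joint_samples prob_space_samples _ this typical_samples_sets pos]
  have sets: "sets (joint_samples N) = sets (samples N)"
    by (simp add: joint_samples_def)
  have q: "0 < ?q" and "- ?p * ln ?q \<le> real N * S + ln 2"
    using bound[OF sets] by simp_all
  then have "- ln ?q \<le> (real N * S + ln 2) / ?p"
    using pos by (simp add: pos_le_divide_eq mult.commute)
  then have "- ((real N * S + ln 2) / ?p) / real N \<le> ln ?q / real N"
    by (intro divide_right_mono) simp_all
  also have "- ((real N * S + ln 2) / ?p) / real N = - ((S + ln 2 / real N) / ?p)"
    using \<open>N > 0\<close> pos by (simp add: field_simps)
  also have "ln ?q / real N \<le> ln (Delta_sym_prob m \<delta> N) / real N"
    using q typical_le by (intro divide_right_mono ln_mono) simp_all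
  finally show ?thesis
    using less_le_trans[OF q typical_le] by (simp add: Delta_sym_rate_eq)
qed

theorem Isym_le_rel_entropy: "Isym R n \<mu> \<Xi> \<le> rel_entropy \<mu> \<nu>"
proof (rule ereal_le_real)
  fix S assume S: "rel_entropy \<mu> \<nu> \<le> ereal S"
  have "ereal (- S) \<le> limsup (Delta_sym_rate m \<delta>)" if "\<delta> > 0" for m \<delta>
  proof -
    obtain m' d where "d > 0" and samples_le: "\<forall>\<^sub>F N in sequentially.
        measure (samples N) (typical_samples m' d N) \<le> Delta_sym_prob m \<delta> N"
      by (rule measure_typical_samples_le_Delta_sym_prob[OF \<open>\<delta> > 0\<close>])
    define p where "p N = measure (joint_samples N) (typical_samples m' d N)" for N
    have p: "p \<longlonglongrightarrow> 1"
      unfolding p_def by (rule measure_typical_joint_samples_tendsto[OF \<open>d > 0\<close>])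
    then have "(\<lambda>N. - ((S + ln 2 / real N) / p N)) \<longlonglongrightarrow> - ((S + 0) / 1)"
      by (intro tendsto_intros lim_const_over_n) simp_all
    then have "(\<lambda>N. ereal (- ((S + ln 2 / real N) / p N))) \<longlonglongrightarrow> ereal (- S)"
      by simp
    then have "ereal (- S) = limsup (\<lambda>N. ereal (- ((S + ln 2 / real N) / p N)))"
      by (rule lim_imp_Limsup[symmetric, rotated]) simp
    also have "\<dots> \<le> limsup (Delta_sym_rate m \<delta>)"
    proof (rule Limsup_mono)
      have "\<forall>\<^sub>F N in sequentially. p N > 0"
        using p by (rule order_tendstoD) simp
      with samples_le eventually_gt_at_top[of 0]
      show "\<forall>\<^sub>F N in sequentially. ereal (- ((S + ln 2 / real N) / p N)) \<le> Delta_sym_rate m \<delta> N"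
        by eventually_elim (simp add: p_def Delta_sym_rate_ge[OF S])
    qed
    finally show ?thesis .
  qed
  then have "ereal (- S) \<le> (INF m. INF \<delta>\<in>{0<..}. limsup (Delta_sym_rate m \<delta>))"
    by (intro INF_greatest) simp
  then show "Isym R n \<mu> \<Xi> \<le> ereal S"
    unfolding Isym_eq by (simp add: ereal_uminus_le_reorder)
qed

corollary Isym_cal_eq: "Isym_cal R n \<mu> \<Xi> = rel_entropy \<mu> \<nu>"
  using rel_entropy_le_Isym_cal Isym_cal_le_Isym Isym_le_rel_entropy by (meson order_trans antisym)

corollary Isym_eq_rel_entropy: "Isym R n \<mu> \<Xi> = rel_entropy \<mu> \<nu>"
  using Isym_cal_le_Isym Isym_le_rel_entropy by (simp add: Isym_cal_eq antisym)

end

theorem theorem3p5: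
  fixes R :: real and n :: nat and \<mu> :: "(nat \<Rightarrow> real) measure"
    and \<Xi> :: "nat \<Rightarrow> nat \<Rightarrow> nat \<Rightarrow> real"
  assumes "R > 0"
    and "\<mu> \<in> Prob_cube R n"
    and "approx_seq R n \<mu> \<Xi>"
  shows "bg_entropy (lebn n) \<mu> = - Isym_cal R n \<mu> \<Xi> + (\<Sum>i<n. bg_entropy lborel (marg \<mu> i)) \<and>
         ((\<forall>i<n. bg_entropy lborel (marg \<mu> i) > -\<infinity>) \<longrightarrow>
           Isym_cal R n \<mu> \<Xi> = Isym R n \<mu> \<Xi> \<and>
           Isym R n \<mu> \<Xi> = rel_entropy \<mu> (PiM {..<n} (\<lambda>i. marg \<mu> i)) \<and>
           (Isym_cal R n \<mu> \<Xi> = 0 \<longleftrightarrow> \<mu> = PiM {..<n} (\<lambda>i. marg \<mu> i)))"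
proof -
  interpret approximating_sequence \<mu> R n \<Xi>
    using assms by (intro approximating_sequence.intro cube_prob_space.intro
        cube_prob_space_axioms.intro approximating_sequence_axioms.intro) (simp_all add: Prob_cube_def)
  have "Isym_cal R n \<mu> \<Xi> = 0 \<longleftrightarrow> \<mu> = \<nu>"
    unfolding Isym_cal_eq by (rule rel_entropy_eq_0_iff[OF prob_space_axioms prob_space_\<nu>])
  then show ?thesis
    using bg_entropy_eq_minus_rel_entropy_marginals[OF R_pos]
    by (simp add: Isym_cal_eq Isym_eq_rel_entropy \<nu>_def)
qed

end
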